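(* Let $N\ge2$, let $k,\ell\ge1$ be integers and let $p\in[1,\infty)$. Let $$W^{k,\ell,p}(\mathbb R^N;\partial\mathbb R^N_+)=\left\{u\in W^{k,p}(\mathbb R^N)\,:\,u_{|\partial\mathbb R^N_+}\in W^{\ell,p}(\partial\mathbb R^N_+)\right\},$$ endowed with the norm of the pair $(u,u_{|\partial\mathbb R^N_+})$ in the product space $W^{k,p}(\mathbb R^N)\times W^{\ell,p}(\partial\mathbb R^N_+)$, where $u_{|\partial\mathbb R^N_+}$ denotes the trace of $u$ on the hyperplane $\partial\mathbb R^N_+=\{x_N=0\}$. Then for any $u\in W^{k,\ell,p}(\mathbb R^N;\partial\mathbb R^N_+)$ there exists a sequence $(u_n)_{n\ge1}$ in $W^{k,\ell,p}(\mathbb R^N;\partial\mathbb R^N_+)\cap C^\infty(\mathbb R^N)$ such that $$\mathrm{supp}\,u_n\subseteq \mathrm{supp}\,u+\overline{B_{1/n}(\mathbb R^N)}\quad\text{for all } n\ge 1,$$ and $u_n\to u$ in $W^{k,\ell,p}(\mathbb R^N;\partial\mathbb R^N_+)$ as $n\to\infty$.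
   Context: Points of $\mathbb R^N$ are written $x=(x',x_N)$ with $x'\in\mathbb R^{N-1}$, $x_N\in\mathbb R$; $\mathbb R^N_+=\{x\in\mathbb R^N: x_N>0\}$ and $\partial\mathbb R^N_+=\{(x',0):x'\in\mathbb R^{N-1}\}$. The space $W^{\ell,p}(\partial\mathbb R^N_+)$ is identified with $W^{\ell,p}(\mathbb R^{N-1})$ via $(x',0)\leftrightarrow x'$. The trace $u_{|\partial\mathbb R^N_+}$ is the usual trace operator on $W^{k,p}(\mathbb R^N)$, $k\ge1$; it is the ordinary restriction when $u$ is continuous. $B_r(\mathbb R^N)$ is the open ball of radius $r$ centred at $0$ in $\mathbb R^N$. The support of a measurable function (class) is the complement of the largest open set on which it vanishes almost everywhere, and $A+B$ denotes the Minkowski sum of sets. *)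

theory Defs
  imports "HOL-Analysis.Analysis" "HOL-Library.Set_Algebras"
begin

text \<open>
  The space of dimension $N \ge 2$ is the type \<^typ>\<open>'a::euclidean_space \<times> real\<close>, whose elements are the
  pairs $(x', x_N)$; its hyperplane $x_N = 0$ is identified with \<^typ>\<open>'a\<close> via
  $(x', 0) \leftrightarrow x'$. Elements of $L^p$ and of Sobolev spaces are represented by Borel
  functions. The notions below do not depend on the representative, up to equality almost everywhere.
\<close>

section \<open>Classical partial derivatives and test functions\<close>

definition partial_deriv ::
    "'a::euclidean_space \<Rightarrow> ('a \<Rightarrow> real) \<Rightarrow> 'a \<Rightarrow> real" where
  "partial_deriv i f x = deriv (\<lambda>t. f (x + t *\<^sub>R i)) 0"

definition iter_partial_deriv ::
    "'a::euclidean_space list \<Rightarrow> ('a \<Rightarrow> real) \<Rightarrow> 'a \<Rightarrow> real" where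
  "iter_partial_deriv is f = foldr partial_deriv is f"

definition C_infinity :: "('a::euclidean_space \<Rightarrow> real) set" where
  "C_infinity =
     {f. \<forall>is \<in> lists Basis. iter_partial_deriv is f differentiable_on UNIV}"

definition test_function :: "('a::euclidean_space \<Rightarrow> real) \<Rightarrow> bool" where
  "test_function \<phi> \<longleftrightarrow> \<phi> \<in> C_infinity \<and> compact (closure {x. \<phi> x \<noteq> 0})"

text \<open>A multi-index assigns an order of differentiation to each basis vector.\<close>

definition multi_indices :: "nat \<Rightarrow> ('a::euclidean_space \<Rightarrow> nat) set" where
  "multi_indices k = {\<alpha>. (\<forall>i. i \<notin> Basis \<longrightarrow> \<alpha> i = 0) \<and> (\<Sum>i\<in>Basis. \<alpha> i) \<le> k}"

text \<open>
  The derivative of order \<open>\<alpha>\<close> is taken along some list of basis vectors in which each \<open>i\<close> occurs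
  \<open>\<alpha> i\<close> times. For smooth functions the order in that list is irrelevant, by Schwarz's theorem.
\<close>

definition multi_deriv ::
    "('a::euclidean_space \<Rightarrow> nat) \<Rightarrow> ('a \<Rightarrow> real) \<Rightarrow> 'a \<Rightarrow> real" where
  "multi_deriv \<alpha> f = iter_partial_deriv (SOME is. \<forall>i. count_list is i = \<alpha> i) f"

section \<open>Lebesgue and Sobolev spaces\<close>

definition Lp_space :: "real \<Rightarrow> ('a::euclidean_space \<Rightarrow> real) set" where
  "Lp_space p =
     {f. f \<in> borel_measurable borel \<and> integrable lborel (\<lambda>x. \<bar>f x\<bar> powr p)}"

definition Lp_norm :: "real \<Rightarrow> ('a::euclidean_space \<Rightarrow> real) \<Rightarrow> real" where
  "Lp_norm p f = (\<integral>x. \<bar>f x\<bar> powr p \<partial>lborel) powr (1 / p)"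

definition locally_integrable :: "('a::euclidean_space \<Rightarrow> real) \<Rightarrow> bool" where
  "locally_integrable f \<longleftrightarrow> (\<forall>K. compact K \<longrightarrow> set_integrable lborel K f)"

definition has_weak_deriv ::
    "('a::euclidean_space \<Rightarrow> nat) \<Rightarrow> ('a \<Rightarrow> real) \<Rightarrow> ('a \<Rightarrow> real) \<Rightarrow> bool" where
  "has_weak_deriv \<alpha> u v \<longleftrightarrow>
     locally_integrable u \<and> locally_integrable v \<and>
     (\<forall>\<phi>. test_function \<phi> \<longrightarrow>
        (\<integral>x. u x * multi_deriv \<alpha> \<phi> x \<partial>lborel) =
        (-1) ^ (\<Sum>i\<in>Basis. \<alpha> i) * (\<integral>x. v x * \<phi> x \<partial>lborel))"

definition weak_deriv ::
    "('a::euclidean_space \<Rightarrow> nat) \<Rightarrow> ('a \<Rightarrow> real) \<Rightarrow> 'a \<Rightarrow> real" where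
  "weak_deriv \<alpha> u = (SOME v. has_weak_deriv \<alpha> u v)"

definition sobolev_space :: "nat \<Rightarrow> real \<Rightarrow> ('a::euclidean_space \<Rightarrow> real) set" where
  "sobolev_space k p =
     {u \<in> Lp_space p. \<forall>\<alpha> \<in> multi_indices k. \<exists>v \<in> Lp_space p. has_weak_deriv \<alpha> u v}"

definition sobolev_norm :: "nat \<Rightarrow> real \<Rightarrow> ('a::euclidean_space \<Rightarrow> real) \<Rightarrow> real" where
  "sobolev_norm k p u =
     (\<Sum>\<alpha> \<in> multi_indices k. Lp_norm p (weak_deriv \<alpha> u) powr p) powr (1 / p)"

section \<open>The trace on the hyperplane\<close>

text \<open>
  The trace operator is the continuous extension to $W^{1,p}$, with values in $L^p$ of the
  hyperplane, of the restriction map on test functions, which are dense in $W^{1,p}$ for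
  $1 \le p < \infty$.
\<close>

definition has_trace ::
    "real \<Rightarrow> ('a::euclidean_space \<times> real \<Rightarrow> real) \<Rightarrow> ('a \<Rightarrow> real) \<Rightarrow> bool" where
  "has_trace p u g \<longleftrightarrow>
     u \<in> sobolev_space 1 p \<and> g \<in> Lp_space p \<and>
     (\<exists>\<phi> :: nat \<Rightarrow> 'a \<times> real \<Rightarrow> real. (\<forall>n. test_function (\<phi> n)) \<and>
        (\<lambda>n. sobolev_norm 1 p (\<lambda>x. \<phi> n x - u x)) \<longlonglongrightarrow> 0 \<and>
        (\<lambda>n. Lp_norm p (\<lambda>x'. \<phi> n (x', 0) - g x')) \<longlonglongrightarrow> 0)"

definition hyperplane_trace ::
    "real \<Rightarrow> ('a::euclidean_space \<times> real \<Rightarrow> real) \<Rightarrow> 'a \<Rightarrow> real" where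
  "hyperplane_trace p u = (SOME g. has_trace p u g)"

definition trace_sobolev_space ::
    "nat \<Rightarrow> nat \<Rightarrow> real \<Rightarrow> ('a::euclidean_space \<times> real \<Rightarrow> real) set" where
  "trace_sobolev_space k l p =
     {u \<in> sobolev_space k p. hyperplane_trace p u \<in> sobolev_space l p}"

definition trace_sobolev_norm ::
    "nat \<Rightarrow> nat \<Rightarrow> real \<Rightarrow> ('a::euclidean_space \<times> real \<Rightarrow> real) \<Rightarrow> real" where
  "trace_sobolev_norm k l p u =
     sobolev_norm k p u + sobolev_norm l p (hyperplane_trace p u)"

section \<open>Support of a measurable function\<close>

text \<open>
  The union below is itself an open set on which \<open>f\<close> vanishes almost everywhere, since the topology
  is second countable.
\<close>

definition ae_support :: "('a::euclidean_space \<Rightarrow> real) \<Rightarrow> 'a set" where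
  "ae_support f = - \<Union>{U. open U \<and> (AE x in lborel. x \<in> U \<longrightarrow> f x = 0)}"

end

theory Submission
  imports Defs
begin

text \<open>
  A convolution with an isotropic kernel averages $u$ over neighbouring hyperplanes, on which nothing
  is known beyond $W^{k,p}$. The approximation is therefore $(\rho \otimes \eta_\delta) * u$, where
  $\rho$ mollifies in the tangential directions and $\eta_\delta$ mollifies in the normal direction on a scale
  $\delta$ that is chosen after $\rho$. Its restriction to the hyperplane is $\rho * A_\delta u$, where
  $A_\delta u$ averages $u$ over $0 < x_N < \delta$. If $g$ is the trace of $u$, then
  \[ D^\beta (\rho * A_\delta u) - D^\beta g
    = D^\beta \rho * (A_\delta u - g) + (\rho * D^\beta g - D^\beta g). \]
  The second term is small if $\rho$ is concentrated near the origin. For fixed $\rho$, the first one is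
  at most $\|D^\beta \rho\|_1 \|A_\delta u - g\|_p$, and $A_\delta u - g$ is an integral of $\partial_N u$
  over a slab of width $\delta$, which tends to $0$.
\<close>

section \<open>Smooth functions\<close>

text \<open>Mollification converges in L^p with one radius for all nonnegative kernels of mass one
  supported in the ball of that radius, whatever their shape. So the tangential and normal scales
  may differ arbitrarily without harm to the W^(k,p) part, and the normal one can be chosen last.
  \<open>hyperplane_trace\<close> is an arbitrary choice among limits of restrictions, so it has to
  be computed before it can be estimated. Let H be the tail integral of the density a of the normal
  average. Integration by parts on each fibre expresses the boundary value of a smooth function as
  the a-average of the function minus the H-weighted integral of its normal derivative. Both terms
  are continuous in L^p, so with density of test functions the formula passes to W^(1,p) and gives
  existence, uniqueness and linearity of the trace. Since the same a enters the mollifier, the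
  distance between the average and the trace is exactly the H-term. The normal kernel is reflected,
  so that the convolution at x_N = 0 sees only the side x_N > 0.\<close>

lemma iter_partial_deriv_Nil [simp]: "iter_partial_deriv [] f = f"
  by (simp add: iter_partial_deriv_def)

lemma iter_partial_deriv_Cons [simp]:
  "iter_partial_deriv (i # is) f = partial_deriv i (iter_partial_deriv is f)"
  by (simp add: iter_partial_deriv_def)

lemma iter_partial_deriv_append:
  "iter_partial_deriv (is @ js) f = iter_partial_deriv is (iter_partial_deriv js f)"
  by (simp add: iter_partial_deriv_def)

text \<open>\<open>C_infinity\<close> is the largest set of differentiable functions stable under
  partial derivatives along \<open>Basis\<close>, so membership follows from any such set containing
  \<open>f\<close>. The choice of \<open>S\<close> replaces an explicit formula for higher
  derivatives.\<close>

lemma C_infinity_coinduct: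
  assumes "f \<in> S" "\<And>g. g \<in> S \<Longrightarrow> g differentiable_on UNIV"
    and "\<And>g i. g \<in> S \<Longrightarrow> i \<in> Basis \<Longrightarrow> partial_deriv i g \<in> S"
  shows "f \<in> C_infinity"
proof -
  have "iter_partial_deriv is f \<in> S" if "is \<in> lists Basis" for "is"
    using that by (induction "is") (use assms in auto)
  then show ?thesis
    using assms(2) by (auto simp: C_infinity_def)
qed

lemma C_infinity_differentiable: "f \<in> C_infinity \<Longrightarrow> f differentiable (at x)"
  unfolding C_infinity_def differentiable_on_def by (auto dest: bspec[of _ _ "[]"])

lemma C_infinity_differentiable_on: "f \<in> C_infinity \<Longrightarrow> f differentiable_on UNIV"
  by (simp add: C_infinity_differentiable differentiable_at_imp_differentiable_on)

lemma C_infinity_continuous_on: "f \<in> C_infinity \<Longrightarrow> continuous_on A f"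
  by (meson C_infinity_differentiable_on continuous_on_subset differentiable_imp_continuous_on
      subset_UNIV)

lemma C_infinity_measurable [measurable_dest]: "f \<in> C_infinity \<Longrightarrow> f \<in> borel_measurable borel"
  by (simp add: C_infinity_continuous_on borel_measurable_continuous_onI)

lemma C_infinity_iter_partial_deriv:
  "f \<in> C_infinity \<Longrightarrow> is \<in> lists Basis \<Longrightarrow> iter_partial_deriv is f \<in> C_infinity"
  unfolding C_infinity_def by (auto simp flip: iter_partial_deriv_append)

lemma C_infinity_partial_deriv:
  "f \<in> C_infinity \<Longrightarrow> i \<in> Basis \<Longrightarrow> partial_deriv i f \<in> C_infinity"
  using C_infinity_iter_partial_deriv[of f "[i]"] by simp

lemma partial_deriv_eq:
  assumes "(f has_derivative D) (at x)"
  shows "((\<lambda>t. f (x + t *\<^sub>R i)) has_real_derivative D i) (at 0)" "partial_deriv i f x = D i"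
proof -
  have "((\<lambda>t. x + t *\<^sub>R i) has_derivative (\<lambda>t. t *\<^sub>R i)) (at 0)"
    by (auto intro!: derivative_eq_intros)
  then have "((\<lambda>t. f (x + t *\<^sub>R i)) has_derivative (\<lambda>t. D (t *\<^sub>R i))) (at 0)"
    by (rule has_derivative_compose) (use assms in simp)
  moreover have "(\<lambda>t. D (t *\<^sub>R i)) = (*) (D i)"
    by (simp add: fun_eq_iff linear_cmul[OF has_derivative_linear[OF assms]])
  ultimately show "((\<lambda>t. f (x + t *\<^sub>R i)) has_real_derivative D i) (at 0)"
    by (simp add: has_field_derivative_def)
  then show "partial_deriv i f x = D i"
    by (simp add: partial_deriv_def DERIV_imp_deriv)
qed

text \<open>The definition of \<open>C_infinity\<close> asks for total differentiability, so a
  derivative exists; by linearity it is determined by its values on the basis vectors, which are the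
  partial derivatives.\<close>

lemma C_infinity_has_derivative:
  assumes "f \<in> C_infinity"
  shows "(f has_derivative (\<lambda>h. \<Sum>i\<in>Basis. (h \<bullet> i) * partial_deriv i f x)) (at x)"
proof -
  obtain D where D: "(f has_derivative D) (at x)"
    using C_infinity_differentiable[OF assms] differentiable_def by blast
  have "D h = (\<Sum>i\<in>Basis. (h \<bullet> i) * partial_deriv i f x)" for h
    unfolding partial_deriv_eq(2)[OF D] using linear_sum[OF has_derivative_linear[OF D], of "\<lambda>i. (h \<bullet> i) *\<^sub>R i" Basis]
    by (simp add: euclidean_representation linear_cmul[OF has_derivative_linear[OF D]])
  then have "D = (\<lambda>h. \<Sum>i\<in>Basis. (h \<bullet> i) * partial_deriv i f x)"
    by (rule ext)
  with D show ?thesis by simp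
qed

lemma sum_inner_Basis_mult:
  assumes "i \<in> Basis"
  shows "(\<Sum>j\<in>Basis. (i \<bullet> j) * g j) = (g i :: real)"
proof -
  have "(\<Sum>j\<in>Basis. (i \<bullet> j) * g j) = (\<Sum>j\<in>Basis. if j = i then g j else 0)"
    using assms by (intro sum.cong) (auto simp: inner_Basis)
  then show ?thesis using assms by simp
qed

lemma C_infinity_DERIV_line:
  assumes "f \<in> C_infinity"
  shows "((\<lambda>t. f (x + t *\<^sub>R h)) has_real_derivative
    (\<Sum>i\<in>Basis. (h \<bullet> i) * partial_deriv i f (x + t *\<^sub>R h))) (at t)"
proof -
  let ?D = "\<lambda>h. \<Sum>j\<in>Basis. (h \<bullet> j) * partial_deriv j f (x + t *\<^sub>R h)"
  have "((\<lambda>s. x + s *\<^sub>R h) has_derivative (\<lambda>s. s *\<^sub>R h)) (at t)"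
    by (auto intro!: derivative_eq_intros)
  then have "((\<lambda>s. f (x + s *\<^sub>R h)) has_derivative
      (\<lambda>s. \<Sum>j\<in>Basis. (s *\<^sub>R h \<bullet> j) * partial_deriv j f (x + t *\<^sub>R h))) (at t)"
    by (rule has_derivative_compose) (rule C_infinity_has_derivative[OF assms(1)])
  moreover have "(\<lambda>s. \<Sum>j\<in>Basis. (s *\<^sub>R h \<bullet> j) * partial_deriv j f (x + t *\<^sub>R h)) = (*) (?D h)"
    by (auto simp: sum_distrib_right sum_distrib_left mult_ac intro!: sum.cong)
  ultimately show ?thesis
    by (simp add: has_field_derivative_def)
qed

lemma C_infinity_has_real_derivative:
  assumes "f \<in> C_infinity" "i \<in> Basis"
  shows "((\<lambda>t. f (x + t *\<^sub>R i)) has_real_derivative partial_deriv i f (x + t *\<^sub>R i)) (at t)"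
  using C_infinity_DERIV_line[OF assms(1), of x i t]
  unfolding sum_inner_Basis_mult[OF assms(2)] .

lemma partial_deriv_const [simp]: "partial_deriv i (\<lambda>x. c) = (\<lambda>x. 0)"
  by (auto simp: partial_deriv_def)

lemma C_infinity_const [simp, intro]: "(\<lambda>x. c) \<in> C_infinity"
  by (rule C_infinity_coinduct[of _ "{\<lambda>x. c |c. True}"]) auto

lemma partial_deriv_mult:
  assumes "f \<in> C_infinity" "g \<in> C_infinity" "i \<in> Basis"
  shows "partial_deriv i (\<lambda>x. f x * g x) = (\<lambda>x. partial_deriv i f x * g x + f x * partial_deriv i g x)"
proof
  fix x
  have "((\<lambda>t. f (x + t *\<^sub>R i) * g (x + t *\<^sub>R i)) has_real_derivative
     partial_deriv i f x * g x + f x * partial_deriv i g x) (at 0)"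
    using C_infinity_has_real_derivative[OF assms(1,3), of x 0]
      C_infinity_has_real_derivative[OF assms(2,3), of x 0]
    by (auto intro!: derivative_eq_intros)
  then show "partial_deriv i (\<lambda>x. f x * g x) x = partial_deriv i f x * g x + f x * partial_deriv i g x"
    unfolding partial_deriv_def by (rule DERIV_imp_deriv)
qed

lemma partial_deriv_add:
  assumes "f differentiable_on UNIV" "g differentiable_on UNIV"
  shows "partial_deriv i (\<lambda>x. f x + g x) = (\<lambda>x. partial_deriv i f x + partial_deriv i g x)"
proof
  fix x
  obtain D D' where "(f has_derivative D) (at x)" "(g has_derivative D') (at x)"
    using assms by (metis UNIV_I differentiable_def differentiable_on_def)
  then show "partial_deriv i (\<lambda>x. f x + g x) x = partial_deriv i f x + partial_deriv i g x"
    using partial_deriv_eq(2)[OF has_derivative_add[of f D _ g D'], of x i]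
    by (simp add: partial_deriv_eq(2))
qed

lemma C_infinity_mult:
  assumes "f \<in> C_infinity" "g \<in> C_infinity"
  shows "(\<lambda>x. f x * g x) \<in> C_infinity"
proof -
  \<comment> \<open>Single products are not stable under differentiation, since the product rule
    yields two of them; finite sums of products are.\<close>
  define S where "S = {\<lambda>x. \<Sum>(f, g)\<leftarrow>fs. f x * g x |fs. set fs \<subseteq> C_infinity \<times> (C_infinity :: ('a \<Rightarrow> real) set)}"
  have mult: "(\<lambda>x. f x * g x) \<in> S" if "f \<in> C_infinity" "g \<in> C_infinity" for f g :: "'a \<Rightarrow> real"
    unfolding S_def using that by (intro CollectI exI[of _ "[(f, g)]"]) auto
  have add: "(\<lambda>x. f x + g x) \<in> S" if fg: "f \<in> S" "g \<in> S" for f g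
  proof -
    obtain fs gs where "set fs \<subseteq> C_infinity \<times> C_infinity" "set gs \<subseteq> C_infinity \<times> C_infinity"
      "f = (\<lambda>x. \<Sum>(f, g)\<leftarrow>fs. f x * g x)" "g = (\<lambda>x. \<Sum>(f, g)\<leftarrow>gs. f x * g x)"
      using fg unfolding S_def by blast
    then show ?thesis
      unfolding S_def by (intro CollectI exI[of _ "fs @ gs"]) auto
  qed
  have diff: "(\<lambda>x. \<Sum>(f, g)\<leftarrow>fs. f x * g x) differentiable_on UNIV"
    if "set fs \<subseteq> C_infinity \<times> C_infinity" for fs :: "(('a \<Rightarrow> real) \<times> ('a \<Rightarrow> real)) list"
    using that
    by (induction fs)
      (auto intro!: differentiable_on_add differentiable_on_mult intro: C_infinity_differentiable_on)
  show ?thesis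
  proof (rule C_infinity_coinduct[of _ S])
    show "(\<lambda>x. f x * g x) \<in> S" using mult assms .
    show "g differentiable_on UNIV" if "g \<in> S" for g
      using that diff unfolding S_def by auto
    show "partial_deriv i g \<in> S" if "g \<in> S" "i \<in> Basis" for g i
    proof -
      obtain fs where fs: "set fs \<subseteq> C_infinity \<times> C_infinity" "g = (\<lambda>x. \<Sum>(f, g)\<leftarrow>fs. f x * g x)"
        using \<open>g \<in> S\<close> unfolding S_def by auto
      have "partial_deriv i (\<lambda>x. \<Sum>(f, g)\<leftarrow>fs. f x * g x) \<in> S"
        using fs(1)
      proof (induction fs)
        case Nil
        then show ?case using mult[of "\<lambda>x. 0" "\<lambda>x. 0"] by simp
      next
        case (Cons fg fs)
        obtain f g where fg: "fg = (f, g)" "f \<in> C_infinity" "g \<in> C_infinity"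
          using Cons.prems by auto
        have "partial_deriv i (\<lambda>x. f x * g x) \<in> S"
          unfolding partial_deriv_mult[OF fg(2,3) \<open>i \<in> Basis\<close>]
          by (intro add mult fg C_infinity_partial_deriv \<open>i \<in> Basis\<close>)
        moreover have "partial_deriv i (\<lambda>x. \<Sum>(f, g)\<leftarrow>fg # fs. f x * g x) =
            (\<lambda>x. partial_deriv i (\<lambda>x. f x * g x) x + partial_deriv i (\<lambda>x. \<Sum>(f, g)\<leftarrow>fs. f x * g x) x)"
          using diff[of fs] Cons.prems fg
          by (simp add: partial_deriv_add C_infinity_differentiable_on differentiable_on_mult)
        ultimately show ?case
          using Cons add by auto
      qed
      then show ?thesis using fs by simp
    qed
  qed
qed

lemma C_infinity_add:
  assumes "f \<in> C_infinity" "g \<in> C_infinity"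
  shows "(\<lambda>x. f x + g x) \<in> C_infinity"
proof (rule C_infinity_coinduct[of _ "{\<lambda>x. f x + g x |f g. f \<in> C_infinity \<and> g \<in> C_infinity}"])
  show "partial_deriv i h \<in> {\<lambda>x. f x + g x |f g. f \<in> C_infinity \<and> g \<in> C_infinity}"
    if "h \<in> {\<lambda>x. f x + g x |f g. f \<in> C_infinity \<and> g \<in> C_infinity}" "i \<in> Basis" for h :: "'a \<Rightarrow> real" and i
    using that by (auto simp: partial_deriv_add C_infinity_differentiable_on)
      (use C_infinity_partial_deriv in blast)
  show "(\<lambda>x. f x + g x) \<in> {\<lambda>x. f x + g x |f g. f \<in> C_infinity \<and> g \<in> C_infinity}"
    using assms by blast
qed (auto intro!: differentiable_on_add intro: C_infinity_differentiable_on)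

lemma C_infinity_sum:
  "(\<And>i. i \<in> I \<Longrightarrow> f i \<in> C_infinity) \<Longrightarrow> (\<lambda>x. \<Sum>i\<in>I. f i x) \<in> C_infinity"
  by (induction I rule: infinite_finite_induct) (auto intro: C_infinity_add)

lemma C_infinity_prod:
  "(\<And>i. i \<in> I \<Longrightarrow> f i \<in> C_infinity) \<Longrightarrow> (\<lambda>x. \<Prod>i\<in>I. f i x) \<in> C_infinity"
  by (induction I rule: infinite_finite_induct) (auto intro: C_infinity_mult)

lemma C_infinity_cmult: "f \<in> C_infinity \<Longrightarrow> (\<lambda>x. c * f x) \<in> C_infinity"
  by (intro C_infinity_mult) auto

section \<open>Affine changes of variable\<close>

lemma has_derivative_compose_affine:
  fixes L :: "'a::euclidean_space \<Rightarrow> 'b::euclidean_space"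
  assumes "f \<in> C_infinity" "linear L"
  shows "((\<lambda>x. f (c + L x)) has_derivative
     (\<lambda>h. \<Sum>j\<in>Basis. (L h \<bullet> j) * partial_deriv j f (c + L x))) (at x)"
proof -
  have "((\<lambda>x. c + L x) has_derivative L) (at x)"
    using has_derivative_add[OF has_derivative_const linear_imp_has_derivative[OF assms(2)]] by simp
  then show ?thesis
    by (rule has_derivative_compose) (rule C_infinity_has_derivative[OF assms(1)])
qed

lemma partial_deriv_compose_affine:
  fixes L :: "'a::euclidean_space \<Rightarrow> 'b::euclidean_space"
  assumes "f \<in> C_infinity" "linear L"
  shows "partial_deriv i (\<lambda>x. f (c + L x)) = (\<lambda>x. \<Sum>j\<in>Basis. (L i \<bullet> j) * partial_deriv j f (c + L x))"
  using partial_deriv_eq(2)[OF has_derivative_compose_affine[OF assms]] by auto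

text \<open>The functions f (c + L x) with smooth f are stable under differentiation, because the
  derivative is a linear combination of partial derivatives of f composed with the same affine map.
  Instances are reflections, dilations, coordinate projections and the inclusions of fibres and of
  the hyperplane.\<close>

lemma C_infinity_compose_affine:
  fixes L :: "'a::euclidean_space \<Rightarrow> 'b::euclidean_space"
  assumes "f \<in> C_infinity" "linear L"
  shows "(\<lambda>x. f (c + L x)) \<in> C_infinity"
proof (rule C_infinity_coinduct[of _ "{\<lambda>x. f (c + L x) |f. f \<in> C_infinity}"])
  show "partial_deriv i g \<in> {\<lambda>x. f (c + L x) |f. f \<in> C_infinity}"
    if "g \<in> {\<lambda>x. f (c + L x) |f. f \<in> C_infinity}" "i \<in> Basis" for g i
  proof -
    obtain f where f: "f \<in> C_infinity" "g = (\<lambda>x. f (c + L x))" using \<open>g \<in> _\<close> by auto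
    have "(\<lambda>x. \<Sum>j\<in>Basis. (L i \<bullet> j) * partial_deriv j f x) \<in> C_infinity"
      by (intro C_infinity_sum C_infinity_cmult C_infinity_partial_deriv f)
    then show ?thesis
      unfolding f(2) partial_deriv_compose_affine[OF f(1) \<open>linear L\<close>]
      by (intro CollectI exI[of _ "\<lambda>x. \<Sum>j\<in>Basis. (L i \<bullet> j) * partial_deriv j f x"]) auto
  qed
qed (use assms has_derivative_compose_affine[OF _ assms(2)] in
    \<open>auto simp: differentiable_on_def differentiable_def\<close>)

text \<open>Each differentiation contributes one factor -1 from the inner map y -> x - y and leaves
  the direction unchanged. The signs are those in the definition of
  \<open>has_weak_deriv\<close>.\<close>

lemma iter_partial_deriv_reflect:
  assumes "f \<in> C_infinity" "is \<in> lists Basis"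
  shows "iter_partial_deriv is (\<lambda>y. f (x - y)) = (\<lambda>y. (-1) ^ length is * iter_partial_deriv is f (x - y))"
  using assms(2)
proof (induction "is")
  case (Cons i "is")
  let ?g = "iter_partial_deriv is f"
  have g: "?g \<in> C_infinity" using Cons assms(1) by (auto intro: C_infinity_iter_partial_deriv)
  then have cg: "(\<lambda>x. (-1) ^ length is * ?g x) \<in> C_infinity" by (rule C_infinity_cmult)
  have scale: "partial_deriv j (\<lambda>x. (-1) ^ length is * ?g x) = (\<lambda>x. (-1) ^ length is * partial_deriv j ?g x)"
    if "j \<in> Basis" for j
    using partial_deriv_mult[OF C_infinity_const g that] by simp
  have "linear (\<lambda>y. - y :: 'a)" by (simp add: linear_uminus)
  from partial_deriv_compose_affine[OF cg this, of i x]
  have "partial_deriv i (\<lambda>y. (-1) ^ length is * ?g (x - y)) =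
    (\<lambda>y. \<Sum>j\<in>Basis. (- i \<bullet> j) * ((-1) ^ length is * partial_deriv j ?g (x - y)))"
    by (simp add: scale)
  also have "\<dots> = (\<lambda>y. \<Sum>j\<in>Basis. if j = i then - ((-1) ^ length is * partial_deriv j ?g (x - y)) else 0)"
    using Cons.hyps by (intro ext sum.cong) (auto simp: inner_Basis)
  finally show ?case
    using Cons by auto
qed auto

section \<open>Supports of derivatives and test functions\<close>

text \<open>The complement of the closed ball is open, so near a point outside the ball
  \<open>f\<close> vanishes along the whole line segment that the derivative sees.\<close>

lemma partial_deriv_eq_0_outside:
  assumes "\<And>x. f x \<noteq> 0 \<Longrightarrow> norm x \<le> R"
  shows "partial_deriv i f x \<noteq> 0 \<Longrightarrow> norm x \<le> R"
proof (rule ccontr)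
  assume *: "partial_deriv i f x \<noteq> 0" "\<not> norm x \<le> R"
  have "((\<lambda>t. norm (x + t *\<^sub>R i)) \<longlongrightarrow> norm (x + 0 *\<^sub>R i)) (nhds 0)"
    by (intro tendsto_intros filterlim_ident)
  then have "\<forall>\<^sub>F t in nhds 0. norm (x + t *\<^sub>R i) > R"
    using *(2) by (intro order_tendstoD(1)) auto
  then have "\<forall>\<^sub>F t in nhds 0. f (x + t *\<^sub>R i) = 0"
    by eventually_elim (use assms leD in blast)
  then have "partial_deriv i f x = deriv (\<lambda>t. 0) 0"
    unfolding partial_deriv_def by (intro deriv_cong_ev) auto
  with *(1) show False by simp
qed

lemma iter_partial_deriv_eq_0_outside:
  assumes "\<And>x. f x \<noteq> 0 \<Longrightarrow> norm x \<le> R"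
  shows "iter_partial_deriv is f x \<noteq> 0 \<Longrightarrow> norm x \<le> R"
proof (induction "is" arbitrary: x)
  case (Cons i "is")
  then show ?case
    using partial_deriv_eq_0_outside[of "iter_partial_deriv is f" R i x] by simp
qed (use assms in auto)

text \<open>A bounded set in a Euclidean space has compact closure; a radius is easier to track
  through products and convolutions than a compact set.\<close>

lemma test_function_iff:
  "test_function f \<longleftrightarrow> f \<in> C_infinity \<and> (\<exists>R. \<forall>x. f x \<noteq> 0 \<longrightarrow> norm x \<le> R)"
  by (auto simp: test_function_def compact_closure bounded_iff)

lemma test_function_C_infinity: "test_function f \<Longrightarrow> f \<in> C_infinity"
  by (simp add: test_function_def)

lemma test_function_iter_partial_deriv:
  "test_function f \<Longrightarrow> is \<in> lists Basis \<Longrightarrow> test_function (iter_partial_deriv is f)"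
  unfolding test_function_iff
  using C_infinity_iter_partial_deriv[of f "is"] iter_partial_deriv_eq_0_outside[of f _ "is"] by blast

lemma test_function_partial_deriv:
  "test_function f \<Longrightarrow> i \<in> Basis \<Longrightarrow> test_function (partial_deriv i f)"
  using test_function_iter_partial_deriv[of f "[i]"] by simp

lemma test_function_mult:
  "test_function f \<Longrightarrow> g \<in> C_infinity \<Longrightarrow> test_function (\<lambda>x. f x * g x)"
  by (auto simp: test_function_iff intro!: C_infinity_mult)

lemma test_function_reflect:
  assumes "test_function f"
  shows "test_function (\<lambda>y. f (x - y))"
proof -
  obtain R where R: "\<And>x. f x \<noteq> 0 \<Longrightarrow> norm x \<le> R"
    using assms test_function_iff by blast
  have "norm y \<le> R + norm x" if "f (x - y) \<noteq> 0" for y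
    using R[OF that] norm_triangle_ineq2[of y x] by (simp add: norm_minus_commute)
  moreover have "(\<lambda>y. f (x - y)) \<in> C_infinity"
    using C_infinity_compose_affine[of f uminus x] assms
    by (simp add: test_function_iff linear_uminus)
  ultimately show ?thesis by (auto simp: test_function_iff)
qed

section \<open>Bump functions\<close>

text \<open>For \<open>P = 1\<close> this is the classical smooth function exp (-1/t), extended by
  0. The polynomial factor is a parameter because differentiation changes nothing else, so the
  family is stable under differentiation.\<close>

definition exp_bump :: "real poly \<Rightarrow> real \<Rightarrow> real" where
  "exp_bump P t = (if t > 0 then poly P (1 / t) * exp (- (1 / t)) else 0)"

lemma poly_exp_tendsto_0: "((\<lambda>s. poly P s * exp (- s)) \<longlongrightarrow> (0::real)) at_top"
proof -
  have "((\<lambda>s. coeff P i * (s ^ i / exp s)) \<longlongrightarrow> coeff P i * 0) at_top" for i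
    by (intro tendsto_intros tendsto_power_div_exp_0)
  then have "((\<lambda>s. \<Sum>i\<le>degree P. coeff P i * (s ^ i / exp s)) \<longlongrightarrow> (\<Sum>i\<le>degree P. 0)) at_top"
    by (intro tendsto_sum) simp
  then show ?thesis
    by (simp add: poly_altdef exp_minus sum_distrib_right divide_inverse mult.assoc)
qed

text \<open>With \<open>s = 1 / t\<close>, the derivative of \<open>P s * exp (- s)\<close> is \<open>s\<^sup>2 * (P s - P' s) * exp (- s)\<close>.\<close>

lemma exp_bump_has_derivative:
  "(exp_bump P has_real_derivative exp_bump ([:0, 0, 1:] * (P - pderiv P)) t) (at t)"
proof -
  consider "t > 0" | "t < 0" | "t = 0" by linarith
  then show ?thesis
  proof cases
    case 1
    have "((\<lambda>t. poly P (1 / t) * exp (- (1 / t))) has_real_derivative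
        poly ([:0, 0, 1:] * (P - pderiv P)) (1 / t) * exp (- (1 / t))) (at t)"
      using 1 by (auto intro!: derivative_eq_intros DERIV_chain2[OF poly_DERIV]
          simp: field_simps power2_eq_square)
    then have "(exp_bump P has_real_derivative
        poly ([:0, 0, 1:] * (P - pderiv P)) (1 / t) * exp (- (1 / t))) (at t)"
      by (rule has_field_derivative_transform_within[where d=t])
        (use 1 in \<open>auto simp: exp_bump_def dist_real_def\<close>)
    then show ?thesis using 1 by (simp add: exp_bump_def)
  next
    case 2
    have "(exp_bump P has_real_derivative 0) (at t)"
      by (rule has_field_derivative_transform_within[where d="-t" and f="\<lambda>x. 0"])
        (use 2 in \<open>auto simp: exp_bump_def dist_real_def\<close>)
    then show ?thesis using 2 by (simp add: exp_bump_def)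
  next
    case 3
    \<comment> \<open>With h = 1/s the difference quotient at 0 becomes s P(s) exp (-s) as s tends
      to infinity; the extra factor s accounts for \<open>pCons 0 P\<close>.\<close>
    have "((\<lambda>h. exp_bump P h / h) \<longlongrightarrow> 0) (at_right 0)"
    proof (subst filterlim_at_right_to_top)
      have "\<forall>\<^sub>F s in at_top. poly (pCons 0 P) s * exp (- s) = exp_bump P (inverse s) / inverse s"
        using eventually_gt_at_top[of 0]
        by eventually_elim (auto simp: exp_bump_def field_simps)
      then show "((\<lambda>s. exp_bump P (inverse s) / inverse s) \<longlongrightarrow> 0) at_top"
        using poly_exp_tendsto_0[of "pCons 0 P"] tendsto_cong by fastforce
    qed
    moreover have "((\<lambda>h. exp_bump P h / h) \<longlongrightarrow> 0) (at_left 0)"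
      by (rule tendsto_eventually)
        (auto simp: eventually_at_filter exp_bump_def intro!: always_eventually)
    ultimately have "((\<lambda>h. exp_bump P h / h) \<longlongrightarrow> 0) (at 0)"
      using filterlim_split_at by blast
    then show ?thesis
      using 3 by (simp add: DERIV_def exp_bump_def)
  qed
qed

lemma exp_bump_C_infinity: "exp_bump P \<in> C_infinity"
proof (rule C_infinity_coinduct[of _ "range exp_bump"])
  show "g differentiable_on UNIV" if "g \<in> range exp_bump" for g
    using that exp_bump_has_derivative
    by (fastforce simp: differentiable_on_def differentiable_def has_field_derivative_def)
  show "partial_deriv i g \<in> range exp_bump" if "g \<in> range exp_bump" "i \<in> Basis" for g i
  proof -
    obtain P where P: "g = exp_bump P" using \<open>g \<in> range exp_bump\<close> by auto
    have "partial_deriv i g = exp_bump ([:0, 0, 1:] * (P - pderiv P))"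
      using partial_deriv_eq(2)[OF exp_bump_has_derivative[unfolded has_field_derivative_def]] that
      by (auto simp: P)
    then show ?thesis by blast
  qed
qed auto

lemma bump_real:
  fixes a b :: real assumes "a < b"
  obtains f :: "real \<Rightarrow> real" where "f \<in> C_infinity" "\<And>t. f t \<ge> 0" "\<And>t. f t > 0 \<longleftrightarrow> a < t \<and> t < b"
proof
  \<comment> \<open>The arguments are written as a constant plus a linear map, to fit the lemma on
    affine composition.\<close>
  let ?f = "\<lambda>t. exp_bump 1 (-a + t) * exp_bump 1 (b + - t)"
  show "?f \<in> C_infinity"
    using C_infinity_compose_affine[OF exp_bump_C_infinity, of "\<lambda>x. x" 1 "-a"]
      C_infinity_compose_affine[OF exp_bump_C_infinity, of uminus 1 b]
    by (intro C_infinity_mult) (auto simp: linear_id linear_uminus linear_ident)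
  show "?f t > 0 \<longleftrightarrow> a < t \<and> t < b" "?f t \<ge> 0" for t
    using assms by (auto simp: exp_bump_def)
qed

lemma bump_euclidean:
  fixes r :: real assumes "r > 0"
  obtains f :: "'a::euclidean_space \<Rightarrow> real" where "test_function f" "\<And>x. f x \<ge> 0" "f 0 > 0"
    "\<And>x. f x \<noteq> 0 \<Longrightarrow> norm x \<le> r"
proof -
  \<comment> \<open>The product of bumps lives on a cube of half-width s; bounding the norm by the
    sum of the absolute coordinates puts the cube into the ball of radius DIM times s, which is
    \<open>r\<close>.\<close>
  define s where "s = r / DIM('a)"
  have s: "s > 0" using assms by (simp add: s_def)
  obtain b where b: "b \<in> C_infinity" "\<And>t. b t \<ge> 0" "\<And>t. b t > 0 \<longleftrightarrow> -s < t \<and> t < s"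
    using bump_real[of "-s" s] s by auto
  let ?f = "\<lambda>x::'a. \<Prod>i\<in>Basis. b (0 + x \<bullet> i)"
  have "?f \<in> C_infinity"
    by (intro C_infinity_prod C_infinity_compose_affine b(1)) (simp add: linear_iff inner_left_distrib)
  moreover have supp: "norm x \<le> r" if "?f x \<noteq> 0" for x
  proof -
    have "\<bar>x \<bullet> i\<bar> \<le> s" if "i \<in> Basis" for i
    proof -
      have "b (x \<bullet> i) \<noteq> 0" using \<open>?f x \<noteq> 0\<close> that by auto
      then have "b (x \<bullet> i) > 0" using b(2)[of "x \<bullet> i"] by linarith
      then show ?thesis using b(3) by (simp add: abs_le_iff less_imp_le)
    qed
    then have "norm x \<le> (\<Sum>i\<in>(Basis::'a set). s)"
      by (intro order_trans[OF norm_le_l1] sum_mono) auto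
    then show ?thesis by (simp add: s_def)
  qed
  ultimately have "test_function ?f" by (auto simp: test_function_iff)
  moreover have "?f x \<ge> 0" "?f 0 > 0" for x
    using b s by (auto intro!: prod_nonneg prod_pos)
  ultimately show ?thesis
    using that[of ?f] supp by blast
qed

section \<open>Integral estimates\<close>

text \<open>Convexity of s powr p. The point s = 0 lies outside the open half-line on which
  convexity is applied and is checked by hand.\<close>

lemma powr_above_tangent:
  fixes a s p :: real
  assumes "p \<ge> 1" "a > 0" "s \<ge> 0"
  shows "a powr p + p * a powr (p - 1) * (s - a) \<le> s powr p"
proof (cases "s = 0")
  case True
  have "a powr (p - 1) * a = a powr p"
    using assms by (simp add: powr_diff)
  then have "a powr p + p * a powr (p - 1) * (s - a) = (1 - p) * a powr p"
    using True by (simp add: algebra_simps)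
  also have "\<dots> \<le> 0" using assms by (simp add: mult_le_0_iff)
  finally show ?thesis using True by simp
next
  case False
  have "p * a powr (p - 1) * (s - a) \<le> s powr p - a powr p"
    using assms False
    by (intro convex_on_imp_above_tangent[where A = "{0<..}"] powr_convex)
      (auto intro!: derivative_eq_intros simp: interior_open)
  then show ?thesis by simp
qed

text \<open>Jensen's inequality for the measure with density |k|, normalised by its mass. It is
  stated in \<open>ennreal\<close> and asks only measurability of \<open>f\<close>, so that it
  applies under an outer integral before anything is known to be finite.\<close>

lemma powr_integral_le:
  fixes k f :: "'b \<Rightarrow> real"
  assumes p: "p \<ge> 1" and k: "integrable M k" and [measurable]: "f \<in> borel_measurable M"
  shows "ennreal (\<bar>\<integral>x. k x * f x \<partial>M\<bar> powr p) \<le>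
    ennreal ((\<integral>x. \<bar>k x\<bar> \<partial>M) powr (p - 1)) * (\<integral>\<^sup>+x. ennreal (\<bar>k x\<bar> * \<bar>f x\<bar> powr p) \<partial>M)"
proof -
  have [measurable]: "k \<in> borel_measurable M" using k by auto
  define m where "m = (\<integral>x. \<bar>k x\<bar> \<partial>M)"
  let ?I = "\<integral>\<^sup>+x. ennreal (\<bar>k x\<bar> * \<bar>f x\<bar> powr p) \<partial>M"
  have m0: "m \<ge> 0" by (simp add: m_def)
  consider "m = 0" | "\<not> integrable M (\<lambda>x. k x * f x)" | "m > 0" "?I = \<infinity>"
    | "m > 0" "?I < \<infinity>" "integrable M (\<lambda>x. k x * f x)"
    using m0 by (metis antisym_conv2 infinity_ennreal_def top.not_eq_extremum)
  then show ?thesis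
  proof cases
    case 1
    then have "AE x in M. \<bar>k x\<bar> = 0"
      using integral_nonneg_eq_0_iff_AE[of M "\<lambda>x. \<bar>k x\<bar>"] k by (simp add: m_def)
    then have "(\<integral>x. k x * f x \<partial>M) = (\<integral>x. 0 \<partial>M)"
      by (intro integral_cong_AE) auto
    then show ?thesis by simp
  next
    case 2
    \<comment> \<open>A non-integrable product has Bochner integral 0, so the left side
      vanishes.\<close>
    then show ?thesis by (simp add: not_integrable_integral_eq)
  next
    case 3
    then have "ennreal (m powr (p - 1)) \<noteq> 0" by (simp add: ennreal_eq_0_iff)
    then show ?thesis using 3 by (simp add: m_def[symmetric] ennreal_mult_top)
  next
    case 4
    have int: "integrable M (\<lambda>x. \<bar>k x\<bar> * \<bar>f x\<bar> powr p)"
      using 4(2) by (intro integrableI_nonneg) auto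
    then have I: "?I = ennreal (\<integral>x. \<bar>k x\<bar> * \<bar>f x\<bar> powr p \<partial>M)"
      by (intro nn_integral_eq_integral) auto
    have kf: "integrable M (\<lambda>x. \<bar>k x\<bar> * \<bar>f x\<bar>)"
      using integrable_abs[OF 4(3)] by (simp add: abs_mult)
    define b where "b = (\<integral>x. \<bar>k x\<bar> * \<bar>f x\<bar> \<partial>M)"
    have b0: "b \<ge> 0" by (simp add: b_def)
    have "b powr p \<le> m powr (p - 1) * (\<integral>x. \<bar>k x\<bar> * \<bar>f x\<bar> powr p \<partial>M)"
    proof (cases "b = 0")
      case False
      \<comment> \<open>The tangent is taken at the mean \<open>a\<close> of |f| with weight |k| /
        m; the linear term then integrates to zero.\<close>
      define a where "a = b / m"
      have a: "a > 0" "a * m = b" using False b0 4 by (auto simp: a_def)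
      have "m * a powr p + p * a powr (p - 1) * (b - a * m)
        = (\<integral>x. a powr p * \<bar>k x\<bar> + (p * a powr (p - 1)) * (\<bar>k x\<bar> * \<bar>f x\<bar>) - (p * a powr (p - 1) * a) * \<bar>k x\<bar> \<partial>M)"
      proof -
        have "(\<integral>x. a powr p * \<bar>k x\<bar> + (p * a powr (p - 1)) * (\<bar>k x\<bar> * \<bar>f x\<bar>) - (p * a powr (p - 1) * a) * \<bar>k x\<bar> \<partial>M)
          = a powr p * m + (p * a powr (p - 1)) * b - (p * a powr (p - 1) * a) * m"
          using k kf by (simp add: m_def b_def)
        then show ?thesis by (simp add: algebra_simps)
      qed
      also have "\<dots> \<le> (\<integral>x. \<bar>k x\<bar> * \<bar>f x\<bar> powr p \<partial>M)"
      proof (intro integral_mono)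
        fix x
        show "a powr p * \<bar>k x\<bar> + (p * a powr (p - 1)) * (\<bar>k x\<bar> * \<bar>f x\<bar>) - (p * a powr (p - 1) * a) * \<bar>k x\<bar>
           \<le> \<bar>k x\<bar> * \<bar>f x\<bar> powr p"
          using mult_left_mono[OF powr_above_tangent[OF p a(1), of "\<bar>f x\<bar>"], of "\<bar>k x\<bar>"]
          by (simp add: algebra_simps)
      qed (use k kf int in auto)
      finally have "m * a powr p \<le> (\<integral>x. \<bar>k x\<bar> * \<bar>f x\<bar> powr p \<partial>M)" using a by simp
      then have "m powr (p - 1) * (m * a powr p) \<le> m powr (p - 1) * (\<integral>x. \<bar>k x\<bar> * \<bar>f x\<bar> powr p \<partial>M)"
        by (rule mult_left_mono) auto
      moreover have "m powr (p - 1) * (m * a powr p) = b powr p"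
        using a 4 by (simp add: a(2)[symmetric] powr_mult powr_diff)
      ultimately show ?thesis by simp
    qed auto
    moreover have "\<bar>\<integral>x. k x * f x \<partial>M\<bar> \<le> b"
      unfolding b_def using integral_abs_bound[of M "\<lambda>x. k x * f x"] by (simp add: abs_mult)
    then have "\<bar>\<integral>x. k x * f x \<partial>M\<bar> powr p \<le> b powr p"
      using p by (intro powr_mono2) auto
    ultimately have "\<bar>\<integral>x. k x * f x \<partial>M\<bar> powr p \<le> m powr (p - 1) * (\<integral>x. \<bar>k x\<bar> * \<bar>f x\<bar> powr p \<partial>M)"
      by simp
    then have "ennreal (\<bar>\<integral>x. k x * f x \<partial>M\<bar> powr p) \<le>
        ennreal (m powr (p - 1) * (\<integral>x. \<bar>k x\<bar> * \<bar>f x\<bar> powr p \<partial>M))"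
      by (rule ennreal_leI)
    then show ?thesis unfolding I m_def by (simp add: ennreal_mult)
  qed
qed

lemma powr_add_le:
  fixes a b p :: real
  assumes "p \<ge> 1"
  shows "\<bar>a + b\<bar> powr p \<le> 2 powr p * (\<bar>a\<bar> powr p + \<bar>b\<bar> powr p)"
proof -
  have "\<bar>a + b\<bar> powr p \<le> (2 * max \<bar>a\<bar> \<bar>b\<bar>) powr p"
    using assms by (intro powr_mono2) auto
  also have "\<dots> = 2 powr p * (max \<bar>a\<bar> \<bar>b\<bar> powr p)"
    by (simp add: powr_mult)
  also have "\<dots> \<le> 2 powr p * (\<bar>a\<bar> powr p + \<bar>b\<bar> powr p)"
    by (intro mult_left_mono) (auto simp: max_def)
  finally show ?thesis .
qed

text \<open>Write x powr p = x * x powr (p - 1) and bound the second factor by its value at a +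
  b.\<close>

lemma powr_superadd:
  fixes a b p :: real
  assumes "p \<ge> 1" "a \<ge> 0" "b \<ge> 0"
  shows "a powr p + b powr p \<le> (a + b) powr p"
proof -
  have *: "x powr p = x * x powr (p - 1)" if "x \<ge> 0" for x :: real
    using that by (cases "x = 0") (auto simp: powr_diff)
  have "a powr p + b powr p \<le> a * (a + b) powr (p - 1) + b * (a + b) powr (p - 1)"
    unfolding *[OF assms(2)] *[OF assms(3)] using assms
    by (intro add_mono mult_left_mono powr_mono2) auto
  also have "\<dots> = (a + b) powr p" using assms by (simp add: * algebra_simps)
  finally show ?thesis .
qed

text \<open>The map \<open>a \<mapsto> sgn a * \<bar>a\<bar> powr p\<close> reduces continuity statements in $L^p$ to the case of $L^1$.\<close>

lemma powr_diff_le_signed_powr_diff: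
  fixes a b p :: real
  assumes "p \<ge> 1"
  shows "\<bar>a - b\<bar> powr p \<le> 2 powr p * \<bar>sgn a * \<bar>a\<bar> powr p - sgn b * \<bar>b\<bar> powr p\<bar>"
proof -
  have one: "1 \<le> 2 powr p" using assms by (simp add: ge_one_powr_ge_zero)
  have *: "\<bar>x - y\<bar> powr p \<le> 2 powr p * \<bar>x powr p - y powr p\<bar>" if "x \<ge> y" "y \<ge> 0" for x y :: real
  proof -
    have "(x - y) powr p \<le> x powr p - y powr p"
      using powr_superadd[OF assms, of "x - y" y] that by simp
    also have "\<dots> = 1 * \<bar>x powr p - y powr p\<bar>"
      using that assms by (simp add: powr_mono2)
    also have "\<dots> \<le> 2 powr p * \<bar>x powr p - y powr p\<bar>"
      by (intro mult_right_mono one) auto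
    finally show ?thesis using that by simp
  qed
  \<comment> \<open>For equal signs the claim follows from superadditivity of the p-th power. For
    opposite signs the right side contains the sum of both p-th powers, and the bound with constant
    2 powr p applies.\<close>
  consider "a \<ge> 0" "b \<ge> 0" "a \<ge> b" | "a \<ge> 0" "b \<ge> 0" "b \<ge> a" | "a < 0" "b < 0" "a \<ge> b"
    | "a < 0" "b < 0" "b \<ge> a" | "a \<ge> 0" "b < 0" | "a < 0" "b \<ge> 0" by linarith
  then show ?thesis
  proof cases
    case 1 then show ?thesis using *[of b a] by (auto simp: sgn_if)
  next
    case 2 then show ?thesis using *[of a b] by (auto simp: sgn_if abs_minus_commute)
  next
    case 3 then show ?thesis using *[of "-a" "-b"] by (auto simp: sgn_if abs_minus_commute)
  next
    case 4 then show ?thesis using *[of "-b" "-a"] by (auto simp: sgn_if abs_minus_commute)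
  next
    case 5 then show ?thesis using powr_add_le[OF assms, of a "-b"] by (auto simp: sgn_if)
  next
    case 6
    have "\<bar>- ((- a) powr p) - b powr p\<bar> = (- a) powr p + b powr p"
      using powr_ge_zero[of "-a" p] powr_ge_zero[of b p] by linarith
    then show ?thesis
      using 6 powr_add_le[OF assms, of b "-a"] by (auto simp: sgn_if add.commute)
  qed
qed

lemma distr_lborel_reflect: "distr lborel borel (\<lambda>y. x - y) = (lborel :: 'a::euclidean_space measure)"
  by (subst lborel_affine[of "-1" x]) (auto simp: density_1)

lemma integral_lborel_reflect:
  fixes f :: "'a::euclidean_space \<Rightarrow> real"
  assumes [measurable]: "f \<in> borel_measurable borel"
  shows "(\<integral>y. f (x - y) \<partial>lborel) = (\<integral>y. f y \<partial>lborel)"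
  by (subst (2) distr_lborel_reflect[of x, symmetric]) (simp add: integral_distr)

lemma integrable_lborel_reflect:
  fixes f :: "'a::euclidean_space \<Rightarrow> real"
  assumes "integrable lborel f"
  shows "integrable lborel (\<lambda>y. f (x - y))"
proof -
  have [measurable]: "f \<in> borel_measurable borel" using assms by auto
  have "integrable (distr lborel borel (\<lambda>y. x - y)) f"
    using assms by (simp add: distr_lborel_reflect)
  then show ?thesis by (simp add: integrable_distr_eq)
qed

lemma nn_integral_lborel_translate:
  fixes f :: "'a::euclidean_space \<Rightarrow> ennreal"
  assumes [measurable]: "f \<in> borel_measurable borel"
  shows "(\<integral>\<^sup>+y. f (y - x) \<partial>lborel) = (\<integral>\<^sup>+y. f y \<partial>lborel)"
  by (subst (2) lborel_distr_plus[of "-x", symmetric]) (simp add: nn_integral_distr)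

section \<open>Continuity of translations in $L^p$\<close>

text \<open>Squeeze A between a compact K and an open U of nearly the same measure. If h is shorter
  than the distance from K to the complement of U, the translate of K stays in U and is disjoint
  from the part of A outside its own translate; comparing measures bounds that part by the gap
  between U and K.\<close>

lemma emeasure_translate_diff_small:
  fixes A :: "'a::euclidean_space set"
  assumes A: "A \<in> sets borel" "emeasure lborel A < \<infinity>" and e: "e > 0"
  shows "\<exists>d>0. \<forall>h. norm h < d \<longrightarrow> emeasure lborel (A - (\<lambda>x. x + h) ` A) \<le> ennreal e"
proof -
  obtain U where U: "open U" "A \<subseteq> U" "emeasure lebesgue (U - A) < ennreal (e / 2)"
    using sets_lebesgue_outer_open[of A "e/2"] A e by (metis half_gt_zero sets_completionI_sets sets_lborel)
  obtain C where C: "closed C" "C \<subseteq> A" "emeasure lebesgue (A - C) < ennreal (e / 4)"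
    using sets_lebesgue_inner_closed[of A "e/4"] A e
    by (metis sets_completionI_sets sets_lborel zero_less_divide_iff zero_less_numeral)
  \<comment> \<open>Intersecting the closed set with balls makes it compact, at an arbitrarily small
    cost in measure because A has finite measure.\<close>
  define K where "K n = C \<inter> cball 0 (real n)" for n
  have [measurable]: "A \<in> sets borel" "U \<in> sets borel" "C \<in> sets borel" "K n \<in> sets borel" for n
    using A U C by (auto simp: K_def)
  have U': "emeasure lborel (U - A) < ennreal (e / 2)" and C': "emeasure lborel (A - C) < ennreal (e / 4)"
    using U C by auto
  have "(\<lambda>n. emeasure lborel (A - K n)) \<longlonglongrightarrow> emeasure lborel (\<Inter>n. A - K n)"
  proof (rule Lim_emeasure_decseq)
    show "decseq (\<lambda>n. A - K n)" by (auto simp: decseq_def K_def)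
    show "emeasure lborel (A - K n) \<noteq> \<infinity>" for n
      using emeasure_mono[of "A - K n" A lborel] A by (auto simp: top_unique)
  qed auto
  moreover have "(\<Inter>n. A - K n) = A - C"
    by (auto simp: K_def intro: real_arch_simple)
  ultimately have "\<forall>\<^sub>F n in sequentially. emeasure lborel (A - K n) < ennreal (e / 4)"
    using C' order_tendstoD(2) by fastforce
  then obtain n where n: "emeasure lborel (A - K n) < ennreal (e / 4)"
    by (auto simp: eventually_sequentially)
  have "compact (K n)" "K n \<subseteq> U"
    using C U by (auto simp: K_def closed_Int_compact)
  then obtain d where d: "d > 0" "\<And>x y. x \<in> K n \<Longrightarrow> y \<notin> U \<Longrightarrow> d \<le> dist x y"
    using separate_compact_closed[of "K n" "-U"] U(1) by (force simp: closed_Compl)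
  show ?thesis
  proof (intro exI[of _ d] conjI allI impI d)
    fix h :: 'a assume h: "norm h < d"
    define T where "T B = (\<lambda>x. x + h) ` B" for B :: "'a set"
    have Tv: "T B = (\<lambda>x. x - h) -` B" for B
      by (auto simp: T_def intro!: image_eqI[of _ _ "_ - h"])
    have Tb: "T B \<in> sets borel" if "B \<in> sets borel" for B
    proof -
      have "(\<lambda>x. x - h) -` B \<inter> space borel \<in> sets borel"
        by (rule measurable_sets[OF _ that]) simp
      then show ?thesis unfolding Tv space_borel Int_UNIV_right .
    qed
    have Tm: "emeasure lborel (T B) = emeasure lborel B" if [measurable]: "B \<in> sets borel" for B
    proof -
      note Tb[OF that, measurable]
      have "emeasure lborel (T B) = (\<integral>\<^sup>+x. indicator (T B) x \<partial>lborel)" by simp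
      also have "\<dots> = (\<integral>\<^sup>+x. indicator B (x - h) \<partial>lborel)"
        by (intro nn_integral_cong) (auto simp: Tv indicator_def)
      also have "\<dots> = emeasure lborel B" by (subst nn_integral_lborel_translate) auto
      finally show ?thesis .
    qed
    have fin: "emeasure lborel (K n) < \<infinity>"
      using \<open>compact (K n)\<close> by (intro emeasure_bounded_finite compact_imp_bounded)
    have "T (K n) \<subseteq> U"
    proof
      fix x assume "x \<in> T (K n)"
      then obtain y where "y \<in> K n" "x = y + h" by (auto simp: T_def)
      then show "x \<in> U" using d(2)[of y x] h by (auto simp: dist_norm)
    qed
    \<comment> \<open>The two sets are disjoint because K n is contained in A, and both lie in
      U.\<close>
    have "emeasure lborel (A - T A) + emeasure lborel (T (K n)) = emeasure lborel ((A - T A) \<union> T (K n))"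
    proof (rule plus_emeasure)
      show "(A - T A) \<inter> T (K n) = {}" using C by (auto simp: K_def T_def)
    qed (use Tb in \<open>auto intro!: sets.Diff\<close>)
    also have "\<dots> \<le> emeasure lborel U"
      using U \<open>T (K n) \<subseteq> U\<close> by (intro emeasure_mono) auto
    also have "\<dots> = emeasure lborel (K n \<union> (A - K n) \<union> (U - A))"
      using U C by (intro arg_cong2[where f=emeasure]) (auto simp: K_def)
    also have "\<dots> \<le> emeasure lborel (K n) + emeasure lborel (A - K n) + emeasure lborel (U - A)"
      by (intro order_trans[OF emeasure_subadditive] add_mono emeasure_subadditive) auto
    also have "\<dots> \<le> emeasure lborel (K n) + ennreal (e / 4) + ennreal (e / 2)"
      using n U' by (intro add_mono) auto
    also have "\<dots> \<le> ennreal e + emeasure lborel (T (K n))"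
    proof -
      have "ennreal (e / 4) + ennreal (e / 2) = ennreal (e / 4 + e / 2)"
        using e by (intro ennreal_plus[symmetric]) auto
      also have "\<dots> \<le> ennreal e" using e by (intro ennreal_leI) simp
      finally have "emeasure lborel (K n) + (ennreal (e / 4) + ennreal (e / 2)) \<le> emeasure lborel (K n) + ennreal e"
        by (rule add_left_mono)
      moreover have "emeasure lborel (T (K n)) = emeasure lborel (K n)" by (rule Tm) measurable
      ultimately show ?thesis by (simp only: ac_simps)
    qed
    finally have "emeasure lborel (T (K n)) + emeasure lborel (A - T A) \<le> emeasure lborel (T (K n)) + ennreal e"
      by (simp only: add.commute)
    moreover have "emeasure lborel (T (K n)) \<noteq> top" using fin Tm by auto
    ultimately show "emeasure lborel (A - (\<lambda>x. x + h) ` A) \<le> ennreal e"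
      unfolding ennreal_add_left_cancel_le T_def by simp
  qed
qed

text \<open>For indicators this is the preceding estimate. Sums and limits follow from the triangle
  inequality, where translation invariance makes the error of the shifted approximation equal to the
  unshifted one.\<close>

lemma translation_continuous_L1:
  fixes f :: "'a::euclidean_space \<Rightarrow> real"
  assumes "integrable lborel f" "e > 0"
  shows "\<exists>d>0. \<forall>h. norm h < d \<longrightarrow> (\<integral>\<^sup>+x. ennreal \<bar>f (x - h) - f x\<bar> \<partial>lborel) \<le> ennreal e"
  using assms
proof (induction f arbitrary: e rule: integrable_induct)
  case (base A c)
  have [measurable]: "A \<in> sets borel" using base by auto
  \<comment> \<open>The factor 2 pays for the two halves of the symmetric difference; the summand 1
    keeps the denominator positive when c = 0.\<close>
  define e' where "e' = e / (2 * (\<bar>c\<bar> + 1))"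
  have e': "e' > 0" using base by (simp add: e'_def)
  obtain d where d: "d > 0" "\<And>h. norm h < d \<Longrightarrow> emeasure lborel (A - (\<lambda>x. x + h) ` A) \<le> ennreal e'"
    using emeasure_translate_diff_small[of A e'] base e' by auto
  show ?case
  proof (intro exI[of _ d] conjI allI impI d)
    fix h :: 'a assume h: "norm h < d"
    have im: "(\<lambda>x. x + h) ` B = (\<lambda>x. x - h) -` B" for h and B :: "'a set"
      by (auto intro!: image_eqI[of _ _ "_ - h"])
    have [measurable]: "(\<lambda>x. x + h) ` A \<in> sets borel" for h
      using measurable_sets[of "\<lambda>x. x - h" borel borel A] by (simp add: im)
    \<comment> \<open>The part of the shifted set outside A is the shift by h of A minus its
      translate by -h, so both halves of the symmetric difference are covered by the one-sided
      estimate.\<close>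
    have "(\<integral>\<^sup>+x. ennreal \<bar>indicator A (x - h) *\<^sub>R c - indicator A x *\<^sub>R c\<bar> \<partial>lborel) =
      (\<integral>\<^sup>+x. ennreal \<bar>c\<bar> * indicator (A - (\<lambda>x. x + h) ` A) x + ennreal \<bar>c\<bar> * indicator (A - (\<lambda>x. x + (-h)) ` A) (x - h) \<partial>lborel)"
      unfolding im by (intro nn_integral_cong) (auto simp: indicator_def)
    also have "\<dots> = ennreal \<bar>c\<bar> * emeasure lborel (A - (\<lambda>x. x + h) ` A) +
       ennreal \<bar>c\<bar> * (\<integral>\<^sup>+x. indicator (A - (\<lambda>x. x + (-h)) ` A) (x - h) \<partial>lborel)"
      using \<open>\<And>h. (\<lambda>x. x + h) ` A \<in> sets borel\<close>[of "-h"]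
      by (subst nn_integral_add) (auto simp: nn_integral_cmult)
    also have "(\<integral>\<^sup>+x. indicator (A - (\<lambda>x. x + (-h)) ` A) (x - h) \<partial>lborel) = emeasure lborel (A - (\<lambda>x. x + (-h)) ` A)"
      using \<open>\<And>h. (\<lambda>x. x + h) ` A \<in> sets borel\<close>[of "-h"]
      by (subst nn_integral_lborel_translate) auto
    also have "ennreal \<bar>c\<bar> * emeasure lborel (A - (\<lambda>x. x + h) ` A) + ennreal \<bar>c\<bar> * emeasure lborel (A - (\<lambda>x. x + (-h)) ` A)
      \<le> ennreal \<bar>c\<bar> * ennreal e' + ennreal \<bar>c\<bar> * ennreal e'"
      using d(2)[of h] d(2)[of "-h"] h by (intro add_mono mult_left_mono) auto
    also have "\<dots> = ennreal (2 * (\<bar>c\<bar> * e'))"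
      using e' by (simp add: ennreal_mult[symmetric] ennreal_plus[symmetric] del: ennreal_plus)
    also have "\<dots> \<le> ennreal e"
      using base(3) by (intro ennreal_leI) (simp add: e'_def field_simps)
    finally show "(\<integral>\<^sup>+x. ennreal \<bar>indicator A (x - h) *\<^sub>R c - indicator A x *\<^sub>R c\<bar> \<partial>lborel) \<le> ennreal e" .
  qed
next
  case (add f g)
  have [measurable]: "f \<in> borel_measurable borel" "g \<in> borel_measurable borel" using add by auto
  obtain d1 d2 where d: "d1 > 0" "d2 > 0"
    "\<And>h. norm h < d1 \<Longrightarrow> (\<integral>\<^sup>+x. ennreal \<bar>f (x - h) - f x\<bar> \<partial>lborel) \<le> ennreal (e / 2)"
    "\<And>h. norm h < d2 \<Longrightarrow> (\<integral>\<^sup>+x. ennreal \<bar>g (x - h) - g x\<bar> \<partial>lborel) \<le> ennreal (e / 2)"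
    using add.IH(1)[of "e/2"] add.IH(2)[of "e/2"] add.prems by auto
  show ?case
  proof (intro exI[of _ "min d1 d2"] conjI allI impI)
    fix h :: 'a assume h: "norm h < min d1 d2"
    have "(\<integral>\<^sup>+x. ennreal \<bar>f (x - h) + g (x - h) - (f x + g x)\<bar> \<partial>lborel) \<le>
      (\<integral>\<^sup>+x. ennreal \<bar>f (x - h) - f x\<bar> + ennreal \<bar>g (x - h) - g x\<bar> \<partial>lborel)"
      by (intro nn_integral_mono) (auto simp flip: ennreal_plus intro!: ennreal_leI)
    also have "\<dots> = (\<integral>\<^sup>+x. ennreal \<bar>f (x - h) - f x\<bar> \<partial>lborel) + (\<integral>\<^sup>+x. ennreal \<bar>g (x - h) - g x\<bar> \<partial>lborel)"
      by (rule nn_integral_add) auto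
    also have "\<dots> \<le> ennreal (e / 2) + ennreal (e / 2)" using d h by (intro add_mono) auto
    also have "\<dots> = ennreal e" using add.prems by (simp flip: ennreal_plus)
    finally show "(\<integral>\<^sup>+x. ennreal \<bar>f (x - h) + g (x - h) - (f x + g x)\<bar> \<partial>lborel) \<le> ennreal e" .
  qed (use d in auto)
next
  case (lim f s)
  have [measurable]: "f \<in> borel_measurable borel" "s i \<in> borel_measurable borel" for i using lim by auto
  have "(\<lambda>i. \<integral>\<^sup>+x. ennreal (norm (f x - s i x)) \<partial>lborel) \<longlonglongrightarrow> 0"
    using lim(1-4) by (intro nn_integral_dominated_convergence_norm[where w="\<lambda>x. 2 * norm (f x)"])
      (auto simp: integrable_iff_bounded[of _ f] nn_integral_cmult ennreal_mult ennreal_mult_less_top)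
  then have "\<forall>\<^sub>F i in sequentially. (\<integral>\<^sup>+x. ennreal (norm (f x - s i x)) \<partial>lborel) < ennreal (e / 4)"
    using lim.prems by (intro order_tendstoD(2)) auto
  then obtain i where "(\<integral>\<^sup>+x. ennreal (norm (f x - s i x)) \<partial>lborel) < ennreal (e / 4)"
    by (auto simp: eventually_sequentially)
  then have i: "(\<integral>\<^sup>+x. ennreal \<bar>s i x - f x\<bar> \<partial>lborel) \<le> ennreal (e / 4)"
    by (simp add: abs_minus_commute)
  obtain d where d: "d > 0" "\<And>h. norm h < d \<Longrightarrow> (\<integral>\<^sup>+x. ennreal \<bar>s i (x - h) - s i x\<bar> \<partial>lborel) \<le> ennreal (e / 2)"
    using lim.IH[of "e/2" i] lim.prems by auto
  show ?case
  proof (intro exI[of _ d] conjI allI impI d)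
    fix h :: 'a assume h: "norm h < d"
    have "(\<integral>\<^sup>+x. ennreal \<bar>f (x - h) - f x\<bar> \<partial>lborel) \<le>
      (\<integral>\<^sup>+x. (ennreal \<bar>s i (x - h) - f (x - h)\<bar> + ennreal \<bar>s i x - f x\<bar>) + ennreal \<bar>s i (x - h) - s i x\<bar> \<partial>lborel)"
      by (intro nn_integral_mono) (auto simp flip: ennreal_plus intro!: ennreal_leI)
    also have "\<dots> = ((\<integral>\<^sup>+x. ennreal \<bar>s i (x - h) - f (x - h)\<bar> \<partial>lborel) + (\<integral>\<^sup>+x. ennreal \<bar>s i x - f x\<bar> \<partial>lborel))
       + (\<integral>\<^sup>+x. ennreal \<bar>s i (x - h) - s i x\<bar> \<partial>lborel)"
      by (simp add: nn_integral_add)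
    also have "(\<integral>\<^sup>+x. ennreal \<bar>s i (x - h) - f (x - h)\<bar> \<partial>lborel) = (\<integral>\<^sup>+x. ennreal \<bar>s i x - f x\<bar> \<partial>lborel)"
      by (rule nn_integral_lborel_translate) auto
    also have "(\<integral>\<^sup>+x. ennreal \<bar>s i x - f x\<bar> \<partial>lborel) + (\<integral>\<^sup>+x. ennreal \<bar>s i x - f x\<bar> \<partial>lborel)
       + (\<integral>\<^sup>+x. ennreal \<bar>s i (x - h) - s i x\<bar> \<partial>lborel) \<le> (ennreal (e / 4) + ennreal (e / 4)) + ennreal (e / 2)"
      using d h by (intro add_mono i) auto
    also have "\<dots> = ennreal e" using lim.prems by (simp flip: ennreal_plus)
    finally show "(\<integral>\<^sup>+x. ennreal \<bar>f (x - h) - f x\<bar> \<partial>lborel) \<le> ennreal e" .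
  qed
qed

section \<open>The $p$-th power of the $L^p$ norm\<close>

text \<open>The value is infinite outside L^p, so estimates need no prior integrability. The
  triangle inequality holds up to the factor 2 powr p, which suffices for convergence to 0 and
  spares Minkowski's inequality and p-th roots.\<close>

definition Lp_mass :: "real \<Rightarrow> ('a::euclidean_space \<Rightarrow> real) \<Rightarrow> ennreal" where
  "Lp_mass p f = (\<integral>\<^sup>+x. ennreal (\<bar>f x\<bar> powr p) \<partial>lborel)"

lemma Lp_mass_cong_AE: "AE x in lborel. f x = g x \<Longrightarrow> Lp_mass p f = Lp_mass p g"
  unfolding Lp_mass_def by (intro nn_integral_cong_AE) auto

lemma Lp_mass_mono: "p \<ge> 0 \<Longrightarrow> (\<And>x. \<bar>f x\<bar> \<le> \<bar>g x\<bar>) \<Longrightarrow> Lp_mass p f \<le> Lp_mass p g"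
  unfolding Lp_mass_def by (intro nn_integral_mono ennreal_leI powr_mono2) auto

lemma Lp_mass_add_le:
  assumes "p \<ge> 1" and [measurable]: "f \<in> borel_measurable borel" "g \<in> borel_measurable borel"
  shows "Lp_mass p (\<lambda>x. f x + g x) \<le> ennreal (2 powr p) * (Lp_mass p f + Lp_mass p g)"
proof -
  have "Lp_mass p (\<lambda>x. f x + g x) \<le>
      (\<integral>\<^sup>+x. ennreal (2 powr p) * (ennreal (\<bar>f x\<bar> powr p) + ennreal (\<bar>g x\<bar> powr p)) \<partial>lborel)"
    unfolding Lp_mass_def using powr_add_le[OF assms(1)]
    by (intro nn_integral_mono) (simp flip: ennreal_plus ennreal_mult add: ennreal_leI)
  also have "\<dots> = ennreal (2 powr p) * (Lp_mass p f + Lp_mass p g)"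
    by (simp add: Lp_mass_def nn_integral_cmult nn_integral_add)
  finally show ?thesis .
qed

lemma Lp_mass_uminus [simp]: "Lp_mass p (\<lambda>x. - f x) = Lp_mass p f"
  by (simp add: Lp_mass_def)

lemma Lp_mass_diff_le:
  assumes "p \<ge> 1" "f \<in> borel_measurable borel" "g \<in> borel_measurable borel"
  shows "Lp_mass p (\<lambda>x. f x - g x) \<le> ennreal (2 powr p) * (Lp_mass p f + Lp_mass p g)"
  using Lp_mass_add_le[of p f "\<lambda>x. - g x"] assms by simp

lemma Lp_mass_cmult:
  assumes [measurable]: "f \<in> borel_measurable borel"
  shows "Lp_mass p (\<lambda>x. c * f x) = ennreal (\<bar>c\<bar> powr p) * Lp_mass p f"
  by (simp add: Lp_mass_def abs_mult powr_mult ennreal_mult nn_integral_cmult)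

lemma Lp_mass_eq_0_iff:
  assumes [measurable]: "f \<in> borel_measurable borel"
  shows "Lp_mass p f = 0 \<longleftrightarrow> (AE x in lborel. f x = 0)"
  unfolding Lp_mass_def by (subst nn_integral_0_iff_AE) auto

lemma Lp_space_iff: "f \<in> Lp_space p \<longleftrightarrow> f \<in> borel_measurable borel \<and> Lp_mass p f < \<infinity>"
  by (auto simp: Lp_space_def Lp_mass_def integrable_iff_bounded)

lemma Lp_space_measurable [measurable_dest]: "f \<in> Lp_space p \<Longrightarrow> f \<in> borel_measurable borel"
  by (simp add: Lp_space_iff)

lemma Lp_norm_eq:
  assumes [measurable]: "f \<in> borel_measurable borel"
  shows "Lp_norm p f = enn2real (Lp_mass p f) powr (1 / p)"
  unfolding Lp_norm_def Lp_mass_def by (subst integral_eq_nn_integral) auto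

lemma ennreal_mult_add_less_top:
  "a < \<infinity> \<Longrightarrow> b < \<infinity> \<Longrightarrow> ennreal c * (a + b) < \<infinity>"
  by (simp add: ennreal_mult_less_top)

lemma Lp_space_add: "p \<ge> 1 \<Longrightarrow> f \<in> Lp_space p \<Longrightarrow> g \<in> Lp_space p \<Longrightarrow> (\<lambda>x. f x + g x) \<in> Lp_space p"
  unfolding Lp_space_iff
  using le_less_trans[OF Lp_mass_add_le[of p f g] ennreal_mult_add_less_top] by auto

lemma Lp_space_diff: "p \<ge> 1 \<Longrightarrow> f \<in> Lp_space p \<Longrightarrow> g \<in> Lp_space p \<Longrightarrow> (\<lambda>x. f x - g x) \<in> Lp_space p"
  unfolding Lp_space_iff
  using le_less_trans[OF Lp_mass_diff_le[of p f g] ennreal_mult_add_less_top] by auto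

text \<open>The L^1 result is applied to the signed power of \<open>f\<close>, with the constant 2
  powr p absorbed in the tolerance.\<close>

lemma Lp_mass_translation_continuous:
  fixes f :: "'a::euclidean_space \<Rightarrow> real"
  assumes p: "p \<ge> 1" and f: "f \<in> Lp_space p" and e: "e > 0"
  shows "\<exists>d>0. \<forall>h. norm h < d \<longrightarrow> Lp_mass p (\<lambda>x. f (x - h) - f x) \<le> ennreal e"
proof -
  have [measurable]: "f \<in> borel_measurable borel" using f by (simp add: Lp_space_iff)
  define F where "F x = sgn (f x) * \<bar>f x\<bar> powr p" for x
  have [measurable]: "F \<in> borel_measurable borel" unfolding F_def by measurable
  have "\<bar>F x\<bar> = \<bar>f x\<bar> powr p" for x
    by (auto simp: F_def abs_mult sgn_if)
  then have "integrable lborel F"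
    using f by (simp add: integrable_iff_bounded Lp_space_iff Lp_mass_def)
  then obtain d where d: "d > 0"
    "\<And>h. norm h < d \<Longrightarrow> (\<integral>\<^sup>+x. ennreal \<bar>F (x - h) - F x\<bar> \<partial>lborel) \<le> ennreal (e / 2 powr p)"
    using translation_continuous_L1[of F "e / 2 powr p"] e by auto
  show ?thesis
  proof (intro exI[of _ d] conjI allI impI d)
    fix h :: 'a assume "norm h < d"
    have "Lp_mass p (\<lambda>x. f (x - h) - f x) \<le> (\<integral>\<^sup>+x. ennreal (2 powr p) * ennreal \<bar>F (x - h) - F x\<bar> \<partial>lborel)"
      unfolding Lp_mass_def F_def using powr_diff_le_signed_powr_diff[OF p]
      by (intro nn_integral_mono) (simp flip: ennreal_mult add: ennreal_leI)
    also have "\<dots> = ennreal (2 powr p) * (\<integral>\<^sup>+x. ennreal \<bar>F (x - h) - F x\<bar> \<partial>lborel)"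
      by (rule nn_integral_cmult) auto
    also have "\<dots> \<le> ennreal (2 powr p) * ennreal (e / 2 powr p)"
      using d \<open>norm h < d\<close> by (intro mult_left_mono) auto
    also have "\<dots> = ennreal e" using e by (simp flip: ennreal_mult)
    finally show "Lp_mass p (\<lambda>x. f (x - h) - f x) \<le> ennreal e" .
  qed
qed

section \<open>Locally integrable functions\<close>

text \<open>Local integrability gives measurability of each restriction to a ball, and
  \<open>f\<close> is the pointwise limit of these restrictions.\<close>

lemma locally_integrable_measurable [measurable_dest]:
  assumes "locally_integrable f"
  shows "f \<in> borel_measurable borel"
proof -
  have "(\<lambda>n. indicator (cball 0 (real n)) x *\<^sub>R f x) \<longlonglongrightarrow> f x" for x
  proof (rule tendsto_eventually)
    obtain N where "norm x \<le> real N" using real_arch_simple by blast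
    then show "\<forall>\<^sub>F n in sequentially. indicator (cball 0 (real n)) x *\<^sub>R f x = f x"
      unfolding eventually_sequentially by (intro exI[of _ N]) (auto simp: indicator_def)
  qed
  moreover have "(\<lambda>x. indicator (cball 0 (real n)) x *\<^sub>R f x) \<in> borel_measurable lborel" for n
    by (rule borel_measurable_integrable)
      (use assms in \<open>auto simp: locally_integrable_def set_integrable_def simp del: real_scaleR_def\<close>)
  ultimately have "f \<in> borel_measurable lborel"
    by (rule borel_measurable_LIMSEQ_metric[rotated])
  then show ?thesis by simp
qed

text \<open>The bounded factor is a general measurable function, because besides test functions it
  will be an indicator times a smooth function, a power of a test function, or the truncated tail
  \<open>H\<close> of a trace kernel.\<close>

lemma locally_integrable_mult_bounded_support:
  assumes f: "locally_integrable f" and [measurable]: "g \<in> borel_measurable borel"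
    and M: "\<And>x. \<bar>g x\<bar> \<le> M" and R: "\<And>x. g x \<noteq> 0 \<Longrightarrow> x \<in> K" "compact K"
  shows "integrable lborel (\<lambda>x. g x * f x)"
proof (rule Bochner_Integration.integrable_bound)
  have [measurable]: "f \<in> borel_measurable borel" using f by (rule locally_integrable_measurable)
  show "integrable lborel (\<lambda>x. M * (indicator K x *\<^sub>R f x))"
    using f R(2) unfolding locally_integrable_def set_integrable_def by auto
  have "M \<ge> 0" using M[of 0] by simp
  show "AE x in lborel. norm (g x * f x) \<le> norm (M * (indicator K x *\<^sub>R f x))"
  proof (rule AE_I2)
    fix x
    show "norm (g x * f x) \<le> norm (M * (indicator K x *\<^sub>R f x))"
      using M[of x] R(1)[of x] \<open>M \<ge> 0\<close>
      by (cases "g x = 0") (auto simp: abs_mult intro!: mult_right_mono)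
  qed
  show "(\<lambda>x. g x * f x) \<in> borel_measurable lborel" by measurable
qed

lemma test_function_support:
  assumes "test_function g"
  shows "\<exists>R. \<forall>x. g x \<noteq> 0 \<longrightarrow> norm x \<le> R"
  using assms test_function_iff by blast

lemma test_function_bound:
  assumes "test_function g"
  shows "\<exists>M\<ge>0. \<forall>x. \<bar>g x\<bar> \<le> M"
proof -
  obtain R where R: "\<And>x. g x \<noteq> 0 \<Longrightarrow> norm x \<le> R"
    using test_function_support[OF assms] by blast
  have "compact (g ` cball 0 R)"
    by (intro compact_continuous_image C_infinity_continuous_on test_function_C_infinity assms compact_cball)
  then obtain M where M: "\<And>x. x \<in> cball 0 R \<Longrightarrow> norm (g x) \<le> M"
    using compact_imp_bounded bounded_iff by (metis imageI)
  have "\<bar>g x\<bar> \<le> max M 0" for x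
    using M[of x] R[of x] by (cases "g x = 0") auto
  then show ?thesis by (intro exI[of _ "max M 0"]) auto
qed

lemma test_function_measurable [measurable_dest]: "test_function g \<Longrightarrow> g \<in> borel_measurable borel"
  by (simp add: C_infinity_measurable test_function_C_infinity)

lemma test_function_mult_integrable:
  assumes "test_function g" "locally_integrable f"
  shows "integrable lborel (\<lambda>x. g x * f x)"
proof -
  obtain M R where "\<And>x. \<bar>g x\<bar> \<le> M" "\<And>x. g x \<noteq> 0 \<Longrightarrow> norm x \<le> R"
    using test_function_bound[OF assms(1)] test_function_support[OF assms(1)] by blast
  then show ?thesis
    using assms by (intro locally_integrable_mult_bounded_support[of f g M "cball 0 R"])
      (auto intro: test_function_measurable)
qed

lemma continuous_imp_locally_integrable:
  "continuous_on UNIV f \<Longrightarrow> locally_integrable f"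
  unfolding locally_integrable_def
  by (meson borel_integrable_compact continuous_on_subset set_integrable_def top_greatest)

lemma C_infinity_locally_integrable: "f \<in> C_infinity \<Longrightarrow> locally_integrable f"
  by (intro continuous_imp_locally_integrable C_infinity_continuous_on)

lemma test_function_integrable: "test_function g \<Longrightarrow> integrable lborel g"
  using test_function_mult_integrable[of g "\<lambda>x. 1"] C_infinity_locally_integrable by auto

lemma Lp_imp_locally_integrable:
  assumes p: "p \<ge> 1" and f: "f \<in> Lp_space p"
  shows "locally_integrable f"
  unfolding locally_integrable_def set_integrable_def
proof (intro allI impI)
  fix K :: "'a set" assume K: "compact K"
  have [measurable]: "f \<in> borel_measurable borel" "K \<in> sets borel"
    using f K by (auto simp: Lp_space_iff borel_compact)
  \<comment> \<open>This bound replaces Hoelder's inequality: on a compact set the constant 1 is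
    integrable.\<close>
  have le: "\<bar>t\<bar> \<le> 1 + \<bar>t\<bar> powr p" for t :: real
  proof (cases "\<bar>t\<bar> \<le> 1")
    case False
    then have "\<bar>t\<bar> powr 1 \<le> \<bar>t\<bar> powr p" using p by (intro powr_mono) auto
    then show ?thesis using False by simp
  qed (simp add: add_increasing2)
  show "integrable lborel (\<lambda>x. indicator K x *\<^sub>R f x)"
  proof (rule Bochner_Integration.integrable_bound)
    show "integrable lborel (\<lambda>x. indicator K x + \<bar>f x\<bar> powr p)"
      using f K by (intro Bochner_Integration.integrable_add)
        (auto simp: Lp_space_def simp del: infinity_ennreal_def
          intro!: integrable_real_indicator emeasure_bounded_finite compact_imp_bounded)
    show "AE x in lborel. norm (indicator K x *\<^sub>R f x) \<le> norm (indicator K x + \<bar>f x\<bar> powr p)"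
      using le by (intro AE_I2) (auto simp: indicator_def)
    show "(\<lambda>x. indicator K x *\<^sub>R f x) \<in> borel_measurable lborel" by measurable
  qed
qed

lemma locally_integrable_add:
  "locally_integrable f \<Longrightarrow> locally_integrable g \<Longrightarrow> locally_integrable (\<lambda>x. f x + g x)"
  unfolding locally_integrable_def by (auto intro: set_integral_add(1))

lemma locally_integrable_diff:
  "locally_integrable f \<Longrightarrow> locally_integrable g \<Longrightarrow> locally_integrable (\<lambda>x. f x - g x)"
  unfolding locally_integrable_def by (auto intro: set_integral_diff(1))

lemma locally_integrable_mult_C_infinity:
  assumes f: "locally_integrable f" and g: "g \<in> C_infinity"
  shows "locally_integrable (\<lambda>x. g x * f x)"
  unfolding locally_integrable_def set_integrable_def
proof (intro allI impI)
  fix K :: "'a set" assume K: "compact K"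
  have [measurable]: "g \<in> borel_measurable borel" "K \<in> sets borel"
    using g K by (auto simp: borel_compact C_infinity_measurable)
  have "compact (g ` K)"
    by (intro compact_continuous_image C_infinity_continuous_on g K)
  then obtain M where M: "\<And>x. x \<in> K \<Longrightarrow> norm (g x) \<le> M"
    using compact_imp_bounded bounded_iff by (metis imageI)
  have "integrable lborel (\<lambda>x. (indicator K x * g x) * f x)"
    by (rule locally_integrable_mult_bounded_support[OF f, of _ "max M 0" K])
      (use M K in \<open>auto simp: indicator_def le_max_iff_disj\<close>)
  then show "integrable lborel (\<lambda>x. indicator K x *\<^sub>R (g x * f x))"
    by (simp add: mult.assoc)
qed

section \<open>Convolution\<close>

definition convolve :: "('a::euclidean_space \<Rightarrow> real) \<Rightarrow> ('a \<Rightarrow> real) \<Rightarrow> 'a \<Rightarrow> real" where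
  "convolve K f x = (\<integral>y. K (x - y) * f y \<partial>lborel)"

lemma convolve_measurable [measurable]:
  assumes [measurable]: "K \<in> borel_measurable borel" "f \<in> borel_measurable borel"
  shows "convolve K f \<in> borel_measurable borel"
proof -
  have "convolve K f \<in> borel_measurable lborel"
    unfolding convolve_def by measurable
  then show ?thesis by simp
qed

lemma convolve_integrable:
  "test_function K \<Longrightarrow> locally_integrable f \<Longrightarrow> integrable lborel (\<lambda>y. K (x - y) * f y)"
  by (intro test_function_mult_integrable test_function_reflect)

lemma convolve_alt:
  assumes [measurable]: "K \<in> borel_measurable borel" "f \<in> borel_measurable borel"
  shows "convolve K f x = (\<integral>y. K y * f (x - y) \<partial>lborel)"
  using integral_lborel_reflect[of "\<lambda>y. K y * f (x - y)" x] by (simp add: convolve_def)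

lemma convolve_commute:
  assumes "K \<in> borel_measurable borel" "f \<in> borel_measurable borel"
  shows "convolve K f = convolve f K"
  by (rule ext) (subst convolve_alt[OF assms], simp add: convolve_def mult.commute)

lemma convolve_diff:
  assumes "test_function K" "locally_integrable f" "locally_integrable g"
  shows "convolve K (\<lambda>x. f x - g x) x = convolve K f x - convolve K g x"
  using convolve_integrable[OF assms(1,2)] convolve_integrable[OF assms(1,3)]
  by (simp add: convolve_def right_diff_distrib)

lemma convolve_nonzero:
  assumes "convolve K f x \<noteq> 0"
  obtains y where "K (x - y) \<noteq> 0" "f y \<noteq> 0"
proof -
  have "\<exists>y. K (x - y) * f y \<noteq> 0"
  proof (rule ccontr)
    assume "\<nexists>y. K (x - y) * f y \<noteq> 0"
    then have "\<And>y. K (x - y) * f y = 0" by blast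
    then have "(\<lambda>y. K (x - y) * f y) = (\<lambda>y. 0)" by (rule ext)
    then have "convolve K f x = 0" unfolding convolve_def by (simp only: integral_zero)
    with assms show False by simp
  qed
  then show ?thesis using that by auto
qed

section \<open>Differentiation of convolutions\<close>

text \<open>Two points at distance less than 1 either both lie in the enlarged compact ball, where
  continuity is uniform, or both lie outside the support.\<close>

lemma test_function_uniformly_continuous:
  assumes "test_function g"
  shows "uniformly_continuous_on UNIV g"
proof -
  obtain R where R: "\<And>x. g x \<noteq> 0 \<Longrightarrow> norm x \<le> R"
    using test_function_support[OF assms] by blast
  have u: "uniformly_continuous_on (cball 0 (R + 1)) g"
    by (intro compact_uniformly_continuous C_infinity_continuous_on test_function_C_infinity assms compact_cball)
  show ?thesis
    unfolding uniformly_continuous_on_def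
  proof (intro allI impI)
    fix e :: real assume e: "e > 0"
    obtain d where d: "d > 0" "\<And>x y. x \<in> cball 0 (R + 1) \<Longrightarrow> y \<in> cball 0 (R + 1) \<Longrightarrow> dist y x < d \<Longrightarrow> dist (g y) (g x) < e"
      using u e unfolding uniformly_continuous_on_def by metis
    show "\<exists>d>0. \<forall>x\<in>UNIV. \<forall>y\<in>UNIV. dist y x < d \<longrightarrow> dist (g y) (g x) < e"
    proof (intro exI[of _ "min d 1"] conjI ballI impI)
      fix x y :: 'a assume xy: "dist y x < min d 1"
      then have "norm (y - x) < 1" by (simp add: dist_norm)
      then have n: "norm x < norm y + 1" "norm y < norm x + 1"
        using norm_triangle_ineq2[of x y] norm_triangle_ineq2[of y x] by (simp_all add: norm_minus_commute)
      show "dist (g y) (g x) < e"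
      proof (cases "x \<in> cball 0 (R + 1) \<and> y \<in> cball 0 (R + 1)")
        case False
        then have "g x = 0" "g y = 0" using n R[of x] R[of y] by force+
        then show ?thesis using e by simp
      qed (use d xy in auto)
    qed (use d in auto)
  qed
qed

text \<open>The mean value theorem for g (z + t h) minus its linear part in t, combined with uniform
  continuity of the partial derivatives, makes the remainder uniform in \<open>z\<close>. Uniformity
  allows the remainder to be integrated against a function that is merely locally
  integrable.\<close>

lemma test_function_uniformly_differentiable:
  fixes g :: "'a::euclidean_space \<Rightarrow> real"
  assumes g: "test_function g" and e: "e > 0"
  shows "\<exists>d>0. \<forall>z h. norm h < d \<longrightarrow>
    \<bar>g (z + h) - g z - (\<Sum>i\<in>Basis. (h \<bullet> i) * partial_deriv i g z)\<bar> \<le> e * norm h"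
proof -
  define e' where "e' = e / DIM('a)"
  have e': "e' > 0" using e by (simp add: e'_def)
  have "\<exists>d>0. \<forall>z h. norm h < d \<longrightarrow> \<bar>partial_deriv i g (z + h) - partial_deriv i g z\<bar> \<le> e'" if "i \<in> Basis" for i
  proof -
    have "uniformly_continuous_on UNIV (partial_deriv i g)"
      by (intro test_function_uniformly_continuous test_function_partial_deriv g that)
    then obtain d where d: "d > 0" "\<And>x y. dist y x < d \<Longrightarrow> dist (partial_deriv i g y) (partial_deriv i g x) < e'"
      using e' unfolding uniformly_continuous_on_def by auto
    then show ?thesis
      by (intro exI[of _ d]) (auto simp: dist_norm real_norm_def intro!: less_imp_le)
  qed
  then obtain d where d: "\<And>i. i \<in> Basis \<Longrightarrow> d i > 0"
    "\<And>i z h. i \<in> Basis \<Longrightarrow> norm h < d i \<Longrightarrow> \<bar>partial_deriv i g (z + h) - partial_deriv i g z\<bar> \<le> e'"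
    by metis
  define d' where "d' = Min (d ` Basis)"
  have d': "d' > 0" "\<And>i. i \<in> Basis \<Longrightarrow> d' \<le> d i" using d by (auto simp: d'_def)
  show ?thesis
  proof (intro exI[of _ d'] conjI allI impI d')
    fix z h :: 'a assume h: "norm h < d'"
    let ?D = "\<lambda>x. \<Sum>i\<in>Basis. (h \<bullet> i) * partial_deriv i g x"
    have "((\<lambda>t. g (z + t *\<^sub>R h) - t * ?D z) has_real_derivative (?D (z + t *\<^sub>R h) - ?D z)) (at t)" for t
      by (rule DERIV_diff[OF C_infinity_DERIV_line[OF test_function_C_infinity[OF g]]])
        (auto intro!: derivative_eq_intros)
    then obtain t where t: "0 < t" "t < 1"
      "(g (z + 1 *\<^sub>R h) - 1 * ?D z) - (g (z + 0 *\<^sub>R h) - 0 * ?D z) = (1 - 0) * (?D (z + t *\<^sub>R h) - ?D z)"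
      using MVT2[of 0 1 "\<lambda>t. g (z + t *\<^sub>R h) - t * ?D z" "\<lambda>t. ?D (z + t *\<^sub>R h) - ?D z"] by auto
    have "norm (t *\<^sub>R h) \<le> 1 * norm h" using t by (simp add: mult_left_le_one_le)
    then have th: "norm (t *\<^sub>R h) < d'" using h by simp
    have "\<bar>?D (z + t *\<^sub>R h) - ?D z\<bar> = \<bar>\<Sum>i\<in>Basis. (h \<bullet> i) * (partial_deriv i g (z + t *\<^sub>R h) - partial_deriv i g z)\<bar>"
      by (simp add: right_diff_distrib sum_subtractf)
    also have "\<dots> \<le> (\<Sum>i\<in>(Basis::'a set). norm h * e')"
      using d(2)[of _ "t *\<^sub>R h" z] th d'(2) Basis_le_norm[of _ h]
      by (intro order_trans[OF sum_abs] sum_mono) (force simp: abs_mult intro!: mult_mono)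
    also have "\<dots> = e * norm h" by (simp add: e'_def)
    finally show "\<bar>g (z + h) - g z - ?D z\<bar> \<le> e * norm h" using t(3) by (simp add: algebra_simps)
  qed
qed

lemma convolve_has_derivative:
  fixes K f :: "'a::euclidean_space \<Rightarrow> real"
  assumes K: "test_function K" and f: "locally_integrable f"
  shows "(convolve K f has_derivative (\<lambda>h. \<Sum>i\<in>Basis. (h \<bullet> i) * convolve (partial_deriv i K) f x)) (at x)"
  unfolding has_derivative_at_alt
proof (intro conjI allI impI)
  let ?D = "\<lambda>h. \<Sum>i\<in>Basis. (h \<bullet> i) * convolve (partial_deriv i K) f x"
  show "bounded_linear ?D"
    by (intro bounded_linear_sum bounded_linear_mult_const bounded_linear_inner_left)
  fix e :: real assume e: "e > 0"
  have [measurable]: "f \<in> borel_measurable borel" using f by (rule locally_integrable_measurable)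
  obtain R where R: "\<And>x. K x \<noteq> 0 \<Longrightarrow> norm x \<le> R"
    using test_function_support[OF K] by blast
  \<comment> \<open>For |h| < 1 the integrand of the remainder vanishes outside this ball, on which
    |f| has a finite integral m.\<close>
  define B where "B = cball x (R + 1)"
  have fB: "integrable lborel (\<lambda>y. indicator B y * \<bar>f y\<bar>)"
    using f[unfolded locally_integrable_def, rule_format, of B, THEN set_integrable_abs]
    by (simp add: B_def set_integrable_def)
  define m where "m = (\<integral>y. indicator B y * \<bar>f y\<bar> \<partial>lborel)"
  have m: "m \<ge> 0" by (simp add: m_def)
  define e' where "e' = e / (m + 1)"
  have e': "e' > 0" "e' * m \<le> e" using e m by (auto simp: e'_def field_simps)
  obtain d where d: "d > 0" "\<And>z h. norm h < d \<Longrightarrow>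
     \<bar>K (z + h) - K z - (\<Sum>i\<in>Basis. (h \<bullet> i) * partial_deriv i K z)\<bar> \<le> e' * norm h"
    using test_function_uniformly_differentiable[OF K e'(1)] by auto
  show "\<exists>d>0. \<forall>y. norm (y - x) < d \<longrightarrow> norm (convolve K f y - convolve K f x - ?D (y - x)) \<le> e * norm (y - x)"
  proof (intro exI[of _ "min d 1"] conjI allI impI)
    fix y assume y: "norm (y - x) < min d 1"
    define h where "h = y - x"
    let ?T = "\<lambda>z. K (x - z + h) - K (x - z) - (\<Sum>i\<in>Basis. (h \<bullet> i) * partial_deriv i K (x - z))"
    have i1: "integrable lborel (\<lambda>z. K (x - z + h) * f z)"
      using convolve_integrable[OF K f, of y] by (simp add: h_def algebra_simps)
    have i3: "integrable lborel (\<lambda>z. (h \<bullet> i) * (partial_deriv i K (x - z) * f z))" if "i \<in> Basis" for i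
      using convolve_integrable[OF test_function_partial_deriv[OF K that] f, of x] by simp
    have fe: "(\<lambda>z. K (x - z + h) * f z - K (x - z) * f z -
        (\<Sum>i\<in>Basis. (h \<bullet> i) * (partial_deriv i K (x - z) * f z))) = (\<lambda>z. ?T z * f z)"
      by (auto simp: algebra_simps sum_distrib_left)
    have iT: "integrable lborel (\<lambda>z. ?T z * f z)"
      unfolding fe[symmetric]
      by (intro Bochner_Integration.integrable_diff Bochner_Integration.integrable_sum i1 i3 convolve_integrable K f)
    have "convolve K f y - convolve K f x - ?D h =
        (\<integral>z. K (x - z + h) * f z \<partial>lborel) - (\<integral>z. K (x - z) * f z \<partial>lborel) -
        (\<integral>z. (\<Sum>i\<in>Basis. (h \<bullet> i) * (partial_deriv i K (x - z) * f z)) \<partial>lborel)"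
    proof -
      have "(\<integral>z. (\<Sum>i\<in>Basis. (h \<bullet> i) * (partial_deriv i K (x - z) * f z)) \<partial>lborel) = ?D h"
        using i3 by (simp add: convolve_def)
      moreover have "convolve K f y = (\<integral>z. K (x - z + h) * f z \<partial>lborel)"
        by (simp add: convolve_def h_def algebra_simps)
      ultimately show ?thesis by (simp add: convolve_def)
    qed
    also have "\<dots> = (\<integral>z. K (x - z + h) * f z - K (x - z) * f z -
        (\<Sum>i\<in>Basis. (h \<bullet> i) * (partial_deriv i K (x - z) * f z)) \<partial>lborel)"
      using i1 i3 convolve_integrable[OF K f, of x] by simp
    also have "\<dots> = (\<integral>z. ?T z * f z \<partial>lborel)"
      by (simp only: fe)
    finally have eq: "convolve K f y - convolve K f x - ?D h = (\<integral>z. ?T z * f z \<partial>lborel)" .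
    have bound: "\<bar>?T z * f z\<bar> \<le> (e' * norm h) * (indicator B z * \<bar>f z\<bar>)" for z
    proof (cases "z \<in> B")
      case True
      then show ?thesis using d(2)[of h "x - z"] y
        by (auto simp: h_def abs_mult intro!: mult_right_mono)
    next
      case False
      then have n: "norm (x - z) > R + 1" by (simp add: B_def dist_norm)
      moreover have "norm (x - z) \<le> norm (x - z + h) + norm h"
        using norm_triangle_ineq4[of "x - z + h" h] by simp
      ultimately have "norm (x - z + h) > R" using y by (simp add: h_def)
      then have "K (x - z + h) = 0" "K (x - z) = 0" "partial_deriv i K (x - z) = 0" for i
        using R n partial_deriv_eq_0_outside[of K R i, OF R] by force+
      then show ?thesis using e' by simp
    qed
    have "\<bar>\<integral>z. ?T z * f z \<partial>lborel\<bar> \<le> (\<integral>z. (e' * norm h) * (indicator B z * \<bar>f z\<bar>) \<partial>lborel)"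
      using fB bound iT by (intro integral_abs_bound_integral) auto
    also have "\<dots> = (e' * m) * norm h" by (simp add: m_def)
    also have "\<dots> \<le> e * norm h" using e' by (intro mult_right_mono) auto
    finally show "norm (convolve K f y - convolve K f x - ?D (y - x)) \<le> e * norm (y - x)"
      using eq by (simp add: h_def)
  qed (use d in auto)
qed

lemma partial_deriv_convolve:
  assumes "test_function K" "locally_integrable f" "i \<in> Basis"
  shows "partial_deriv i (convolve K f) = convolve (partial_deriv i K) f"
proof
  fix x
  show "partial_deriv i (convolve K f) x = convolve (partial_deriv i K) f x"
    using partial_deriv_eq(2)[OF convolve_has_derivative[OF assms(1,2)], of i x]
    unfolding sum_inner_Basis_mult[OF assms(3)] .
qed

text \<open>Differentiation falls on the kernel, so with \<open>f\<close> fixed and the kernel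
  varying over all test functions the set of convolutions is stable under differentiation.\<close>

lemma convolve_C_infinity:
  assumes "test_function K" "locally_integrable f"
  shows "convolve K f \<in> C_infinity"
proof (rule C_infinity_coinduct[of _ "{convolve K f |K. test_function K}"])
  show "partial_deriv i g \<in> {convolve K f |K. test_function K}"
    if "g \<in> {convolve K f |K. test_function K}" "i \<in> Basis" for g i
    using that partial_deriv_convolve[OF _ assms(2)] test_function_partial_deriv by blast
  show "g differentiable_on UNIV" if "g \<in> {convolve K f |K. test_function K}" for g
    using that convolve_has_derivative[OF _ assms(2)]
    by (fastforce simp: differentiable_on_def differentiable_def)
qed (use assms in auto)

lemma iter_partial_deriv_convolve:
  assumes "test_function K" "locally_integrable f" "is \<in> lists Basis"
  shows "iter_partial_deriv is (convolve K f) = convolve (iter_partial_deriv is K) f"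
  using assms(3)
  by (induction "is") (auto simp: partial_deriv_convolve test_function_iter_partial_deriv assms)

lemma test_function_convolve:
  assumes K: "test_function K" and f: "locally_integrable f" and R: "\<And>x. f x \<noteq> 0 \<Longrightarrow> norm x \<le> R"
  shows "test_function (convolve K f)"
proof -
  obtain R' where R': "\<And>x. K x \<noteq> 0 \<Longrightarrow> norm x \<le> R'"
    using test_function_support[OF K] by blast
  have "norm x \<le> R' + R" if x: "convolve K f x \<noteq> 0" for x
  proof -
    obtain y where "K (x - y) \<noteq> 0" "f y \<noteq> 0" using x by (rule convolve_nonzero)
    then show ?thesis using R[of y] R'[of "x - y"] norm_triangle_sub[of x y] by simp
  qed
  then show ?thesis
    using convolve_C_infinity[OF K f] test_function_iff by blast
qed

section \<open>Adjoint of the convolution and Young's inequality\<close>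

lemma integrable_pair_mult:
  fixes f :: "'a::euclidean_space \<Rightarrow> real" and g :: "'b::euclidean_space \<Rightarrow> real"
  assumes f: "integrable lborel f" and g: "integrable lborel g"
  shows "integrable (lborel \<Otimes>\<^sub>M lborel) (\<lambda>(x, y). f x * g y)"
proof (rule integrableI_bounded)
  have [measurable]: "f \<in> borel_measurable borel" "g \<in> borel_measurable borel" using f g by auto
  show "(\<lambda>(x, y). f x * g y) \<in> borel_measurable (lborel \<Otimes>\<^sub>M lborel)" by measurable
  have "(\<integral>\<^sup>+z. ennreal (norm (case z of (x, y) \<Rightarrow> f x * g y)) \<partial>(lborel \<Otimes>\<^sub>M lborel)) =
     (\<integral>\<^sup>+x. \<integral>\<^sup>+y. ennreal \<bar>f x\<bar> * ennreal \<bar>g y\<bar> \<partial>lborel \<partial>lborel)"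
    by (subst lborel.nn_integral_fst[symmetric]) (auto simp: abs_mult ennreal_mult)
  also have "\<dots> = (\<integral>\<^sup>+x. ennreal \<bar>f x\<bar> \<partial>lborel) * (\<integral>\<^sup>+y. ennreal \<bar>g y\<bar> \<partial>lborel)"
    by (simp add: nn_integral_cmult nn_integral_multc)
  also have "\<dots> < \<infinity>"
    using f g by (auto simp: integrable_iff_bounded ennreal_mult_less_top)
  finally show "(\<integral>\<^sup>+z. ennreal (norm (case z of (x, y) \<Rightarrow> f x * g y)) \<partial>(lborel \<Otimes>\<^sub>M lborel)) < \<infinity>" .
qed

text \<open>The adjoint of convolution with \<open>K\<close> is convolution with the reflected
  kernel, written with \<open>0 - z\<close> to be an instance of
  \<open>test_function_reflect\<close>. Since \<open>u\<close> is only locally integrable, the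
  supports of \<open>K\<close> and \<open>\<phi>\<close> confine it to a ball before Fubini's
  theorem is applied.\<close>

lemma integral_convolve_mult:
  fixes K u \<phi> :: "'a::euclidean_space \<Rightarrow> real"
  assumes K: "test_function K" and u: "locally_integrable u" and \<phi>: "test_function \<phi>"
  shows "(\<integral>x. convolve K u x * \<phi> x \<partial>lborel) = (\<integral>y. u y * convolve \<phi> (\<lambda>z. K (0 - z)) y \<partial>lborel)"
proof -
  have [measurable]: "K \<in> borel_measurable borel" "u \<in> borel_measurable borel" "\<phi> \<in> borel_measurable borel"
    using K u \<phi> by (auto intro: test_function_measurable locally_integrable_measurable)
  obtain M R where M: "\<And>x. \<bar>K x\<bar> \<le> M" and R: "\<And>x. K x \<noteq> 0 \<Longrightarrow> norm x \<le> R"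
    using test_function_bound[OF K] test_function_support[OF K] by blast
  obtain R' where R': "\<And>x. \<phi> x \<noteq> 0 \<Longrightarrow> norm x \<le> R'"
    using test_function_support[OF \<phi>] by blast
  define B where "B = cball (0::'a) (R + R')"
  have uB: "integrable lborel (\<lambda>y. M * (indicator B y * u y))"
    using u by (auto simp: locally_integrable_def set_integrable_def B_def)
  have int: "integrable (lborel \<Otimes>\<^sub>M lborel) (\<lambda>(x, y). K (x - y) * u y * \<phi> x)"
  proof (rule Bochner_Integration.integrable_bound[OF integrable_pair_mult[OF test_function_integrable[OF \<phi>] uB]])
    show "AE z in lborel \<Otimes>\<^sub>M lborel. norm (case z of (x, y) \<Rightarrow> K (x - y) * u y * \<phi> x)
       \<le> norm (case z of (x, y) \<Rightarrow> \<phi> x * (M * (indicator B y * u y)))"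
    proof (intro AE_I2, clarsimp simp: abs_mult)
      fix x y
      show "\<bar>K (x - y)\<bar> * \<bar>u y\<bar> * \<bar>\<phi> x\<bar> \<le> \<bar>\<phi> x\<bar> * (\<bar>M\<bar> * (indicator B y * \<bar>u y\<bar>))"
      proof (cases "K (x - y) = 0 \<or> \<phi> x = 0")
        case False
        then have "norm (x - y) \<le> R" "norm x \<le> R'" using R R' by auto
        then have "norm y \<le> R + R'" using norm_triangle_ineq3[of x y] norm_triangle_sub[of y x] by (simp add: norm_minus_commute)
        then have "y \<in> B" by (simp add: B_def)
        moreover have "\<bar>K (x - y)\<bar> \<le> \<bar>M\<bar>" using M[of "x - y"] by simp
        then have "\<bar>K (x - y)\<bar> * (\<bar>u y\<bar> * \<bar>\<phi> x\<bar>) \<le> \<bar>M\<bar> * (\<bar>u y\<bar> * \<bar>\<phi> x\<bar>)"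
          by (intro mult_right_mono) auto
        ultimately show ?thesis by (simp add: mult_ac)
      qed auto
    qed
  qed measurable
  have "(\<integral>x. convolve K u x * \<phi> x \<partial>lborel) = (\<integral>x. (\<integral>y. K (x - y) * u y * \<phi> x \<partial>lborel) \<partial>lborel)"
    by (simp add: convolve_def)
  also have "\<dots> = (\<integral>y. (\<integral>x. K (x - y) * u y * \<phi> x \<partial>lborel) \<partial>lborel)"
    using lborel_pair.Fubini_integral[OF int] by simp
  also have "\<dots> = (\<integral>y. u y * convolve \<phi> (\<lambda>z. K (0 - z)) y \<partial>lborel)"
  proof (intro Bochner_Integration.integral_cong refl)
    fix y
    have "convolve \<phi> (\<lambda>z. K (0 - z)) y = (\<integral>x. \<phi> x * K (x - y) \<partial>lborel)"
      by (subst convolve_alt) auto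
    then show "(\<integral>x. K (x - y) * u y * \<phi> x \<partial>lborel) = u y * convolve \<phi> (\<lambda>z. K (0 - z)) y"
      by (simp add: mult_ac flip: integral_mult_right_zero)
  qed
  finally show ?thesis .
qed

text \<open>Young's inequality: Jensen's inequality at each point with weight |K (x - y)|, then
  Tonelli's theorem.\<close>

lemma Lp_mass_convolve_le:
  assumes p: "p \<ge> 1" and K: "integrable lborel K" and [measurable]: "f \<in> borel_measurable borel"
  shows "Lp_mass p (convolve K f) \<le> ennreal ((\<integral>x. \<bar>K x\<bar> \<partial>lborel) powr p) * Lp_mass p f"
proof -
  have [measurable]: "K \<in> borel_measurable borel" using K by auto
  define m where "m = (\<integral>x. \<bar>K x\<bar> \<partial>lborel)"
  have m: "m \<ge> 0" by (simp add: m_def)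
  have mm: "(\<integral>y. \<bar>K (x - y)\<bar> \<partial>lborel) = m" for x
    unfolding m_def by (rule integral_lborel_reflect[of "\<lambda>y. \<bar>K y\<bar>"]) auto
  have "Lp_mass p (convolve K f) \<le>
    (\<integral>\<^sup>+x. ennreal (m powr (p - 1)) * (\<integral>\<^sup>+y. ennreal (\<bar>K (x - y)\<bar> * \<bar>f y\<bar> powr p) \<partial>lborel) \<partial>lborel)"
    unfolding Lp_mass_def convolve_def
    using powr_integral_le[OF p integrable_lborel_reflect[OF K], of f] by (intro nn_integral_mono) (simp add: mm)
  also have "\<dots> = ennreal (m powr (p - 1)) * (\<integral>\<^sup>+x. \<integral>\<^sup>+y. ennreal (\<bar>K (x - y)\<bar> * \<bar>f y\<bar> powr p) \<partial>lborel \<partial>lborel)"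
    by (rule nn_integral_cmult) measurable
  also have "(\<integral>\<^sup>+x. \<integral>\<^sup>+y. ennreal (\<bar>K (x - y)\<bar> * \<bar>f y\<bar> powr p) \<partial>lborel \<partial>lborel) =
      (\<integral>\<^sup>+y. \<integral>\<^sup>+x. ennreal \<bar>K (x - y)\<bar> * ennreal (\<bar>f y\<bar> powr p) \<partial>lborel \<partial>lborel)"
    by (subst lborel_pair.Fubini') (auto simp: ennreal_mult)
  also have "\<dots> = (\<integral>\<^sup>+y. ennreal m * ennreal (\<bar>f y\<bar> powr p) \<partial>lborel)"
  proof (intro nn_integral_cong)
    fix y
    have "(\<integral>\<^sup>+x. ennreal \<bar>K (x - y)\<bar> \<partial>lborel) = (\<integral>\<^sup>+x. ennreal \<bar>K x\<bar> \<partial>lborel)"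
      by (rule nn_integral_lborel_translate[of "\<lambda>x. ennreal \<bar>K x\<bar>"]) auto
    also have "\<dots> = ennreal m"
      unfolding m_def using K by (intro nn_integral_eq_integral) auto
    finally show "(\<integral>\<^sup>+x. ennreal \<bar>K (x - y)\<bar> * ennreal (\<bar>f y\<bar> powr p) \<partial>lborel) = ennreal m * ennreal (\<bar>f y\<bar> powr p)"
      by (simp add: nn_integral_multc)
  qed
  also have "\<dots> = ennreal m * Lp_mass p f"
    by (simp add: nn_integral_cmult Lp_mass_def)
  also have "ennreal (m powr (p - 1)) * (ennreal m * Lp_mass p f) = ennreal (m powr p) * Lp_mass p f"
  proof -
    have "m powr (p - 1) * m = m powr p" using m by (cases "m = 0") (auto simp: powr_diff)
    then show ?thesis using m by (simp add: mult.assoc[symmetric] ennreal_mult[symmetric])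
  qed
  finally show ?thesis by (simp add: m_def)
qed

lemma convolve_Lp:
  assumes "p \<ge> 1" "integrable lborel K" "f \<in> Lp_space p"
  shows "convolve K f \<in> Lp_space p"
proof -
  have [measurable]: "K \<in> borel_measurable borel" "f \<in> borel_measurable borel"
    using assms by (auto simp: Lp_space_iff)
  have "Lp_mass p (convolve K f) < \<infinity>"
    using Lp_mass_convolve_le[OF assms(1,2), of f] assms(3)
    by (auto simp: Lp_space_iff ennreal_mult_less_top intro: le_less_trans)
  then show ?thesis by (simp add: Lp_space_iff)
qed

section \<open>Mollifiers\<close>

text \<open>Only the radius of the support is prescribed, not a rescaled profile: the predicate must
  also cover tensor products of kernels with very different scales.\<close>

definition mollifier :: "real \<Rightarrow> ('a::euclidean_space \<Rightarrow> real) \<Rightarrow> bool" where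
  "mollifier r K \<longleftrightarrow> test_function K \<and> (\<forall>x. K x \<ge> 0) \<and> (\<integral>x. K x \<partial>lborel) = 1 \<and> (\<forall>x. K x \<noteq> 0 \<longrightarrow> norm x \<le> r)"

text \<open>If the integral were zero, the continuous nonnegative \<open>f\<close> would vanish
  almost everywhere; but the set where it is nonzero is open, and a nonempty open set is not
  null.\<close>

lemma test_function_integral_pos:
  fixes f :: "'a::euclidean_space \<Rightarrow> real"
  assumes f: "test_function f" "\<And>x. f x \<ge> 0" "f x0 > 0"
  shows "(\<integral>x. f x \<partial>lborel) > 0"
proof -
  have "(\<integral>x. f x \<partial>lborel) \<noteq> 0"
  proof
    assume "(\<integral>x. f x \<partial>lborel) = 0"
    then have ae: "AE x in lborel. f x = 0"
      using f test_function_integrable[OF f(1)] integral_nonneg_eq_0_iff_AE[of lborel f] by simp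
    have "continuous_on UNIV f"
      by (intro C_infinity_continuous_on test_function_C_infinity f)
    then have op: "open {x. f x \<noteq> 0}"
      using open_Collect_neq[of f "\<lambda>x. 0"] by simp
    then have "{x. f x \<noteq> 0} \<in> null_sets lborel"
      using ae by (subst AE_iff_null_sets) auto
    then have "negligible {x. f x \<noteq> 0}"
      by (simp add: negligible_iff_null_sets null_sets_completionI)
    then have "{x. f x \<noteq> 0} = {}"
      using open_not_negligible op by blast
    then show False using f(3) by auto
  qed
  then show ?thesis using f by (simp add: less_le)
qed

lemma mollifier_exists:
  assumes "r > 0"
  shows "\<exists>K :: 'a::euclidean_space \<Rightarrow> real. mollifier r K"
proof -
  obtain f :: "'a \<Rightarrow> real" where f: "test_function f" "\<And>x. f x \<ge> 0" "f 0 > 0" "\<And>x. f x \<noteq> 0 \<Longrightarrow> norm x \<le> r"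
    using bump_euclidean[OF assms] by blast
  have pos: "(\<integral>x. f x \<partial>lborel) > 0" by (rule test_function_integral_pos[OF f(1-3)])
  let ?c = "1 / (\<integral>x. f x \<partial>lborel)"
  have "test_function (\<lambda>x. f x * ?c)" by (rule test_function_mult[OF f(1)]) auto
  then have "mollifier r (\<lambda>x. f x * ?c)"
    using f pos by (auto simp: mollifier_def)
  then show ?thesis by blast
qed

lemma mollifier_test_function: "mollifier r K \<Longrightarrow> test_function K"
  by (simp add: mollifier_def)

text \<open>Since the mass of \<open>K\<close> is one, the error is the \<open>K\<close>-average of
  f (x - y) - f x. Jensen's inequality and Tonelli's theorem bound its mass by the
  \<open>K\<close>-average of the masses of the translation differences, so the radius can be fixed
  before \<open>K\<close>.\<close>

lemma mollify_Lp:
  fixes f :: "'a::euclidean_space \<Rightarrow> real"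
  assumes p: "p \<ge> 1" and f: "f \<in> Lp_space p" and e: "e > 0"
  shows "\<exists>d>0. \<forall>K. mollifier d K \<longrightarrow> Lp_mass p (\<lambda>x. convolve K f x - f x) \<le> ennreal e"
proof -
  have [measurable]: "f \<in> borel_measurable borel" using f by (simp add: Lp_space_iff)
  obtain d where d: "d > 0" "\<And>h. norm h < d \<Longrightarrow> Lp_mass p (\<lambda>x. f (x - h) - f x) \<le> ennreal e"
    using Lp_mass_translation_continuous[OF assms] by auto
  show ?thesis
  \<comment> \<open>Half the radius turns the weak bound on the support into the strict bound
    required of translations.\<close>
  proof (intro exI[of _ "d/2"] conjI allI impI)
    fix K :: "'a \<Rightarrow> real" assume "mollifier (d/2) K"
    then have K: "test_function K" "\<And>x. K x \<ge> 0" "(\<integral>x. K x \<partial>lborel) = 1" "\<And>x. K x \<noteq> 0 \<Longrightarrow> norm x < d"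
      using d(1) by (fastforce simp: mollifier_def)+
    have [measurable]: "K \<in> borel_measurable borel" using K by (auto intro: test_function_measurable)
    have Ki: "integrable lborel K" by (rule test_function_integrable[OF K(1)])
    have eq: "convolve K f x - f x = (\<integral>y. K y * (f (x - y) - f x) \<partial>lborel)" for x
    proof -
      have "integrable lborel (\<lambda>y. K y * f (x - y))"
        using integrable_lborel_reflect[OF convolve_integrable[OF K(1) Lp_imp_locally_integrable[OF p f], of x], of x] by simp
      then have "(\<integral>y. K y * (f (x - y) - f x) \<partial>lborel) = (\<integral>y. K y * f (x - y) \<partial>lborel) - f x"
        using Ki K(3) by (simp add: right_diff_distrib)
      then show ?thesis by (simp add: convolve_alt)
    qed
    have "Lp_mass p (\<lambda>x. convolve K f x - f x) \<le>
       (\<integral>\<^sup>+x. \<integral>\<^sup>+y. ennreal (\<bar>K y\<bar> * \<bar>f (x - y) - f x\<bar> powr p) \<partial>lborel \<partial>lborel)"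
      unfolding Lp_mass_def eq
      using powr_integral_le[OF p Ki, of "\<lambda>y. f (_ - y) - f _"] K by (intro nn_integral_mono) simp
    also have "\<dots> = (\<integral>\<^sup>+y. \<integral>\<^sup>+x. ennreal (K y) * ennreal (\<bar>f (x - y) - f x\<bar> powr p) \<partial>lborel \<partial>lborel)"
      using K(2) by (subst lborel_pair.Fubini') (auto simp: ennreal_mult)
    also have "\<dots> = (\<integral>\<^sup>+y. ennreal (K y) * Lp_mass p (\<lambda>x. f (x - y) - f x) \<partial>lborel)"
      unfolding Lp_mass_def by (intro nn_integral_cong nn_integral_cmult) auto
    also have "\<dots> \<le> (\<integral>\<^sup>+y. ennreal (K y) * ennreal e \<partial>lborel)"
    proof (intro nn_integral_mono)
      fix y show "ennreal (K y) * Lp_mass p (\<lambda>x. f (x - y) - f x) \<le> ennreal (K y) * ennreal e"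
        using d(2)[of y] K(4)[of y] by (cases "K y = 0") (auto intro!: mult_left_mono)
    qed
    also have "\<dots> = ennreal e"
      using nn_integral_eq_integral[OF Ki] K by (simp add: nn_integral_multc)
    finally show "Lp_mass p (\<lambda>x. convolve K f x - f x) \<le> ennreal e" .
  qed (use d in auto)
qed

section \<open>Multi-indices\<close>

text \<open>Supplies the list on whose existence the choice operator in \<open>multi_deriv\<close>
  relies.\<close>

lemma exists_list_count:
  "finite B \<Longrightarrow> \<exists>is. \<forall>i. count_list is i = (if i \<in> B then \<alpha> i else (0::nat))"
proof (induction B rule: finite_induct)
  case empty
  then show ?case by (intro exI[of _ "[]"]) auto
next
  case (insert b B)
  then obtain js where js: "\<And>i. count_list js i = (if i \<in> B then \<alpha> i else 0)" by blast
  have "count_list (replicate n b) i = (if i = b then n else 0)" for n i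
    by (induction n) auto
  then show ?case
    using insert js by (intro exI[of _ "replicate (\<alpha> b) b @ js"]) auto
qed

text \<open>One list serves all functions, since the choice depends on \<open>\<alpha>\<close>
  alone. Derivatives of a test function and of a kernel are therefore taken in the same
  order.\<close>

lemma multi_deriv_iter:
  fixes \<alpha> :: "'a::euclidean_space \<Rightarrow> nat"
  assumes "\<And>i. i \<notin> Basis \<Longrightarrow> \<alpha> i = 0"
  shows "\<exists>is\<in>lists Basis. length is = (\<Sum>i\<in>Basis. \<alpha> i) \<and> (\<forall>i. count_list is i = \<alpha> i) \<and>
    (\<forall>f. multi_deriv \<alpha> f = iter_partial_deriv is f)"
proof -
  define js where "js = (SOME is. \<forall>i. count_list is i = \<alpha> i)"
  obtain js' where "\<And>i. count_list js' i = (if i \<in> Basis then \<alpha> i else 0)"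
    using exists_list_count[of Basis \<alpha>] by auto
  then have "\<exists>is. \<forall>i. count_list is i = \<alpha> i"
    using assms by (intro exI[of _ js']) auto
  then have js: "count_list js i = \<alpha> i" for i
    unfolding js_def by (rule someI2_ex) auto
  have sub: "set js \<subseteq> Basis"
    using js assms by (metis count_list_0_iff subsetI)
  moreover have "length js = (\<Sum>i\<in>Basis. \<alpha> i)"
    using sum_count_set[OF sub] js by simp
  moreover have "multi_deriv \<alpha> f = iter_partial_deriv js f" for f
    by (simp add: multi_deriv_def js_def)
  ultimately show ?thesis
    using js by (intro bexI[of _ js]) auto
qed

definition unit_index :: "'a \<Rightarrow> 'a \<Rightarrow> nat" where
  "unit_index i = (\<lambda>j. if j = i then 1 else 0)"

lemma sum_unit_index: "i \<in> Basis \<Longrightarrow> (\<Sum>j\<in>Basis. unit_index i j) = 1"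
  by (simp add: unit_index_def)

lemma unit_index_notin: "i \<in> Basis \<Longrightarrow> j \<notin> Basis \<Longrightarrow> unit_index i j = 0"
  by (auto simp: unit_index_def)

lemma multi_deriv_unit_index:
  assumes "i \<in> Basis"
  shows "multi_deriv (unit_index i) f = partial_deriv i f"
proof -
  obtain js where js: "length js = (\<Sum>j\<in>Basis. unit_index i j)" "\<And>j. count_list js j = unit_index i j"
    "\<And>f. multi_deriv (unit_index i) f = iter_partial_deriv js f"
    using multi_deriv_iter[of "unit_index i", OF unit_index_notin[OF assms]] by blast
  obtain a where a: "js = [a]"
    using js(1) sum_unit_index[OF assms] by (auto simp: length_Suc_conv)
  have "a = i"
    using js(2)[of i] a by (auto simp: unit_index_def split: if_splits)
  then show ?thesis using js(3) a by simp
qed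

lemma multi_deriv_zero: "multi_deriv (\<lambda>_. 0) f = f"
proof -
  obtain js :: "'a list" where "length js = (\<Sum>j\<in>(Basis::'a set). 0)"
    "\<And>f. multi_deriv (\<lambda>_. 0) f = iter_partial_deriv js f"
    using multi_deriv_iter[of "\<lambda>_::'a. 0"] by blast
  then show ?thesis by simp
qed

lemma unit_index_in_multi_indices: "i \<in> Basis \<Longrightarrow> k \<ge> 1 \<Longrightarrow> unit_index i \<in> multi_indices k"
  using sum_unit_index[of i] by (auto simp: multi_indices_def unit_index_notin)

lemma multi_indices_1: "multi_indices 1 = insert (\<lambda>_. 0) (unit_index ` (Basis :: 'a::euclidean_space set))"
proof (intro equalityI subsetI)
  fix \<alpha> :: "'a \<Rightarrow> nat" assume \<alpha>: "\<alpha> \<in> multi_indices 1"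
  show "\<alpha> \<in> insert (\<lambda>_. 0) (unit_index ` Basis)"
  proof (cases "\<exists>i\<in>Basis. \<alpha> i \<noteq> 0")
    case False
    then have "\<alpha> = (\<lambda>_. 0)" using \<alpha> by (auto simp: multi_indices_def fun_eq_iff)
    then show ?thesis by simp
  next
    case True
    then obtain i where i: "i \<in> Basis" "\<alpha> i \<noteq> 0" by auto
    have "\<alpha> i + (\<Sum>j\<in>Basis - {i}. \<alpha> j) \<le> 1"
      using \<alpha> i by (simp add: multi_indices_def sum.remove)
    then have one: "\<alpha> i = 1" "(\<Sum>j\<in>Basis - {i}. \<alpha> j) = 0" using i by linarith+
    then have "\<alpha> j = 0" if "j \<in> Basis" "j \<noteq> i" for j
      using that by simp
    moreover have "\<alpha> j = 0" if "j \<notin> Basis" for j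
      using \<alpha> that by (simp add: multi_indices_def)
    ultimately have "\<alpha> = unit_index i"
      using one by (auto simp: unit_index_def fun_eq_iff)
    then show ?thesis using i by auto
  qed
qed (auto simp: unit_index_in_multi_indices, simp add: multi_indices_def)

lemma finite_multi_indices: "finite (multi_indices k :: ('a::euclidean_space \<Rightarrow> nat) set)"
proof (rule finite_subset)
  show "multi_indices k \<subseteq> {f. \<forall>x. (x \<in> (Basis::'a set) \<longrightarrow> f x \<in> {..k}) \<and> (x \<notin> Basis \<longrightarrow> f x = 0)}"
  proof (clarsimp simp: multi_indices_def)
    fix \<alpha> :: "'a \<Rightarrow> nat" and i :: 'a
    assume "sum \<alpha> Basis \<le> k" "i \<in> Basis"
    then show "\<alpha> i \<le> k" using member_le_sum[of i Basis \<alpha>] by simp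
  qed
  show "finite {f. \<forall>x. (x \<in> (Basis::'a set) \<longrightarrow> f x \<in> {..k}) \<and> (x \<notin> Basis \<longrightarrow> f x = (0::nat))}"
    by (rule finite_set_of_finite_funs) auto
qed

lemma multi_indices_notin: "\<alpha> \<in> multi_indices k \<Longrightarrow> i \<notin> Basis \<Longrightarrow> \<alpha> i = 0"
  by (simp add: multi_indices_def)

lemma test_function_multi_deriv:
  assumes "\<alpha> \<in> multi_indices k" "test_function \<phi>"
  shows "test_function (multi_deriv \<alpha> \<phi>)"
proof -
  obtain "is" where "is \<in> lists Basis" "multi_deriv \<alpha> \<phi> = iter_partial_deriv is \<phi>"
    using multi_deriv_iter[of \<alpha>, OF multi_indices_notin[OF assms(1)]] by blast
  then show ?thesis using test_function_iter_partial_deriv[OF assms(2)] by metis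
qed

section \<open>Weak derivatives\<close>

lemma has_weak_derivD:
  assumes "has_weak_deriv \<alpha> u v"
  shows "locally_integrable u" "locally_integrable v"
    "test_function \<phi> \<Longrightarrow> (\<integral>x. u x * multi_deriv \<alpha> \<phi> x \<partial>lborel) =
        (-1) ^ (\<Sum>i\<in>Basis. \<alpha> i) * (\<integral>x. v x * \<phi> x \<partial>lborel)"
  using assms by (auto simp: has_weak_deriv_def)

lemma has_weak_deriv_zero: "locally_integrable u \<Longrightarrow> has_weak_deriv (\<lambda>_. 0) u u"
  by (simp add: has_weak_deriv_def multi_deriv_zero)

lemma mult_test_function_integrable:
  "locally_integrable f \<Longrightarrow> test_function g \<Longrightarrow> integrable lborel (\<lambda>x. f x * g x)"
  using test_function_mult_integrable[of g f] by (simp add: mult.commute)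

lemma has_weak_deriv_add:
  assumes \<alpha>: "\<alpha> \<in> multi_indices k" and u: "has_weak_deriv \<alpha> u v" and u': "has_weak_deriv \<alpha> u' v'"
  shows "has_weak_deriv \<alpha> (\<lambda>x. u x + u' x) (\<lambda>x. v x + v' x)"
  unfolding has_weak_deriv_def
proof (intro conjI allI impI locally_integrable_add)
  fix \<phi> :: "'a \<Rightarrow> real" assume \<phi>: "test_function \<phi>"
  note int = mult_test_function_integrable[OF has_weak_derivD(1)[OF u] test_function_multi_deriv[OF \<alpha> \<phi>]]
    mult_test_function_integrable[OF has_weak_derivD(1)[OF u'] test_function_multi_deriv[OF \<alpha> \<phi>]]
    mult_test_function_integrable[OF has_weak_derivD(2)[OF u] \<phi>]
    mult_test_function_integrable[OF has_weak_derivD(2)[OF u'] \<phi>]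
  show "(\<integral>x. (u x + u' x) * multi_deriv \<alpha> \<phi> x \<partial>lborel) =
        (-1) ^ (\<Sum>i\<in>Basis. \<alpha> i) * (\<integral>x. (v x + v' x) * \<phi> x \<partial>lborel)"
    using int has_weak_derivD(3)[OF u \<phi>] has_weak_derivD(3)[OF u' \<phi>]
    by (simp add: distrib_right distrib_left)
qed (use has_weak_derivD u u' in auto)

lemma has_weak_deriv_uminus:
  assumes "has_weak_deriv \<alpha> u v"
  shows "has_weak_deriv \<alpha> (\<lambda>x. - u x) (\<lambda>x. - v x)"
proof -
  have "locally_integrable (\<lambda>x. - f x)" if "locally_integrable f" for f :: "'a \<Rightarrow> real"
    using locally_integrable_mult_C_infinity[OF that C_infinity_const[of "-1"]] by simp
  then show ?thesis using assms by (auto simp: has_weak_deriv_def)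
qed

lemma has_weak_deriv_diff:
  assumes "\<alpha> \<in> multi_indices k" "has_weak_deriv \<alpha> u v" "has_weak_deriv \<alpha> u' v'"
  shows "has_weak_deriv \<alpha> (\<lambda>x. u x - u' x) (\<lambda>x. v x - v' x)"
  using has_weak_deriv_add[OF assms(1,2) has_weak_deriv_uminus[OF assms(3)]] by simp

lemma locally_integrable_cong_AE:
  assumes "locally_integrable f" "AE x in lborel. f x = g x" and [measurable]: "g \<in> borel_measurable borel"
  shows "locally_integrable g"
  unfolding locally_integrable_def set_integrable_def
proof (intro allI impI)
  fix K :: "'a set" assume K: "compact K"
  have [measurable]: "f \<in> borel_measurable borel" "K \<in> sets borel"
    using assms K by (auto simp: borel_compact intro: locally_integrable_measurable)
  have "integrable lborel (\<lambda>x. indicator K x *\<^sub>R f x)"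
    using assms(1) K by (auto simp: locally_integrable_def set_integrable_def)
  then show "integrable lborel (\<lambda>x. indicator K x *\<^sub>R g x)"
    by (rule integrable_cong_AE_imp) (use assms(2) in auto)
qed

text \<open>Traces are determined only almost everywhere; this transfers weak derivatives computed
  for an explicit formula to the chosen representative.\<close>

lemma has_weak_deriv_cong_AE:
  assumes \<alpha>: "\<alpha> \<in> multi_indices k" and w: "has_weak_deriv \<alpha> u v" and ae: "AE x in lborel. u x = u' x"
    and [measurable]: "u' \<in> borel_measurable borel"
  shows "has_weak_deriv \<alpha> u' v"
  unfolding has_weak_deriv_def
proof (intro conjI allI impI)
  have [measurable]: "u \<in> borel_measurable borel"
    by (rule locally_integrable_measurable[OF has_weak_derivD(1)[OF w]])
  show "locally_integrable u'"
    by (rule locally_integrable_cong_AE[OF has_weak_derivD(1)[OF w] ae]) measurable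
  show "locally_integrable v" by (rule has_weak_derivD[OF w])
  fix \<phi> :: "'a \<Rightarrow> real" assume \<phi>: "test_function \<phi>"
  have [measurable]: "multi_deriv \<alpha> \<phi> \<in> borel_measurable borel"
    by (rule test_function_measurable[OF test_function_multi_deriv[OF \<alpha> \<phi>]])
  have "(\<integral>x. u' x * multi_deriv \<alpha> \<phi> x \<partial>lborel) = (\<integral>x. u x * multi_deriv \<alpha> \<phi> x \<partial>lborel)"
    using ae by (intro integral_cong_AE) auto
  then show "(\<integral>x. u' x * multi_deriv \<alpha> \<phi> x \<partial>lborel) =
        (-1) ^ (\<Sum>i\<in>Basis. \<alpha> i) * (\<integral>x. v x * \<phi> x \<partial>lborel)"
    using has_weak_derivD(3)[OF w \<phi>] by simp
qed

lemma test_function_convolve_reflect: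
  assumes "test_function \<phi>" "test_function K"
  shows "test_function (convolve \<phi> (\<lambda>z. K (0 - z)))"
proof -
  have r: "test_function (\<lambda>z. K (0 - z))" by (rule test_function_reflect[OF assms(2)])
  obtain R where "\<And>x. K (0 - x) \<noteq> 0 \<Longrightarrow> norm x \<le> R"
    using test_function_support[OF r] by blast
  then show ?thesis
    by (intro test_function_convolve C_infinity_locally_integrable test_function_C_infinity r assms(1))
qed

text \<open>The kernel is moved onto the test function, where it commutes with the derivative and
  yields another test function. There the weak derivative of \<open>u\<close> applies, and the
  kernel is moved back.\<close>

lemma has_weak_deriv_convolve:
  assumes \<alpha>: "\<alpha> \<in> multi_indices k" and u: "has_weak_deriv \<alpha> u w" and K: "test_function K"
  shows "has_weak_deriv \<alpha> (convolve K u) (convolve K w)"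
  unfolding has_weak_deriv_def
proof (intro conjI allI impI)
  note lu = has_weak_derivD(1)[OF u] and lw = has_weak_derivD(2)[OF u]
  show "locally_integrable (convolve K u)" "locally_integrable (convolve K w)"
    by (intro C_infinity_locally_integrable convolve_C_infinity K lu lw)+
  fix \<phi> :: "'a \<Rightarrow> real" assume \<phi>: "test_function \<phi>"
  obtain "is" where l: "is \<in> lists Basis" "\<And>f. multi_deriv \<alpha> f = iter_partial_deriv is f"
    using multi_deriv_iter[of \<alpha>, OF multi_indices_notin[OF \<alpha>]] by blast
  let ?\<psi> = "convolve \<phi> (\<lambda>z. K (0 - z))"
  have lr: "locally_integrable (\<lambda>z. K (0 - z))"
    by (intro C_infinity_locally_integrable test_function_C_infinity test_function_reflect K)
  have "(\<integral>x. convolve K u x * multi_deriv \<alpha> \<phi> x \<partial>lborel) =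
      (\<integral>y. u y * convolve (iter_partial_deriv is \<phi>) (\<lambda>z. K (0 - z)) y \<partial>lborel)"
    unfolding l(2) by (rule integral_convolve_mult[OF K lu test_function_iter_partial_deriv[OF \<phi> l(1)]])
  also have "\<dots> = (\<integral>y. u y * multi_deriv \<alpha> ?\<psi> y \<partial>lborel)"
    by (simp only: l(2) iter_partial_deriv_convolve[OF \<phi> lr l(1)])
  also have "\<dots> = (-1) ^ (\<Sum>i\<in>Basis. \<alpha> i) * (\<integral>x. w x * ?\<psi> x \<partial>lborel)"
    by (rule has_weak_derivD(3)[OF u test_function_convolve_reflect[OF \<phi> K]])
  also have "(\<integral>x. w x * ?\<psi> x \<partial>lborel) = (\<integral>x. convolve K w x * \<phi> x \<partial>lborel)"
    by (rule integral_convolve_mult[OF K lw \<phi>, symmetric])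
  finally show "(\<integral>x. convolve K u x * multi_deriv \<alpha> \<phi> x \<partial>lborel) =
        (-1) ^ (\<Sum>i\<in>Basis. \<alpha> i) * (\<integral>x. convolve K w x * \<phi> x \<partial>lborel)" .
qed

text \<open>Commutativity of the convolution moves the derivatives from the test function to the kernel
  one after the other in the same order, so that Schwarz's theorem is not needed.\<close>

lemma has_weak_deriv_convolve_kernel:
  assumes \<alpha>: "\<alpha> \<in> multi_indices k" and f: "locally_integrable f" and K: "test_function K"
  shows "has_weak_deriv \<alpha> (convolve K f) (convolve (multi_deriv \<alpha> K) f)"
  unfolding has_weak_deriv_def
proof (intro conjI allI impI)
  have [measurable]: "K \<in> borel_measurable borel" by (rule test_function_measurable[OF K])
  note DK = test_function_multi_deriv[OF \<alpha> K]
  show "locally_integrable (convolve K f)" "locally_integrable (convolve (multi_deriv \<alpha> K) f)"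
    by (intro C_infinity_locally_integrable convolve_C_infinity K DK f)+
  fix \<phi> :: "'a \<Rightarrow> real" assume \<phi>: "test_function \<phi>"
  have [measurable]: "\<phi> \<in> borel_measurable borel" by (rule test_function_measurable[OF \<phi>])
  obtain "is" where l: "is \<in> lists Basis" "length is = (\<Sum>i\<in>Basis. \<alpha> i)"
    "\<And>f. multi_deriv \<alpha> f = iter_partial_deriv is f"
    using multi_deriv_iter[of \<alpha>, OF multi_indices_notin[OF \<alpha>]] by blast
  let ?r = "\<lambda>K z. K (0 - z) :: real" and ?s = "(-1) ^ (\<Sum>i\<in>Basis. \<alpha> i) :: real"
  have tr: "test_function (?r K)" by (rule test_function_reflect[OF K])
  have lr: "locally_integrable (?r K)" "locally_integrable \<phi>"
    by (intro C_infinity_locally_integrable test_function_C_infinity tr \<phi>)+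
  have "convolve (iter_partial_deriv is \<phi>) (?r K) = iter_partial_deriv is (convolve \<phi> (?r K))"
    by (rule iter_partial_deriv_convolve[OF \<phi> lr(1) l(1), symmetric])
  also have "convolve \<phi> (?r K) = convolve (?r K) \<phi>"
    by (rule convolve_commute) auto
  also have "iter_partial_deriv is (convolve (?r K) \<phi>) = convolve (iter_partial_deriv is (?r K)) \<phi>"
    by (rule iter_partial_deriv_convolve[OF tr lr(2) l(1)])
  also have "\<dots> = (\<lambda>x. ?s * convolve (?r (multi_deriv \<alpha> K)) \<phi> x)"
    unfolding iter_partial_deriv_reflect[OF test_function_C_infinity[OF K] l(1)] l(2) l(3)[symmetric]
    by (rule ext) (simp add: convolve_def mult.assoc)
  also have "convolve (?r (multi_deriv \<alpha> K)) \<phi> = convolve \<phi> (?r (multi_deriv \<alpha> K))"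
    by (rule convolve_commute[OF test_function_measurable[OF test_function_reflect[OF DK]]]) simp
  finally have eq: "convolve (multi_deriv \<alpha> \<phi>) (?r K) = (\<lambda>x. ?s * convolve \<phi> (?r (multi_deriv \<alpha> K)) x)"
    by (simp only: l(3))
  have "(\<integral>x. convolve K f x * multi_deriv \<alpha> \<phi> x \<partial>lborel) =
      (\<integral>y. f y * convolve (multi_deriv \<alpha> \<phi>) (?r K) y \<partial>lborel)"
    by (rule integral_convolve_mult[OF K f test_function_multi_deriv[OF \<alpha> \<phi>]])
  also have "\<dots> = (\<integral>y. ?s * (f y * convolve \<phi> (?r (multi_deriv \<alpha> K)) y) \<partial>lborel)"
    unfolding eq by (simp only: mult.left_commute)
  also have "\<dots> = ?s * (\<integral>y. f y * convolve \<phi> (?r (multi_deriv \<alpha> K)) y \<partial>lborel)"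
    by (rule integral_mult_right_zero)
  also have "(\<integral>y. f y * convolve \<phi> (?r (multi_deriv \<alpha> K)) y \<partial>lborel) = (\<integral>x. convolve (multi_deriv \<alpha> K) f x * \<phi> x \<partial>lborel)"
    by (rule integral_convolve_mult[OF DK f \<phi>, symmetric])
  finally show "(\<integral>x. convolve K f x * multi_deriv \<alpha> \<phi> x \<partial>lborel) =
        ?s * (\<integral>x. convolve (multi_deriv \<alpha> K) f x * \<phi> x \<partial>lborel)" .
qed

text \<open>The convolution of \<open>\<phi>\<close> with the constant \<open>1\<close> is constant, so its derivative vanishes.\<close>

lemma integral_partial_deriv_test_function:
  assumes \<phi>: "test_function \<phi>" and i: "i \<in> Basis"
  shows "(\<integral>x. partial_deriv i \<phi> x \<partial>lborel) = 0"
proof -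
  have m: "\<phi> \<in> borel_measurable borel" "partial_deriv i \<phi> \<in> borel_measurable borel"
    by (intro test_function_measurable test_function_partial_deriv \<phi> i)+
  have "convolve \<phi> (\<lambda>x. 1) = (\<lambda>x. \<integral>y. \<phi> y \<partial>lborel)"
    using integral_lborel_reflect[OF m(1)] by (simp add: convolve_def fun_eq_iff)
  then have "convolve (partial_deriv i \<phi>) (\<lambda>x. 1) 0 = 0"
    by (subst partial_deriv_convolve[OF \<phi> C_infinity_locally_integrable[OF C_infinity_const[of 1]] i, symmetric]) simp
  then show ?thesis
    using integral_lborel_reflect[OF m(2), of 0] by (simp add: convolve_def)
qed

text \<open>Test the weak derivative of \<open>u\<close> against \<open>c\<close> times
  \<open>\<phi>\<close> and solve the product rule for the term with the derivative of
  \<open>\<phi>\<close>. The first-order case serves the cutoff argument in W^(1,p).\<close>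

lemma has_weak_deriv_mult_C_infinity:
  assumes i: "i \<in> Basis" and u: "has_weak_deriv (unit_index i) u w" and c: "c \<in> C_infinity"
  shows "has_weak_deriv (unit_index i) (\<lambda>x. c x * u x) (\<lambda>x. c x * w x + partial_deriv i c x * u x)"
  unfolding has_weak_deriv_def
proof (intro conjI allI impI)
  note lu = has_weak_derivD(1)[OF u] and lw = has_weak_derivD(2)[OF u]
  show "locally_integrable (\<lambda>x. c x * u x)" "locally_integrable (\<lambda>x. c x * w x + partial_deriv i c x * u x)"
    by (intro locally_integrable_add locally_integrable_mult_C_infinity lu lw c C_infinity_partial_deriv i)+
  fix \<phi> :: "'a \<Rightarrow> real" assume \<phi>: "test_function \<phi>"
  have c\<phi>: "test_function (\<lambda>x. c x * \<phi> x)"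
    using test_function_mult[OF \<phi> c] by (simp add: mult.commute)
  have d\<phi>: "test_function (\<lambda>x. \<phi> x * partial_deriv i c x)"
    by (rule test_function_mult[OF \<phi> C_infinity_partial_deriv[OF c i]])
  have D: "partial_deriv i (\<lambda>x. c x * \<phi> x) = (\<lambda>x. partial_deriv i c x * \<phi> x + c x * partial_deriv i \<phi> x)"
    by (rule partial_deriv_mult[OF c test_function_C_infinity[OF \<phi>] i])
  have "(\<integral>x. u x * partial_deriv i (\<lambda>x. c x * \<phi> x) x \<partial>lborel) = - (\<integral>x. w x * (c x * \<phi> x) \<partial>lborel)"
    using has_weak_derivD(3)[OF u c\<phi>] by (simp add: sum_unit_index[OF i] multi_deriv_unit_index[OF i])
  moreover have "integrable lborel (\<lambda>x. u x * partial_deriv i (\<lambda>x. c x * \<phi> x) x)"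
    by (intro mult_test_function_integrable lu test_function_partial_deriv c\<phi> i)
  moreover have int2: "integrable lborel (\<lambda>x. u x * (\<phi> x * partial_deriv i c x))"
    by (rule mult_test_function_integrable[OF lu d\<phi>])
  ultimately have "(\<integral>x. u x * partial_deriv i (\<lambda>x. c x * \<phi> x) x - u x * (\<phi> x * partial_deriv i c x) \<partial>lborel) =
    - (\<integral>x. w x * (c x * \<phi> x) \<partial>lborel) - (\<integral>x. u x * (\<phi> x * partial_deriv i c x) \<partial>lborel)"
    by simp
  moreover have "integrable lborel (\<lambda>x. w x * (c x * \<phi> x))"
    by (rule mult_test_function_integrable[OF lw c\<phi>])
  with int2 have "(\<integral>x. w x * (c x * \<phi> x) + u x * (\<phi> x * partial_deriv i c x) \<partial>lborel) =
    (\<integral>x. w x * (c x * \<phi> x) \<partial>lborel) + (\<integral>x. u x * (\<phi> x * partial_deriv i c x) \<partial>lborel)"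
    by simp
  moreover have "u x * partial_deriv i (\<lambda>x. c x * \<phi> x) x - u x * (\<phi> x * partial_deriv i c x) = c x * u x * partial_deriv i \<phi> x"
    and "w x * (c x * \<phi> x) + u x * (\<phi> x * partial_deriv i c x) = (c x * w x + partial_deriv i c x * u x) * \<phi> x" for x
    unfolding D by (simp_all add: algebra_simps)
  ultimately show "(\<integral>x. c x * u x * multi_deriv (unit_index i) \<phi> x \<partial>lborel) =
        (-1) ^ (\<Sum>j\<in>Basis. unit_index i j) * (\<integral>x. (c x * w x + partial_deriv i c x * u x) * \<phi> x \<partial>lborel)"
    by (simp add: sum_unit_index[OF i] multi_deriv_unit_index[OF i])
qed

text \<open>The constant 1 has weak derivative 0, since derivatives of test functions have integral
  zero; the product rule with \<open>u = 1\<close> then yields the classical derivative of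
  \<open>c\<close>.\<close>

lemma has_weak_deriv_C_infinity:
  assumes i: "i \<in> Basis" and c: "c \<in> C_infinity"
  shows "has_weak_deriv (unit_index i) c (partial_deriv i c)"
proof -
  have l1: "locally_integrable (\<lambda>x. 1)" "locally_integrable (\<lambda>x. 0)"
    by (intro C_infinity_locally_integrable C_infinity_const)+
  have "has_weak_deriv (unit_index i) (\<lambda>x. 1) (\<lambda>x. 0)"
    unfolding has_weak_deriv_def
    using l1 integral_partial_deriv_test_function[OF _ i] by (simp add: multi_deriv_unit_index[OF i])
  from has_weak_deriv_mult_C_infinity[OF i this c] show ?thesis by simp
qed

section \<open>Uniqueness of weak derivatives\<close>

lemma mollifier_mono: "mollifier r K \<Longrightarrow> r \<le> r' \<Longrightarrow> mollifier r' K"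
  unfolding mollifier_def by (meson order_trans)

lemma mollifier_support: "mollifier r K \<Longrightarrow> K x \<noteq> 0 \<Longrightarrow> norm x \<le> r"
  by (simp add: mollifier_def)

text \<open>The fundamental lemma of the calculus of variations. For x in a ball and a kernel of
  radius at most 1, the convolution at x is the integral of \<open>f\<close> against a reflected
  kernel, which is a test function, hence zero; yet it is L^1-close to \<open>f\<close> on the
  ball.\<close>

lemma AE_zero_if_orthogonal_test_functions:
  fixes f :: "'a::euclidean_space \<Rightarrow> real"
  assumes f: "locally_integrable f" and orth: "\<And>\<phi>. test_function \<phi> \<Longrightarrow> (\<integral>x. f x * \<phi> x \<partial>lborel) = 0"
  shows "AE x in lborel. f x = 0"
proof -
  have [measurable]: "f \<in> borel_measurable borel" by (rule locally_integrable_measurable[OF f])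
  have "AE x in lborel. indicator (cball 0 (real N)) x * f x = 0" for N
  proof -
    \<comment> \<open>The margin 1 makes the truncation invisible, inside the smaller ball, to
      kernels of radius at most 1.\<close>
    define B where "B = cball (0::'a) (real N + 1)"
    have [measurable]: "B \<in> sets borel" "cball 0 (real N) \<in> sets (borel :: 'a measure)"
      by (simp_all add: B_def)
    define f1 where "f1 x = indicator B x * f x" for x
    have [measurable]: "f1 \<in> borel_measurable borel" unfolding f1_def by measurable
    have "integrable lborel (\<lambda>x. indicator B x *\<^sub>R f x)"
      using f by (auto simp: locally_integrable_def set_integrable_def B_def)
    then have "integrable lborel f1" by (simp add: f1_def[abs_def])
    then have f1: "f1 \<in> Lp_space 1"
      by (simp add: Lp_space_def)
    have "Lp_mass 1 (\<lambda>x. indicator (cball 0 (real N)) x * f x) \<le> ennreal e" if e: "e > 0" for e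
    proof -
      obtain d where d: "d > 0" "\<And>K. mollifier d K \<Longrightarrow> Lp_mass 1 (\<lambda>x. convolve K f1 x - f1 x) \<le> ennreal e"
        using mollify_Lp[OF order_refl f1 e] by blast
      obtain K :: "'a \<Rightarrow> real" where K: "mollifier (min d 1) K"
        using mollifier_exists[of "min d 1"] d(1) by auto
      note tK = mollifier_test_function[OF K]
      have zero: "convolve K f1 x = 0" if "x \<in> cball 0 (real N)" for x
      proof -
        have "convolve K f1 x = (\<integral>y. f y * K (x - y) \<partial>lborel)"
          unfolding convolve_def
        proof (intro Bochner_Integration.integral_cong refl)
          fix y
          have "y \<in> B" if "K (x - y) \<noteq> 0"
          proof -
            have "norm (x - y) \<le> 1" using mollifier_support[OF K that] by simp
            then show ?thesis
              using norm_triangle_sub[of y x] \<open>x \<in> _\<close> by (simp add: B_def norm_minus_commute)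
          qed
          then show "K (x - y) * f1 y = f y * K (x - y)"
            by (cases "K (x - y) = 0") (simp_all add: f1_def)
        qed
        also have "\<dots> = 0" by (rule orth[OF test_function_reflect[OF tK]])
        finally show ?thesis .
      qed
      have "Lp_mass 1 (\<lambda>x. indicator (cball 0 (real N)) x * f x) \<le> Lp_mass 1 (\<lambda>x. convolve K f1 x - f1 x)"
      proof (rule Lp_mass_mono)
        fix x show "\<bar>indicator (cball 0 (real N)) x * f x\<bar> \<le> \<bar>convolve K f1 x - f1 x\<bar>"
          using zero[of x] by (cases "x \<in> cball 0 (real N)") (simp_all add: f1_def B_def)
      qed simp
      also have "\<dots> \<le> ennreal e" by (rule d(2)[OF mollifier_mono[OF K]]) simp
      finally show ?thesis .
    qed
    then have "Lp_mass 1 (\<lambda>x. indicator (cball 0 (real N)) x * f x) \<le> 0"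
      by - (rule ennreal_le_epsilon, simp)
    then have "Lp_mass 1 (\<lambda>x. indicator (cball 0 (real N)) x * f x) = 0" by simp
    then show ?thesis
      by (rule iffD1[OF Lp_mass_eq_0_iff, rotated]) measurable
  qed
  then have "AE x in lborel. \<forall>N. indicator (cball 0 (real N)) x * f x = 0"
    unfolding AE_all_countable by (rule allI)
  then show ?thesis
  proof eventually_elim
    case (elim x)
    obtain N where "norm x \<le> real N" using real_arch_simple by blast
    then show ?case using elim[rule_format, of N] by (auto simp: indicator_def)
  qed
qed

text \<open>Makes the choice in \<open>weak_deriv\<close> harmless: all weak derivatives have the
  same L^p mass, so the Sobolev norm can be computed from any of them.\<close>

lemma has_weak_deriv_unique:
  assumes v: "has_weak_deriv \<alpha> u v" and v': "has_weak_deriv \<alpha> u v'"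
  shows "AE x in lborel. v x = v' x"
proof -
  have "AE x in lborel. v x - v' x = 0"
  proof (rule AE_zero_if_orthogonal_test_functions)
    show "locally_integrable (\<lambda>x. v x - v' x)"
      by (intro locally_integrable_diff has_weak_derivD(2)[OF v] has_weak_derivD(2)[OF v'])
    fix \<phi> :: "'a \<Rightarrow> real" assume \<phi>: "test_function \<phi>"
    have "(-1) ^ (\<Sum>i\<in>Basis. \<alpha> i) * (\<integral>x. v x * \<phi> x \<partial>lborel) = (-1) ^ (\<Sum>i\<in>Basis. \<alpha> i) * (\<integral>x. v' x * \<phi> x \<partial>lborel)"
      using has_weak_derivD(3)[OF v \<phi>] has_weak_derivD(3)[OF v' \<phi>] by simp
    then have "(\<integral>x. v x * \<phi> x \<partial>lborel) = (\<integral>x. v' x * \<phi> x \<partial>lborel)" by simp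
    then show "(\<integral>x. (v x - v' x) * \<phi> x \<partial>lborel) = 0"
      using mult_test_function_integrable[OF has_weak_derivD(2)[OF v] \<phi>]
        mult_test_function_integrable[OF has_weak_derivD(2)[OF v'] \<phi>]
      by (simp add: left_diff_distrib)
  qed
  then show ?thesis by simp
qed

section \<open>Convergence in Lebesgue and Sobolev spaces\<close>

lemma Lp_norm_weak_deriv:
  assumes p: "p \<ge> 1" and w: "has_weak_deriv \<alpha> u w"
  shows "Lp_norm p (weak_deriv \<alpha> u) powr p = enn2real (Lp_mass p w)"
proof -
  have W: "has_weak_deriv \<alpha> u (weak_deriv \<alpha> u)"
    unfolding weak_deriv_def by (rule someI[of "has_weak_deriv \<alpha> u", OF w])
  have "Lp_norm p (weak_deriv \<alpha> u) powr p = enn2real (Lp_mass p (weak_deriv \<alpha> u))"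
    using p by (simp add: Lp_norm_eq[OF locally_integrable_measurable[OF has_weak_derivD(2)[OF W]]] powr_powr)
  also have "Lp_mass p (weak_deriv \<alpha> u) = Lp_mass p w"
    by (rule Lp_mass_cong_AE[OF has_weak_deriv_unique[OF W w]])
  finally show ?thesis .
qed

lemma tendsto_0_powr_iff:
  fixes x :: "'b \<Rightarrow> real"
  assumes "\<And>n. x n \<ge> 0" "q > 0"
  shows "((\<lambda>n. x n powr q) \<longlongrightarrow> 0) F \<longleftrightarrow> (x \<longlongrightarrow> 0) F"
proof
  assume "((\<lambda>n. x n powr q) \<longlongrightarrow> 0) F"
  then have "((\<lambda>n. (x n powr q) powr (1 / q)) \<longlongrightarrow> 0) F"
    by (rule tendsto_zero_powrI[where b="1/q"]) (use assms in auto)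
  then show "(x \<longlongrightarrow> 0) F" using assms by (simp add: powr_powr)
next
  assume "(x \<longlongrightarrow> 0) F"
  then show "((\<lambda>n. x n powr q) \<longlongrightarrow> 0) F"
    by (rule tendsto_zero_powrI[where b=q]) (use assms in auto)
qed

lemma enn2real_tendsto_0: "(f \<longlongrightarrow> (0::ennreal)) F \<Longrightarrow> ((\<lambda>n. enn2real (f n)) \<longlongrightarrow> 0) F"
  using tendsto_enn2real[of f 0 F] by simp

text \<open>Finiteness is essential, because \<open>enn2real\<close> maps infinity to 0.\<close>

lemma tendsto_0_enn2real:
  assumes "((\<lambda>n. enn2real (f n)) \<longlongrightarrow> 0) F" "\<And>n. f n < \<infinity>"
  shows "(f \<longlongrightarrow> (0::ennreal)) F"
  using tendsto_ennrealI[OF assms(1)] assms(2) by simp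

lemma Lp_norm_tendsto_0_iff:
  assumes p: "p \<ge> 1" and f: "\<And>n. f n \<in> Lp_space p"
  shows "((\<lambda>n. Lp_norm p (f n)) \<longlongrightarrow> 0) F \<longleftrightarrow> ((\<lambda>n. Lp_mass p (f n)) \<longlongrightarrow> 0) F"
proof -
  have "((\<lambda>n. Lp_norm p (f n)) \<longlongrightarrow> 0) F \<longleftrightarrow> ((\<lambda>n. enn2real (Lp_mass p (f n))) \<longlongrightarrow> 0) F"
    using f p by (simp add: Lp_norm_eq Lp_space_measurable tendsto_0_powr_iff)
  also have "\<dots> \<longleftrightarrow> ((\<lambda>n. Lp_mass p (f n)) \<longlongrightarrow> 0) F"
    using enn2real_tendsto_0[of "\<lambda>n. Lp_mass p (f n)" F] tendsto_0_enn2real[of "\<lambda>n. Lp_mass p (f n)" F] f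
    unfolding Lp_space_iff by blast
  finally show ?thesis .
qed

lemma sobolev_norm_tendsto_0I:
  fixes u :: "'b \<Rightarrow> 'a::euclidean_space \<Rightarrow> real"
  assumes p: "p \<ge> 1" and w: "\<And>n \<alpha>. \<alpha> \<in> multi_indices k \<Longrightarrow> has_weak_deriv \<alpha> (u n) (w n \<alpha>)"
    and lim: "\<And>\<alpha>. \<alpha> \<in> multi_indices k \<Longrightarrow> ((\<lambda>n. Lp_mass p (w n \<alpha>)) \<longlongrightarrow> 0) F"
  shows "((\<lambda>n. sobolev_norm k p (u n)) \<longlongrightarrow> 0) F"
proof -
  have "sobolev_norm k p (u n) = (\<Sum>\<alpha>\<in>multi_indices k. enn2real (Lp_mass p (w n \<alpha>))) powr (1 / p)" for n
    unfolding sobolev_norm_def using Lp_norm_weak_deriv[OF p w] by simp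
  moreover have "((\<lambda>n. \<Sum>\<alpha>\<in>multi_indices k. enn2real (Lp_mass p (w n \<alpha>))) \<longlongrightarrow> (\<Sum>\<alpha>\<in>(multi_indices k :: ('a \<Rightarrow> nat) set). 0)) F"
    using lim by (intro tendsto_sum enn2real_tendsto_0) auto
  ultimately show ?thesis
    using p by (simp add: tendsto_0_powr_iff sum_nonneg)
qed

text \<open>One summand of the norm is extracted. Membership in L^p excludes infinite masses, which
  the real-valued norm would record as 0.\<close>

lemma sobolev_norm_tendsto_0D:
  assumes p: "p \<ge> 1" and \<alpha>: "\<alpha> \<in> multi_indices k" and w: "\<And>n. has_weak_deriv \<alpha> (u n) (w n)"
    and Lp: "\<And>n. w n \<in> Lp_space p" and lim: "((\<lambda>n. sobolev_norm k p (u n)) \<longlongrightarrow> 0) F"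
  shows "((\<lambda>n. Lp_mass p (w n)) \<longlongrightarrow> 0) F"
proof (rule tendsto_0_enn2real)
  have S: "((\<lambda>n. \<Sum>\<alpha>\<in>multi_indices k. Lp_norm p (weak_deriv \<alpha> (u n)) powr p) \<longlongrightarrow> 0) F"
    using lim p unfolding sobolev_norm_def by (subst (asm) tendsto_0_powr_iff) (auto intro: sum_nonneg)
  show "((\<lambda>n. enn2real (Lp_mass p (w n))) \<longlongrightarrow> 0) F"
  proof (rule tendsto_sandwich[OF _ _ tendsto_const S])
    show "\<forall>\<^sub>F n in F. enn2real (Lp_mass p (w n)) \<le> (\<Sum>\<alpha>\<in>multi_indices k. Lp_norm p (weak_deriv \<alpha> (u n)) powr p)"
    proof (intro always_eventually allI)
      fix n
      have "Lp_norm p (weak_deriv \<alpha> (u n)) powr p \<le> (\<Sum>\<alpha>\<in>multi_indices k. Lp_norm p (weak_deriv \<alpha> (u n)) powr p)"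
        by (intro member_le_sum \<alpha> finite_multi_indices) auto
      then show "enn2real (Lp_mass p (w n)) \<le> (\<Sum>\<alpha>\<in>multi_indices k. Lp_norm p (weak_deriv \<alpha> (u n)) powr p)"
        by (simp add: Lp_norm_weak_deriv[OF p w])
    qed
  qed auto
  show "Lp_mass p (w n) < \<infinity>" for n using Lp[of n] by (simp add: Lp_space_iff)
qed

lemma Lp_mass_add_tendsto_0:
  assumes p: "p \<ge> 1" and "\<And>n. f n \<in> borel_measurable borel" "\<And>n. g n \<in> borel_measurable borel"
    and "((\<lambda>n. Lp_mass p (f n)) \<longlongrightarrow> 0) F" "((\<lambda>n. Lp_mass p (g n)) \<longlongrightarrow> 0) F"
  shows "((\<lambda>n. Lp_mass p (\<lambda>x. f n x + g n x)) \<longlongrightarrow> 0) F"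
proof (rule tendsto_sandwich[OF _ _ tendsto_const])
  show "\<forall>\<^sub>F n in F. Lp_mass p (\<lambda>x. f n x + g n x) \<le> ennreal (2 powr p) * (Lp_mass p (f n) + Lp_mass p (g n))"
    using assms by (intro always_eventually allI Lp_mass_add_le) auto
  have "((\<lambda>n. ennreal (2 powr p) * (Lp_mass p (f n) + Lp_mass p (g n))) \<longlongrightarrow> ennreal (2 powr p) * (0 + 0)) F"
    using assms by (intro ennreal_tendsto_cmult tendsto_add) auto
  then show "((\<lambda>n. ennreal (2 powr p) * (Lp_mass p (f n) + Lp_mass p (g n))) \<longlongrightarrow> 0) F" by simp
qed auto

text \<open>The minimum of finitely many radii lets a single kernel handle all weak derivatives at
  once.\<close>

lemma mollify_Lp_finite:
  fixes f :: "'b \<Rightarrow> 'a::euclidean_space \<Rightarrow> real"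
  assumes p: "p \<ge> 1" and "finite J" and f: "\<And>j. j \<in> J \<Longrightarrow> f j \<in> Lp_space p" and e: "e > 0"
  shows "\<exists>d>0. \<forall>K. mollifier d K \<longrightarrow> (\<forall>j\<in>J. Lp_mass p (\<lambda>x. convolve K (f j) x - f j x) \<le> ennreal e)"
  using \<open>finite J\<close> f
proof (induction J rule: finite_induct)
  case empty
  then show ?case by (intro exI[of _ 1]) auto
next
  case (insert j J)
  obtain d1 where d1: "d1 > 0" "\<And>K. mollifier d1 K \<Longrightarrow> \<forall>j\<in>J. Lp_mass p (\<lambda>x. convolve K (f j) x - f j x) \<le> ennreal e"
    using insert by auto
  obtain d2 where d2: "d2 > 0" "\<And>K. mollifier d2 K \<Longrightarrow> Lp_mass p (\<lambda>x. convolve K (f j) x - f j x) \<le> ennreal e"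
    using mollify_Lp[OF p _ e, of "f j"] insert.prems by auto
  show ?case
  proof (intro exI[of _ "min d1 d2"] conjI allI impI)
    fix K :: "'a \<Rightarrow> real" assume "mollifier (min d1 d2) K"
    then have "mollifier d1 K" "mollifier d2 K" by (auto elim: mollifier_mono)
    then show "\<forall>j\<in>insert j J. Lp_mass p (\<lambda>x. convolve K (f j) x - f j x) \<le> ennreal e"
      using d1(2) d2(2) by auto
  qed (use d1 d2 in auto)
qed

section \<open>Density of test functions\<close>

lemma test_function_Lp:
  assumes "p \<ge> 1" "test_function g"
  shows "g \<in> Lp_space p"
proof -
  have [measurable]: "g \<in> borel_measurable borel" by (rule test_function_measurable[OF assms(2)])
  obtain M R where M: "\<And>x. \<bar>g x\<bar> \<le> M" and R: "\<And>x. g x \<noteq> 0 \<Longrightarrow> norm x \<le> R"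
    using test_function_bound[OF assms(2)] test_function_support[OF assms(2)] by blast
  have "integrable lborel (\<lambda>x. \<bar>g x\<bar> powr p * 1)"
  proof (rule locally_integrable_mult_bounded_support)
    show "locally_integrable (\<lambda>x. 1)" by (intro C_infinity_locally_integrable C_infinity_const)
    show "\<bar>\<bar>g x\<bar> powr p\<bar> \<le> M powr p" for x
      using M[of x] assms(1) by (simp add: powr_mono2)
    show "x \<in> cball 0 R" if "\<bar>g x\<bar> powr p \<noteq> 0" for x
      using R[of x] that by auto
  qed auto
  then show ?thesis by (simp add: Lp_space_def)
qed

lemma Lp_space_mult_bounded:
  assumes p: "p \<ge> 1" and f: "f \<in> Lp_space p" and [measurable]: "c \<in> borel_measurable borel"
    and M: "\<And>x. \<bar>c x\<bar> \<le> M"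
  shows "(\<lambda>x. c x * f x) \<in> Lp_space p"
proof -
  have [measurable]: "f \<in> borel_measurable borel" by (rule Lp_space_measurable[OF f])
  have M0: "M \<ge> 0" using M[of undefined] by linarith
  have "Lp_mass p (\<lambda>x. c x * f x) \<le> Lp_mass p (\<lambda>x. M * f x)"
    using p M M0 by (intro Lp_mass_mono) (auto simp: abs_mult intro!: mult_right_mono)
  also have "\<dots> < \<infinity>"
    using f by (simp add: Lp_mass_cmult Lp_space_iff ennreal_mult_less_top)
  finally show ?thesis by (simp add: Lp_space_iff)
qed

text \<open>Dominated convergence: the dilated cutoff tends pointwise to c 0 = 1, and the difference
  is bounded by (M + 1) |f|.\<close>

lemma cutoff_tendsto:
  fixes f :: "'a::euclidean_space \<Rightarrow> real"
  assumes p: "p \<ge> 1" and f: "f \<in> Lp_space p" and c: "continuous_on UNIV c" "c 0 = 1" "\<And>x. \<bar>c x\<bar> \<le> M"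
  shows "(\<lambda>n. Lp_mass p (\<lambda>x. c (x /\<^sub>R real (Suc n)) * f x - f x)) \<longlonglongrightarrow> 0"
proof -
  have [measurable]: "f \<in> borel_measurable borel" by (rule Lp_space_measurable[OF f])
  have [measurable]: "c \<in> borel_measurable borel" using c(1) by (rule borel_measurable_continuous_onI)
  have M0: "M \<ge> 0" using c(3)[of undefined] by linarith
  have "(\<lambda>n. Lp_mass p (\<lambda>x. c (x /\<^sub>R real (Suc n)) * f x - f x)) \<longlonglongrightarrow> (\<integral>\<^sup>+x. 0 \<partial>(lborel :: 'a measure))"
    unfolding Lp_mass_def
  proof (rule nn_integral_dominated_convergence[where w="\<lambda>x. ennreal (\<bar>(M + 1) * f x\<bar> powr p)"])
    have "Lp_mass p (\<lambda>x. (M + 1) * f x) < \<infinity>"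
      using f by (simp add: Lp_mass_cmult Lp_space_iff ennreal_mult_less_top)
    then show "(\<integral>\<^sup>+x. ennreal (\<bar>(M + 1) * f x\<bar> powr p) \<partial>lborel) < \<infinity>" by (simp add: Lp_mass_def)
    show "AE x in lborel. ennreal (\<bar>c (x /\<^sub>R real (Suc n)) * f x - f x\<bar> powr p) \<le> ennreal (\<bar>(M + 1) * f x\<bar> powr p)" for n
    proof (intro AE_I2 ennreal_leI powr_mono2)
      fix x
      have "\<bar>c (x /\<^sub>R real (Suc n)) - 1\<bar> \<le> \<bar>M + 1\<bar>" using c(3)[of "x /\<^sub>R real (Suc n)"] by linarith
      then have "\<bar>c (x /\<^sub>R real (Suc n)) - 1\<bar> * \<bar>f x\<bar> \<le> \<bar>M + 1\<bar> * \<bar>f x\<bar>" by (rule mult_right_mono) simp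
      then show "\<bar>c (x /\<^sub>R real (Suc n)) * f x - f x\<bar> \<le> \<bar>(M + 1) * f x\<bar>"
        by (simp add: abs_mult[symmetric] left_diff_distrib)
    qed (use p in auto)
    show "AE x in lborel. (\<lambda>n. ennreal (\<bar>c (x /\<^sub>R real (Suc n)) * f x - f x\<bar> powr p)) \<longlonglongrightarrow> 0"
    proof (rule AE_I2)
      fix x :: 'a
      have "(\<lambda>n. inverse (real (Suc n)) *\<^sub>R x) \<longlonglongrightarrow> 0 *\<^sub>R x"
        by (intro tendsto_scaleR LIMSEQ_inverse_real_of_nat tendsto_const)
      then have "(\<lambda>n. c (x /\<^sub>R real (Suc n))) \<longlonglongrightarrow> c 0"
        using continuous_on_tendsto_compose[OF c(1), of "\<lambda>n. x /\<^sub>R real (Suc n)" 0 sequentially] by simp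
      then have "(\<lambda>n. c (x /\<^sub>R real (Suc n)) * f x - f x) \<longlonglongrightarrow> 1 * f x - f x"
        unfolding c(2) by (intro tendsto_intros)
      then have "(\<lambda>n. \<bar>c (x /\<^sub>R real (Suc n)) * f x - f x\<bar>) \<longlonglongrightarrow> 0"
        by (intro tendsto_rabs_zero) simp
      then have "(\<lambda>n. \<bar>c (x /\<^sub>R real (Suc n)) * f x - f x\<bar> powr p) \<longlonglongrightarrow> 0"
        by (subst tendsto_0_powr_iff) (use p in auto)
      then show "(\<lambda>n. ennreal (\<bar>c (x /\<^sub>R real (Suc n)) * f x - f x\<bar> powr p)) \<longlonglongrightarrow> 0"
        using tendsto_ennrealI by fastforce
    qed
  qed auto
  then show ?thesis by simp
qed

lemma tendsto_0_inverse_Suc_ennreal: "(\<lambda>n. ennreal (inverse (real (Suc n)))) \<longlonglongrightarrow> 0"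
  using tendsto_ennrealI[OF LIMSEQ_inverse_real_of_nat] by simp

lemma tendsto_0_le:
  fixes f g :: "'b \<Rightarrow> ennreal"
  assumes "\<And>n. f n \<le> g n" "(g \<longlongrightarrow> 0) F"
  shows "(f \<longlongrightarrow> 0) F"
  by (rule tendsto_sandwich[OF _ _ tendsto_const assms(2)]) (use assms(1) in auto)

text \<open>Cut off at scale n + 1, then mollify. The derivative of the cutoff is of size 1 / (n +
  1), so its term in the product rule disappears. This supplies the approximating sequences demanded
  by \<open>has_trace\<close>.\<close>

lemma test_functions_dense:
  fixes u :: "'a::euclidean_space \<Rightarrow> real"
  assumes p: "p \<ge> 1" and u: "u \<in> sobolev_space 1 p"
  shows "\<exists>\<phi>. (\<forall>n. test_function (\<phi> n)) \<and> (\<lambda>n. sobolev_norm 1 p (\<lambda>x. \<phi> n x - u x)) \<longlonglongrightarrow> 0"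
proof -
  have uLp: "u \<in> Lp_space p" using u by (simp add: sobolev_space_def)
  then have [measurable]: "u \<in> borel_measurable borel" and lu: "locally_integrable u"
    by (auto intro: Lp_space_measurable Lp_imp_locally_integrable p)
  have "\<exists>v \<in> Lp_space p. has_weak_deriv (unit_index i) u v" if "i \<in> Basis" for i
    using u unit_index_in_multi_indices[OF that, of 1] by (simp add: sobolev_space_def)
  then obtain w where w: "\<And>i. i \<in> Basis \<Longrightarrow> w i \<in> Lp_space p" "\<And>i. i \<in> Basis \<Longrightarrow> has_weak_deriv (unit_index i) u (w i)"
    by metis
  note [measurable] = Lp_space_measurable[OF w(1)]
  obtain f :: "'a \<Rightarrow> real" where f: "test_function f" "f 0 > 0"
    using bump_euclidean[of 1] by (metis zero_less_one)
  define c where "c x = f x * (1 / f 0)" for x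
  have c: "test_function c" "c 0 = 1"
    unfolding c_def[abs_def] using f test_function_mult[OF f(1) C_infinity_const[of "1 / f 0"]] by simp_all
  note [measurable] = test_function_measurable[OF c(1)]
  obtain M where M: "\<And>x. \<bar>c x\<bar> \<le> M" using test_function_bound[OF c(1)] by blast
  have cc: "continuous_on UNIV c" by (intro C_infinity_continuous_on test_function_C_infinity c)
  define cn where "cn n x = c (0 + x /\<^sub>R real (Suc n))" for n x
  have lin: "linear (\<lambda>x::'a. x /\<^sub>R r)" for r by (simp add: linear_iff scaleR_add_right)
  have cnC: "cn n \<in> C_infinity" for n
    unfolding cn_def by (rule C_infinity_compose_affine[OF test_function_C_infinity[OF c(1)] lin])
  have [measurable]: "cn n \<in> borel_measurable borel" for n by (rule C_infinity_measurable[OF cnC])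
  have cnM: "\<bar>cn n x\<bar> \<le> M" for n x by (simp add: cn_def M)
  have cn_test: "test_function (cn n)" for n
  proof -
    obtain R where R: "\<And>x. c x \<noteq> 0 \<Longrightarrow> norm x \<le> R" using test_function_support[OF c(1)] by blast
    have "norm x \<le> R * real (Suc n)" if "cn n x \<noteq> 0" for x
      using R[of "x /\<^sub>R real (Suc n)"] that by (simp add: cn_def field_simps)
    then show ?thesis using cnC test_function_iff by blast
  qed
  have dcn: "partial_deriv i (cn n) = (\<lambda>x. inverse (real (Suc n)) * partial_deriv i c (x /\<^sub>R real (Suc n)))"
    if i: "i \<in> Basis" for i n
  proof
    fix x
    have "partial_deriv i (cn n) x = (\<Sum>j\<in>Basis. ((i /\<^sub>R real (Suc n)) \<bullet> j) * partial_deriv j c (0 + x /\<^sub>R real (Suc n)))"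
      unfolding cn_def by (simp only: partial_deriv_compose_affine[OF test_function_C_infinity[OF c(1)] lin])
    also have "\<dots> = inverse (real (Suc n)) * (\<Sum>j\<in>Basis. (i \<bullet> j) * partial_deriv j c (x /\<^sub>R real (Suc n)))"
      by (simp add: sum_distrib_left mult.assoc)
    finally show "partial_deriv i (cn n) x = inverse (real (Suc n)) * partial_deriv i c (x /\<^sub>R real (Suc n))"
      unfolding sum_inner_Basis_mult[OF i] .
  qed
  define un where "un n x = cn n x * u x" for n x
  define wn where "wn i n x = cn n x * w i x + partial_deriv i (cn n) x * u x" for i n x
  have unwn: "has_weak_deriv (unit_index i) (un n) (wn i n)" if "i \<in> Basis" for i n
    unfolding un_def wn_def by (rule has_weak_deriv_mult_C_infinity[OF that w(2)[OF that] cnC])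
  have un_Lp: "un n \<in> Lp_space p" for n
    unfolding un_def by (rule Lp_space_mult_bounded[OF p uLp]) (use cnM in auto)
  have un_lim: "(\<lambda>n. Lp_mass p (\<lambda>x. un n x - u x)) \<longlonglongrightarrow> 0"
    using cutoff_tendsto[OF p uLp cc c(2) M] by (simp add: un_def cn_def)
  have dM: "\<exists>M'. \<forall>x. \<bar>partial_deriv i c x\<bar> \<le> M'" if "i \<in> Basis" for i
    using test_function_bound[OF test_function_partial_deriv[OF c(1) that]] by blast
  have dcu_lim: "(\<lambda>n. Lp_mass p (\<lambda>x. partial_deriv i (cn n) x * u x)) \<longlonglongrightarrow> 0" if i: "i \<in> Basis" for i
  proof -
    obtain M' where M': "\<And>x. \<bar>partial_deriv i c x\<bar> \<le> M'" using dM[OF i] by blast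
    have M'0: "M' \<ge> 0" using M'[of 0] by linarith
    have "Lp_mass p (\<lambda>x. partial_deriv i (cn n) x * u x) \<le> ennreal ((inverse (real (Suc n)) * M') powr p) * Lp_mass p u" for n
    proof -
      have "Lp_mass p (\<lambda>x. partial_deriv i (cn n) x * u x) \<le> Lp_mass p (\<lambda>x. (inverse (real (Suc n)) * M') * u x)"
      proof (rule Lp_mass_mono)
        fix x
        have "\<bar>partial_deriv i (cn n) x\<bar> \<le> inverse (real (Suc n)) * M'"
          unfolding dcn[OF i] using M'[of "x /\<^sub>R real (Suc n)"] by (simp add: abs_mult mult_left_mono)
        then show "\<bar>partial_deriv i (cn n) x * u x\<bar> \<le> \<bar>(inverse (real (Suc n)) * M') * u x\<bar>"
          using M'0 by (simp add: abs_mult mult_right_mono)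
      qed (use p in simp)
      then show ?thesis using M'0 by (simp add: Lp_mass_cmult)
    qed
    moreover have "(\<lambda>n. ennreal ((inverse (real (Suc n)) * M') powr p) * Lp_mass p u) \<longlonglongrightarrow> 0"
    proof -
      have "(\<lambda>n. inverse (real (Suc n)) * M') \<longlonglongrightarrow> 0 * M'"
        by (intro tendsto_mult LIMSEQ_inverse_real_of_nat tendsto_const)
      then have "(\<lambda>n. (inverse (real (Suc n)) * M') powr p) \<longlonglongrightarrow> 0"
        by (subst tendsto_0_powr_iff) (use p M'0 in auto)
      then have "(\<lambda>n. ennreal ((inverse (real (Suc n)) * M') powr p)) \<longlonglongrightarrow> 0"
        using tendsto_ennrealI by fastforce
      moreover have "Lp_mass p u < top" using uLp by (simp add: Lp_space_iff)
      ultimately have "(\<lambda>n. Lp_mass p u * ennreal ((inverse (real (Suc n)) * M') powr p)) \<longlonglongrightarrow> Lp_mass p u * 0"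
        by (intro ennreal_tendsto_cmult)
      then show ?thesis by (simp add: mult.commute)
    qed
    ultimately show ?thesis by (rule tendsto_0_le)
  qed
  have pdm[measurable]: "partial_deriv i (cn n) \<in> borel_measurable borel" if "i \<in> Basis" for i n
    by (rule C_infinity_measurable[OF C_infinity_partial_deriv[OF cnC that]])
  have wn_lim: "(\<lambda>n. Lp_mass p (\<lambda>x. wn i n x - w i x)) \<longlonglongrightarrow> 0" if i: "i \<in> Basis" for i
  proof -
    note [measurable] = pdm[OF i] Lp_space_measurable[OF w(1)[OF i]]
    have "(\<lambda>n. Lp_mass p (\<lambda>x. (cn n x * w i x - w i x) + partial_deriv i (cn n) x * u x)) \<longlonglongrightarrow> 0"
      using cutoff_tendsto[OF p w(1)[OF i] cc c(2) M] dcu_lim[OF i]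
      by (intro Lp_mass_add_tendsto_0[OF p]) (auto simp: cn_def)
    then show ?thesis by (simp add: wn_def algebra_simps)
  qed
  have wn_Lp: "wn i n \<in> Lp_space p" if i: "i \<in> Basis" for i n
  proof -
    obtain M' where M': "\<And>x. \<bar>partial_deriv i (cn n) x\<bar> \<le> M'"
      using test_function_bound[OF test_function_partial_deriv[OF cn_test i]] by blast
    show ?thesis
      unfolding wn_def
      by (intro Lp_space_add[OF p] Lp_space_mult_bounded[OF p w(1)[OF i] _ cnM]
          Lp_space_mult_bounded[OF p uLp _ M'] pdm i) auto
  qed
  \<comment> \<open>\<open>None\<close> stands for the function and \<open>Some i\<close> for its
    derivative in direction \<open>i\<close>, so that one kernel serves all of them with error 1 /
    (n + 1).\<close>
  define J where "J = insert None (Some ` (Basis::'a set))"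
  define F where "F n j = (case j of None \<Rightarrow> un n | Some i \<Rightarrow> wn i n)" for n j
  have "\<exists>K :: 'a \<Rightarrow> real. \<exists>d. mollifier d K \<and> (\<forall>j\<in>J. Lp_mass p (\<lambda>x. convolve K (F n j) x - F n j x) \<le> ennreal (inverse (real (Suc n))))" for n
  proof -
    have "\<exists>d>0. \<forall>K. mollifier d K \<longrightarrow> (\<forall>j\<in>J. Lp_mass p (\<lambda>x. convolve K (F n j) x - F n j x) \<le> ennreal (inverse (real (Suc n))))"
      by (rule mollify_Lp_finite[OF p]) (auto simp: J_def F_def un_Lp wn_Lp)
    then show ?thesis using mollifier_exists by blast
  qed
  then obtain K :: "nat \<Rightarrow> 'a \<Rightarrow> real" and d where K: "\<And>n. mollifier (d n) (K n)"
    "\<And>n j. j \<in> J \<Longrightarrow> Lp_mass p (\<lambda>x. convolve (K n) (F n j) x - F n j x) \<le> ennreal (inverse (real (Suc n)))"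
    by metis
  note tK = mollifier_test_function[OF K(1)]
  note [measurable] = test_function_measurable[OF tK]
  have K_lim: "(\<lambda>n. Lp_mass p (\<lambda>x. convolve (K n) (g n) x - h x)) \<longlonglongrightarrow> 0"
    if "j \<in> J" "\<And>n. g n = F n j" "(\<lambda>n. Lp_mass p (\<lambda>x. g n x - h x)) \<longlonglongrightarrow> 0"
      and [measurable]: "\<And>n. g n \<in> borel_measurable borel" "h \<in> borel_measurable borel" for j g and h :: "'a \<Rightarrow> real"
  proof -
    have "(\<lambda>n. Lp_mass p (\<lambda>x. convolve (K n) (g n) x - g n x)) \<longlonglongrightarrow> 0"
      by (rule tendsto_0_le[OF _ tendsto_0_inverse_Suc_ennreal]) (use K(2)[OF that(1)] that(2) in simp)
    with that(3) have "(\<lambda>n. Lp_mass p (\<lambda>x. (convolve (K n) (g n) x - g n x) + (g n x - h x))) \<longlonglongrightarrow> 0"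
      by (intro Lp_mass_add_tendsto_0[OF p]) auto
    then show ?thesis by simp
  qed
  define \<phi> where "\<phi> n = convolve (K n) (un n)" for n
  have t\<phi>: "test_function (\<phi> n)" for n
  proof -
    obtain R where "\<And>x. cn n x \<noteq> 0 \<Longrightarrow> norm x \<le> R" using test_function_support[OF cn_test] by blast
    then show ?thesis
      unfolding \<phi>_def using tK Lp_imp_locally_integrable[OF p un_Lp]
      by (intro test_function_convolve[where R=R]) (auto simp: un_def)
  qed
  have "(\<lambda>n. sobolev_norm 1 p (\<lambda>x. \<phi> n x - u x)) \<longlonglongrightarrow> 0"
  proof (rule sobolev_norm_tendsto_0I[OF p])
    \<comment> \<open>Multi-indices of order at most one are zero or unit vectors; the direction is
      recovered from the multi-index by choice, which is unambiguous by
      \<open>unit_inj\<close>.\<close>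
    define W where "W n \<alpha> = (if \<alpha> = (\<lambda>_. 0) then (\<lambda>x. \<phi> n x - u x) else (\<lambda>x. convolve (K n) (wn (SOME i. i \<in> Basis \<and> \<alpha> = unit_index i) n) x - w (SOME i. i \<in> Basis \<and> \<alpha> = unit_index i) x))" for n \<alpha>
    have unit_inj: "unit_index i = unit_index i' \<Longrightarrow> i = i'" for i i' :: 'a
      by (metis unit_index_def zero_neq_one)
    have un0: "unit_index i \<noteq> (\<lambda>_. 0)" for i :: 'a
      by (metis unit_index_def zero_neq_one)
    have W: "W n (unit_index i) = (\<lambda>x. convolve (K n) (wn i n) x - w i x)" if "i \<in> Basis" for n i
    proof -
      have "(SOME i'. i' \<in> Basis \<and> unit_index i = unit_index i') = i"
        by (rule some_equality) (use that unit_inj in auto)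
      then show ?thesis by (simp add: W_def un0)
    qed
    fix \<alpha> :: "'a \<Rightarrow> nat" assume \<alpha>: "\<alpha> \<in> multi_indices 1"
    show "has_weak_deriv \<alpha> (\<lambda>x. \<phi> n x - u x) (W n \<alpha>)" for n
    proof (cases "\<alpha> = (\<lambda>_. 0)")
      case True
      then show ?thesis
        using has_weak_deriv_zero[of "\<lambda>x. \<phi> n x - u x"] C_infinity_locally_integrable[OF test_function_C_infinity[OF t\<phi>]] lu
        by (simp add: W_def locally_integrable_diff)
    next
      case False
      then obtain i where i: "\<alpha> = unit_index i" "i \<in> Basis" using \<alpha> multi_indices_1 by auto
      show ?thesis
        using has_weak_deriv_diff[OF \<alpha> has_weak_deriv_convolve[OF \<alpha> _ tK] , of "un n" "wn i n"] unwn[OF i(2)] w(2)[OF i(2)]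
        by (simp add: i W[OF i(2)] \<phi>_def)
    qed
    show "(\<lambda>n. Lp_mass p (W n \<alpha>)) \<longlonglongrightarrow> 0"
    proof (cases "\<alpha> = (\<lambda>_. 0)")
      case True
      then show ?thesis
        using K_lim[of None un u, OF _ _ un_lim] un_Lp by (simp add: W_def J_def F_def \<phi>_def Lp_space_measurable)
    next
      case False
      then obtain i where i: "\<alpha> = unit_index i" "i \<in> Basis" using \<alpha> multi_indices_1 by auto
      show ?thesis
        using K_lim[of "Some i" "wn i" "w i", OF _ _ wn_lim[OF i(2)]] wn_Lp[OF i(2)] w(1)[OF i(2)] i
        by (simp add: W[OF i(2)] J_def F_def Lp_space_measurable)
    qed
  qed
  then show ?thesis using t\<phi> by blast
qed

section \<open>Traces as fibre integrals\<close>

text \<open>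
  If \<open>H' = - a\<close> on \<open>[0, \<delta>]\<close>, \<open>H 0 = 1\<close> and \<open>H \<delta> = 0\<close>, then integrating the derivative of \<open>H \<phi>\<close>
  recovers \<open>\<phi> 0\<close> from \<open>\<phi>\<close> and \<open>\<phi>'\<close>. Both integrals below make sense for functions in $W^{1,p}$.
\<close>

definition trace_kernel :: "real \<Rightarrow> (real \<Rightarrow> real) \<Rightarrow> (real \<Rightarrow> real) \<Rightarrow> bool" where
  "trace_kernel \<delta> a H \<longleftrightarrow>
     test_function a \<and> (\<forall>t. a t \<ge> 0) \<and> (\<forall>t. a t \<noteq> 0 \<longrightarrow> 0 \<le> t \<and> t \<le> \<delta>) \<and> (\<integral>t. a t \<partial>lborel) = 1 \<and>
     H \<in> borel_measurable borel \<and> (\<forall>t. \<bar>H t\<bar> \<le> indicator {0..\<delta>} t) \<and>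
     (\<forall>\<phi>\<in>C_infinity. \<phi> 0 = (\<integral>t. a t * \<phi> t \<partial>lborel) - (\<integral>t. H t * partial_deriv 1 \<phi> t \<partial>lborel))"

text \<open>\<open>a\<close> is a normalised bump on the interval from 0 to \<open>\<delta>\<close>,
  and \<open>H\<close> is its tail integral from t to \<open>\<delta>\<close>, set to 0 outside the
  interval. As the tail of a probability density it lies between 0 and 1.\<close>

lemma trace_kernel_exists:
  assumes \<delta>: "\<delta> > 0"
  shows "\<exists>a H. trace_kernel \<delta> a H"
proof -
  obtain f :: "real \<Rightarrow> real" where f: "f \<in> C_infinity" "\<And>t. f t \<ge> 0" "\<And>t. f t > 0 \<longleftrightarrow> 0 < t \<and> t < \<delta>"
    using bump_real[OF \<delta>] by blast
  have fsupp: "0 < t \<and> t < \<delta>" if "f t \<noteq> 0" for t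
    using that f(2)[of t] f(3)[of t] by linarith
  then have "norm t \<le> \<delta>" if "f t \<noteq> 0" for t
    using that by fastforce
  then have tf: "test_function f" using f(1) test_function_iff by blast
  define a where "a t = f t * (1 / (\<integral>t. f t \<partial>lborel))" for t
  have pos: "(\<integral>t. f t \<partial>lborel) > 0"
    by (rule test_function_integral_pos[OF tf f(2), of "\<delta>/2"]) (use f(3) \<delta> in auto)
  have ta: "test_function a"
    unfolding a_def[abs_def] by (rule test_function_mult[OF tf C_infinity_const])
  have a0: "a t \<ge> 0" for t using f(2) pos by (simp add: a_def)
  have asupp: "0 \<le> t \<and> t \<le> \<delta>" if "a t \<noteq> 0" for t
    using fsupp[of t] that by (simp add: a_def)
  have a1: "(\<integral>t. a t \<partial>lborel) = 1" using pos by (simp add: a_def)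
  have ac: "continuous_on A a" for A by (intro C_infinity_continuous_on test_function_C_infinity ta)
  have ai: "a integrable_on {s..t}" for s t by (rule integrable_continuous_real[OF ac])
  define G where "G t = integral {t..\<delta>} a" for t
  have G0: "G 0 = 1"
  proof -
    have "integral {0..\<delta>} a = (\<integral>t. indicator {0..\<delta>} t *\<^sub>R a t \<partial>lborel)"
      using set_borel_integral_eq_integral(2)[of "{0..\<delta>}" a] borel_integrable_compact[OF _ ac, of "{0..\<delta>}"]
      by (simp add: set_lebesgue_integral_def set_integrable_def)
    also have "\<dots> = (\<integral>t. a t \<partial>lborel)"
      using asupp by (intro Bochner_Integration.integral_cong) (auto simp: indicator_def)
    finally show ?thesis by (simp add: G_def a1)
  qed
  have G\<delta>: "G \<delta> = 0" by (simp add: G_def)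
  have Gb: "0 \<le> G t" "G t \<le> 1" if "0 \<le> t" for t
  proof -
    show "0 \<le> G t" unfolding G_def by (rule integral_nonneg[OF ai]) (simp add: a0)
    show "G t \<le> 1"
      unfolding G0[symmetric] unfolding G_def
      by (rule integral_subset_le[OF _ ai ai]) (use that a0 in auto)
  qed
  have Gd: "(G has_real_derivative - a t) (at t within {0..\<delta>})" if "0 \<le> t" "t \<le> \<delta>" for t
    unfolding G_def by (rule integral_has_real_derivative'[OF ac]) (use that in auto)
  have Gc: "continuous_on {0..\<delta>} G"
    by (rule DERIV_continuous_on[of _ _ "\<lambda>t. - a t"]) (use Gd in auto)
  define H where "H t = indicator {0..\<delta>} t * G t" for t
  have Hm: "H \<in> borel_measurable borel"
    using borel_measurable_continuous_on_indicator[OF _ Gc] by (simp add: H_def[abs_def])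
  have Hb: "\<bar>H t\<bar> \<le> indicator {0..\<delta>} t" for t
    using Gb[of t] by (auto simp: H_def indicator_def)
  have "\<phi> 0 = (\<integral>t. a t * \<phi> t \<partial>lborel) - (\<integral>t. H t * partial_deriv 1 \<phi> t \<partial>lborel)" if \<phi>: "\<phi> \<in> C_infinity" for \<phi>
  proof -
    have D: "(\<phi> has_real_derivative partial_deriv 1 \<phi> t) (at t within {0..\<delta>})" for t
      using C_infinity_has_real_derivative[OF \<phi>, of 1 0 t] by (auto intro: has_field_derivative_at_within)
    have d\<phi>: "partial_deriv 1 \<phi> \<in> C_infinity" by (rule C_infinity_partial_deriv[OF \<phi>]) simp
    \<comment> \<open>The integrand is the derivative of the negative of G times
      \<open>\<phi>\<close>, which vanishes at \<open>\<delta>\<close> and equals the negative of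
      \<open>\<phi> 0\<close> at 0.\<close>
    have "(\<integral>t. indicator {0..\<delta>} t *\<^sub>R (a t * \<phi> t - G t * partial_deriv 1 \<phi> t) \<partial>lborel) = - (G \<delta> * \<phi> \<delta>) - - (G 0 * \<phi> 0)"
    proof (rule integral_FTC_Icc)
      show "0 \<le> \<delta>" using \<delta> by simp
      show "((\<lambda>t. - (G t * \<phi> t)) has_vector_derivative a t * \<phi> t - G t * partial_deriv 1 \<phi> t) (at t within {0..\<delta>})"
        if "0 \<le> t" "t \<le> \<delta>" for t
        unfolding has_real_derivative_iff_has_vector_derivative[symmetric]
        using DERIV_minus[OF DERIV_mult[OF Gd[OF that] D[of t]]] by (simp add: algebra_simps)
      show "continuous_on {0..\<delta>} (\<lambda>t. a t * \<phi> t - G t * partial_deriv 1 \<phi> t)"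
        by (intro continuous_intros ac Gc C_infinity_continuous_on \<phi> d\<phi>)
    qed
    moreover have "(\<integral>t. indicator {0..\<delta>} t *\<^sub>R (a t * \<phi> t - G t * partial_deriv 1 \<phi> t) \<partial>lborel) =
       (\<integral>t. a t * \<phi> t - H t * partial_deriv 1 \<phi> t \<partial>lborel)"
      using asupp by (intro Bochner_Integration.integral_cong refl) (auto simp: H_def indicator_def)
    moreover have "integrable lborel (\<lambda>t. a t * \<phi> t)"
      by (intro test_function_mult_integrable ta C_infinity_locally_integrable \<phi>)
    moreover have "integrable lborel (\<lambda>t. H t * partial_deriv 1 \<phi> t)"
    proof (rule locally_integrable_mult_bounded_support[OF C_infinity_locally_integrable[OF d\<phi>] Hm])
      show "\<bar>H t\<bar> \<le> 1" for t using Hb[of t] by (auto split: split_indicator_asm)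
      show "t \<in> {0..\<delta>}" if "H t \<noteq> 0" for t
        using that by (auto simp: H_def split: split_indicator_asm)
    qed simp
    ultimately show ?thesis by (simp add: G0 G\<delta>)
  qed
  then have "trace_kernel \<delta> a H"
    unfolding trace_kernel_def using ta a0 asupp a1 Hm Hb by blast
  then show ?thesis by blast
qed

lemma trace_kernelD:
  assumes "trace_kernel \<delta> a H"
  shows "test_function a" "a t \<ge> 0" "a t \<noteq> 0 \<Longrightarrow> 0 \<le> t \<and> t \<le> \<delta>" "(\<integral>t. a t \<partial>lborel) = 1"
    "H \<in> borel_measurable borel" "\<bar>H t\<bar> \<le> indicator {0..\<delta>} t" "\<bar>H t\<bar> \<le> 1"
    "H t \<noteq> 0 \<Longrightarrow> t \<in> {0..\<delta>}"
    "\<phi> \<in> C_infinity \<Longrightarrow> \<phi> 0 = (\<integral>t. a t * \<phi> t \<partial>lborel) - (\<integral>t. H t * partial_deriv 1 \<phi> t \<partial>lborel)"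
proof -
  have H: "\<bar>H t\<bar> \<le> indicator {0..\<delta>} t" using assms by (simp add: trace_kernel_def)
  then show "\<bar>H t\<bar> \<le> indicator {0..\<delta>} t" "\<bar>H t\<bar> \<le> 1" "H t \<noteq> 0 \<Longrightarrow> t \<in> {0..\<delta>}"
    by (auto split: split_indicator_asm)
qed (use assms in \<open>auto simp: trace_kernel_def\<close>)

lemma trace_kernel_integrable:
  assumes "trace_kernel \<delta> a H"
  shows "integrable lborel a" "integrable lborel H"
proof -
  show "integrable lborel a" by (rule test_function_integrable[OF trace_kernelD(1)[OF assms]])
  have "integrable lborel (\<lambda>t. H t * 1)"
    by (rule locally_integrable_mult_bounded_support[of _ H 1 "{0..\<delta>}"])
      (use trace_kernelD[OF assms] in \<open>auto intro: C_infinity_locally_integrable\<close>)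
  then show "integrable lborel H" by simp
qed

section \<open>Integration along the normal fibres\<close>

text \<open>With \<open>h = a\<close> from a trace kernel this is the average over the slab; with
  \<open>h = H\<close> and the normal derivative for \<open>f\<close> it is the deviation of that
  average from the trace.\<close>

definition fibre_integral :: "(real \<Rightarrow> real) \<Rightarrow> ('a::euclidean_space \<times> real \<Rightarrow> real) \<Rightarrow> 'a \<Rightarrow> real" where
  "fibre_integral h f x = (\<integral>t. h t * f (x, t) \<partial>lborel)"

lemma measurable_fibre [measurable]:
  fixes f :: "'a::euclidean_space \<times> real \<Rightarrow> real"
  assumes "f \<in> borel_measurable borel"
  shows "(\<lambda>t. f (x, t)) \<in> borel_measurable borel"
  by (rule measurable_compose[OF _ assms]) simp

lemma fibre_integral_measurable [measurable]:
  assumes [measurable]: "h \<in> borel_measurable borel" "f \<in> borel_measurable borel"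
  shows "fibre_integral h f \<in> borel_measurable borel"
proof -
  have [measurable]: "f \<in> borel_measurable (borel \<Otimes>\<^sub>M borel)" by (simp add: borel_prod)
  have "fibre_integral h f \<in> borel_measurable lborel"
    unfolding fibre_integral_def by measurable
  then show ?thesis by simp
qed

lemma Lp_mass_prod:
  fixes f :: "'a::euclidean_space \<times> real \<Rightarrow> real"
  assumes [measurable]: "f \<in> borel_measurable borel"
  shows "Lp_mass p f = (\<integral>\<^sup>+x. \<integral>\<^sup>+t. ennreal (\<bar>f (x, t)\<bar> powr p) \<partial>lborel \<partial>lborel)"
proof -
  have [measurable]: "f \<in> borel_measurable (borel \<Otimes>\<^sub>M borel)" by (simp add: borel_prod)
  show ?thesis
    unfolding Lp_mass_def lborel_prod[symmetric] by (subst lborel.nn_integral_fst[symmetric]) auto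
qed

text \<open>Jensen's inequality on each fibre, then the bound M for the weight. The set S records
  where the weight is nonzero: all of space is enough for continuity, a thin slab is needed for
  smallness.\<close>

lemma Lp_mass_fibre_integral_le:
  fixes f :: "'a::euclidean_space \<times> real \<Rightarrow> real"
  assumes p: "p \<ge> 1" and h: "integrable lborel h" "\<And>t. \<bar>h t\<bar> \<le> M" "\<And>t. h t \<noteq> 0 \<Longrightarrow> t \<in> S"
    and [measurable]: "S \<in> sets borel" "f \<in> borel_measurable borel"
  shows "Lp_mass p (fibre_integral h f) \<le>
    ennreal ((\<integral>t. \<bar>h t\<bar> \<partial>lborel) powr (p - 1) * M) * Lp_mass p (\<lambda>x. indicator S (snd x) * f x)"
proof -
  have [measurable]: "h \<in> borel_measurable borel" using h by auto
  have [measurable]: "f \<in> borel_measurable (borel \<Otimes>\<^sub>M borel)" by (simp add: borel_prod)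
  have M: "M \<ge> 0" using h(2)[of 0] by linarith
  let ?m = "ennreal ((\<integral>t. \<bar>h t\<bar> \<partial>lborel) powr (p - 1))"
  let ?g = "\<lambda>x. indicator S (snd x) * f x"
  have [measurable]: "?g \<in> borel_measurable borel"
  proof -
    have "?g \<in> borel_measurable (borel \<Otimes>\<^sub>M borel)" by measurable
    then show ?thesis by (simp add: borel_prod)
  qed
  have "Lp_mass p (fibre_integral h f) \<le> (\<integral>\<^sup>+x. ?m * (\<integral>\<^sup>+t. ennreal (\<bar>h t\<bar> * \<bar>f (x, t)\<bar> powr p) \<partial>lborel) \<partial>lborel)"
    unfolding Lp_mass_def fibre_integral_def
    by (intro nn_integral_mono powr_integral_le[OF p h(1)]) measurable
  also have "\<dots> \<le> (\<integral>\<^sup>+x. ?m * (\<integral>\<^sup>+t. ennreal M * ennreal (\<bar>?g (x, t)\<bar> powr p) \<partial>lborel) \<partial>lborel)"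
  proof (intro nn_integral_mono mult_left_mono)
    fix x t
    have "\<bar>h t\<bar> * \<bar>f (x, t)\<bar> powr p \<le> M * \<bar>?g (x, t)\<bar> powr p"
      using h(2)[of t] h(3)[of t] M by (cases "h t = 0") (auto intro!: mult_right_mono)
    then show "ennreal (\<bar>h t\<bar> * \<bar>f (x, t)\<bar> powr p) \<le> ennreal M * ennreal (\<bar>?g (x, t)\<bar> powr p)"
      using M by (simp add: ennreal_mult[symmetric] ennreal_leI)
  qed auto
  also have "\<dots> = ?m * (ennreal M * Lp_mass p ?g)"
    by (subst Lp_mass_prod) (auto simp: nn_integral_cmult)
  finally show ?thesis using M by (simp add: ennreal_mult mult.assoc)
qed

lemma fibre_integral_Lp:
  assumes p: "p \<ge> 1" and h: "integrable lborel h" "\<And>t. \<bar>h t\<bar> \<le> M" and f: "f \<in> Lp_space p"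
  shows "fibre_integral h f \<in> Lp_space p"
proof -
  have [measurable]: "f \<in> borel_measurable borel" "h \<in> borel_measurable borel"
    using h f by (auto intro: Lp_space_measurable)
  show ?thesis
    using Lp_mass_fibre_integral_le[OF p h, of UNIV f] f
    by (auto simp: Lp_space_iff ennreal_mult_less_top intro: le_less_trans)
qed

text \<open>Tonelli's theorem: a finite iterated integral has finite inner integrals almost
  everywhere.\<close>

lemma AE_fibre_Lp:
  fixes f :: "'a::euclidean_space \<times> real \<Rightarrow> real"
  assumes f: "f \<in> Lp_space p"
  shows "AE x in lborel. (\<lambda>t. f (x, t)) \<in> Lp_space p"
proof -
  have [measurable]: "f \<in> borel_measurable borel" by (rule Lp_space_measurable[OF f])
  have [measurable]: "f \<in> borel_measurable (borel \<Otimes>\<^sub>M borel)" by (simp add: borel_prod)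
  have "AE x in lborel. (\<integral>\<^sup>+t. ennreal (\<bar>f (x, t)\<bar> powr p) \<partial>lborel) \<noteq> \<infinity>"
    by (rule nn_integral_PInf_AE) (use f in \<open>auto simp: Lp_space_iff Lp_mass_prod\<close>)
  then show ?thesis
    by eventually_elim (auto simp: Lp_space_iff Lp_mass_def less_top)
qed

text \<open>The equality is only almost everywhere: on an exceptional fibre the integrals may
  diverge and take the value 0 by convention, which can destroy linearity.\<close>

lemma fibre_integral_diff:
  assumes p: "p \<ge> 1" and h: "h \<in> borel_measurable borel" "\<And>t. \<bar>h t\<bar> \<le> M" "\<And>t. h t \<noteq> 0 \<Longrightarrow> t \<in> K" "compact K"
    and f: "f \<in> Lp_space p" and g: "g \<in> Lp_space p"
  shows "AE x in lborel. fibre_integral h (\<lambda>x. f x - g x) x = fibre_integral h f x - fibre_integral h g x"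
  using AE_fibre_Lp[OF f] AE_fibre_Lp[OF g]
proof eventually_elim
  case (elim x)
  have "integrable lborel (\<lambda>t. h t * f (x, t))" "integrable lborel (\<lambda>t. h t * g (x, t))"
    using elim
    by (auto intro!: locally_integrable_mult_bounded_support[OF _ h] Lp_imp_locally_integrable[OF p])
  then show ?case by (simp add: fibre_integral_def right_diff_distrib)
qed

section \<open>The integral formula for the trace\<close>

text \<open>Candidate for the trace of \<open>u\<close>, with \<open>w\<close> standing for the weak
  derivative of \<open>u\<close> in the normal direction.\<close>

definition trace_integral ::
    "(real \<Rightarrow> real) \<Rightarrow> (real \<Rightarrow> real) \<Rightarrow> ('a::euclidean_space \<times> real \<Rightarrow> real) \<Rightarrow> ('a \<times> real \<Rightarrow> real) \<Rightarrow> 'a \<Rightarrow> real" where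
  "trace_integral a H u w x = fibre_integral a u x - fibre_integral H w x"

lemma normal_Basis [simp]: "(0, 1) \<in> (Basis :: ('a::euclidean_space \<times> real) set)"
  by (simp add: Basis_prod_def)

text \<open>The defining identity of a trace kernel is applied on each normal line, where the normal
  partial derivative is an ordinary derivative.\<close>

lemma trace_integral_C_infinity:
  fixes \<phi> :: "'a::euclidean_space \<times> real \<Rightarrow> real"
  assumes tk: "trace_kernel \<delta> a H" and \<phi>: "\<phi> \<in> C_infinity"
  shows "trace_integral a H \<phi> (partial_deriv (0, 1) \<phi>) x = \<phi> (x, 0)"
proof -
  let ?f = "\<lambda>t. \<phi> ((x, 0) + (0, t))"
  have "?f \<in> C_infinity"
    by (rule C_infinity_compose_affine[OF \<phi>]) (simp add: linear_iff)
  then have "(\<lambda>t. \<phi> (x, t)) \<in> C_infinity" by simp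
  moreover have "partial_deriv 1 (\<lambda>t. \<phi> (x, t)) t = partial_deriv (0, 1) \<phi> (x, t)" for t
    by (simp add: partial_deriv_def)
  ultimately show ?thesis
    using trace_kernelD(9)[OF tk, of "\<lambda>t. \<phi> (x, t)"] by (simp add: trace_integral_def fibre_integral_def)
qed

lemma trace_integral_Lp:
  assumes p: "p \<ge> 1" and tk: "trace_kernel \<delta> a H" and u: "u \<in> Lp_space p" and w: "w \<in> Lp_space p"
  shows "trace_integral a H u w \<in> Lp_space p"
proof -
  obtain M where "\<And>t. \<bar>a t\<bar> \<le> M" using test_function_bound[OF trace_kernelD(1)[OF tk]] by blast
  then show ?thesis
    unfolding trace_integral_def
    by (intro Lp_space_diff[OF p] fibre_integral_Lp[OF p _ _ u] fibre_integral_Lp[OF p _ trace_kernelD(7)[OF tk] w]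
        trace_kernel_integrable[OF tk])
qed

text \<open>Both fibre integrals are linear up to null sets and bounded on L^p.\<close>

lemma trace_integral_tendsto:
  fixes u w :: "'a::euclidean_space \<times> real \<Rightarrow> real"
  assumes p: "p \<ge> 1" and tk: "trace_kernel \<delta> a H" and u: "u \<in> Lp_space p" and w: "w \<in> Lp_space p"
    and un: "\<And>n. un n \<in> Lp_space p" and wn: "\<And>n. wn n \<in> Lp_space p"
    and limu: "(\<lambda>n. Lp_mass p (\<lambda>x. un n x - u x)) \<longlonglongrightarrow> 0"
    and limw: "(\<lambda>n. Lp_mass p (\<lambda>x. wn n x - w x)) \<longlonglongrightarrow> 0"
  shows "(\<lambda>n. Lp_mass p (\<lambda>x. trace_integral a H (un n) (wn n) x - trace_integral a H u w x)) \<longlonglongrightarrow> 0"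
proof -
  note meas[measurable] = Lp_space_measurable[OF u] Lp_space_measurable[OF w] Lp_space_measurable[OF un] Lp_space_measurable[OF wn]
    test_function_measurable[OF trace_kernelD(1)[OF tk]] trace_kernelD(5)[OF tk]
  obtain M where M: "\<And>t. \<bar>a t\<bar> \<le> M" using test_function_bound[OF trace_kernelD(1)[OF tk]] by blast
  have asupp: "a t \<noteq> 0 \<Longrightarrow> t \<in> {0..\<delta>}" for t using trace_kernelD(3)[OF tk] by simp
  have d1: "AE x in lborel. fibre_integral a (\<lambda>x. un n x - u x) x = fibre_integral a (un n) x - fibre_integral a u x" for n
    by (rule fibre_integral_diff[OF p meas(5) M _ compact_Icc un u]) (rule asupp)
  have d2: "AE x in lborel. fibre_integral H (\<lambda>x. wn n x - w x) x = fibre_integral H (wn n) x - fibre_integral H w x" for n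
    by (rule fibre_integral_diff[OF p meas(6) trace_kernelD(7)[OF tk] _ compact_Icc wn w]) (rule trace_kernelD(8)[OF tk])
  have ae: "AE x in lborel. trace_integral a H (un n) (wn n) x - trace_integral a H u w x =
      fibre_integral a (\<lambda>x. un n x - u x) x - fibre_integral H (\<lambda>x. wn n x - w x) x" for n
    using d1[of n] d2[of n] by eventually_elim (simp add: trace_integral_def)
  have lim: "(\<lambda>n. Lp_mass p (fibre_integral h (\<lambda>x. fn n x - f x))) \<longlonglongrightarrow> 0"
    if h: "integrable lborel h" "\<And>t. \<bar>h t\<bar> \<le> M'" and [measurable]: "\<And>n. fn n \<in> borel_measurable borel" "f \<in> borel_measurable borel"
      and lim: "(\<lambda>n. Lp_mass p (\<lambda>x. fn n x - f x)) \<longlonglongrightarrow> 0" for h M' fn and f :: "'a \<times> real \<Rightarrow> real"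
  proof (rule tendsto_0_le)
    show "Lp_mass p (fibre_integral h (\<lambda>x. fn n x - f x)) \<le>
       ennreal ((\<integral>t. \<bar>h t\<bar> \<partial>lborel) powr (p - 1) * M') * Lp_mass p (\<lambda>x. fn n x - f x)" for n
      using Lp_mass_fibre_integral_le[OF p h, of UNIV "\<lambda>x. fn n x - f x"] by simp
    show "(\<lambda>n. ennreal ((\<integral>t. \<bar>h t\<bar> \<partial>lborel) powr (p - 1) * M') * Lp_mass p (\<lambda>x. fn n x - f x)) \<longlonglongrightarrow> 0"
      using ennreal_tendsto_cmult[OF _ lim, of "ennreal ((\<integral>t. \<bar>h t\<bar> \<partial>lborel) powr (p - 1) * M')"] by simp
  qed
  have "(\<lambda>n. Lp_mass p (\<lambda>x. fibre_integral a (\<lambda>x. un n x - u x) x + - fibre_integral H (\<lambda>x. wn n x - w x) x)) \<longlonglongrightarrow> 0"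
  proof (rule Lp_mass_add_tendsto_0[OF p])
    show "(\<lambda>n. Lp_mass p (fibre_integral a (\<lambda>x. un n x - u x))) \<longlonglongrightarrow> 0"
      by (rule lim[OF trace_kernel_integrable(1)[OF tk] M _ _ limu]) measurable
    show "(\<lambda>n. Lp_mass p (\<lambda>x. - fibre_integral H (\<lambda>x. wn n x - w x) x)) \<longlonglongrightarrow> 0"
      unfolding Lp_mass_uminus
      by (rule lim[OF trace_kernel_integrable(2)[OF tk] trace_kernelD(7)[OF tk] _ _ limw]) measurable
  qed measurable
  moreover have "Lp_mass p (\<lambda>x. trace_integral a H (un n) (wn n) x - trace_integral a H u w x) =
      Lp_mass p (\<lambda>x. fibre_integral a (\<lambda>x. un n x - u x) x + - fibre_integral H (\<lambda>x. wn n x - w x) x)" for n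
    using ae[of n] by (intro Lp_mass_cong_AE) (simp add: eventually_mono)
  ultimately show ?thesis by simp
qed

text \<open>On test functions the integral formula is the restriction, and it is continuous under
  L^p convergence of the function and of its normal derivative. Hence every approximating sequence
  has the same limit on the hyperplane, which serves both existence and uniqueness of the
  trace.\<close>

lemma test_function_trace_tendsto:
  fixes u w :: "'a::euclidean_space \<times> real \<Rightarrow> real"
  assumes p: "p \<ge> 1" and tk: "trace_kernel \<delta> a H" and u: "u \<in> Lp_space p" and w: "w \<in> Lp_space p"
    and uw: "has_weak_deriv (unit_index (0, 1)) u w"
    and \<phi>: "\<And>n. test_function (\<phi> n)" and lim: "(\<lambda>n. sobolev_norm 1 p (\<lambda>x. \<phi> n x - u x)) \<longlonglongrightarrow> 0"
  shows "(\<lambda>n. Lp_mass p (\<lambda>x. \<phi> n (x, 0) - trace_integral a H u w x)) \<longlonglongrightarrow> 0"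
proof -
  have \<phi>L: "\<phi> n \<in> Lp_space p" "partial_deriv (0, 1) (\<phi> n) \<in> Lp_space p" for n
    by (intro test_function_Lp[OF p] test_function_partial_deriv \<phi>; simp)+
  have i: "unit_index (0, 1) \<in> (multi_indices 1 :: ('a \<times> real \<Rightarrow> nat) set)"
    and z: "(\<lambda>_. 0) \<in> (multi_indices 1 :: ('a \<times> real \<Rightarrow> nat) set)"
    by (rule unit_index_in_multi_indices) (auto simp: multi_indices_def)
  have "(\<lambda>n. Lp_mass p (\<lambda>x. \<phi> n x - u x)) \<longlonglongrightarrow> 0"
    by (rule sobolev_norm_tendsto_0D[OF p z _ _ lim])
      (intro has_weak_deriv_zero locally_integrable_diff Lp_imp_locally_integrable[OF p] Lp_space_diff[OF p] \<phi>L u)+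
  moreover have "(\<lambda>n. Lp_mass p (\<lambda>x. partial_deriv (0, 1) (\<phi> n) x - w x)) \<longlonglongrightarrow> 0"
  proof (rule sobolev_norm_tendsto_0D[OF p i _ _ lim])
    show "has_weak_deriv (unit_index (0, 1)) (\<lambda>x. \<phi> n x - u x) (\<lambda>x. partial_deriv (0, 1) (\<phi> n) x - w x)" for n
      by (intro has_weak_deriv_diff[OF i] has_weak_deriv_C_infinity test_function_C_infinity \<phi> uw normal_Basis)
    show "(\<lambda>x. partial_deriv (0, 1) (\<phi> n) x - w x) \<in> Lp_space p" for n
      by (intro Lp_space_diff[OF p] \<phi>L w)
  qed
  ultimately show ?thesis
    using trace_integral_tendsto[where un=\<phi> and wn="\<lambda>n. partial_deriv (0, 1) (\<phi> n)", OF p tk u w \<phi>L]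
    by (simp add: trace_integral_C_infinity[OF tk test_function_C_infinity[OF \<phi>]])
qed

lemma test_function_restrict_Lp:
  fixes \<phi> :: "'a::euclidean_space \<times> real \<Rightarrow> real"
  assumes p: "p \<ge> 1" and \<phi>: "test_function \<phi>"
  shows "(\<lambda>x. \<phi> (x, 0)) \<in> Lp_space p"
proof (rule test_function_Lp[OF p])
  have "(\<lambda>x. \<phi> ((0, 0) + (x, 0))) \<in> C_infinity"
    by (rule C_infinity_compose_affine[OF test_function_C_infinity[OF \<phi>]]) (simp add: linear_iff)
  moreover obtain R where R: "\<And>x. \<phi> x \<noteq> 0 \<Longrightarrow> norm x \<le> R"
    using test_function_support[OF \<phi>] by blast
  have "norm x \<le> R" if "\<phi> (x, 0) \<noteq> 0" for x
    using R[OF that] by (simp add: norm_Pair)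
  ultimately show "test_function (\<lambda>x. \<phi> (x, 0))" by (auto simp: test_function_iff)
qed

section \<open>Existence, uniqueness and linearity of the trace\<close>

text \<open>The restrictions of an approximating sequence converge in L^p both to \<open>g\<close>
  and to the integral formula, and limits in L^p agree almost everywhere.\<close>

lemma has_trace_unique:
  fixes u w :: "'a::euclidean_space \<times> real \<Rightarrow> real"
  assumes p: "p \<ge> 1" and g: "has_trace p u g" and tk: "trace_kernel \<delta> a H" and w: "w \<in> Lp_space p"
    and uw: "has_weak_deriv (unit_index (0, 1)) u w"
  shows "AE x in lborel. g x = trace_integral a H u w x"
proof -
  have u: "u \<in> Lp_space p" using g by (simp add: has_trace_def sobolev_space_def)
  have gL: "g \<in> Lp_space p" using g by (simp add: has_trace_def)
  obtain \<phi> where \<phi>: "\<And>n. test_function (\<phi> n)" "(\<lambda>n. sobolev_norm 1 p (\<lambda>x. \<phi> n x - u x)) \<longlonglongrightarrow> 0"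
    "(\<lambda>n. Lp_norm p (\<lambda>x. \<phi> n (x, 0) - g x)) \<longlonglongrightarrow> 0"
    using g unfolding has_trace_def by blast
  let ?T = "trace_integral a H u w"
  note TL = trace_integral_Lp[OF p tk u w]
  note \<phi>L = test_function_restrict_Lp[OF p \<phi>(1)]
  note [measurable] = Lp_space_measurable[OF gL] Lp_space_measurable[OF TL] Lp_space_measurable[OF \<phi>L]
  have l1: "(\<lambda>n. Lp_mass p (\<lambda>x. \<phi> n (x, 0) - ?T x)) \<longlonglongrightarrow> 0"
    by (rule test_function_trace_tendsto[OF p tk u w uw \<phi>(1,2)])
  have l2: "(\<lambda>n. Lp_mass p (\<lambda>x. \<phi> n (x, 0) - g x)) \<longlonglongrightarrow> 0"
    using \<phi>(3) Lp_norm_tendsto_0_iff[OF p, of "\<lambda>n x. \<phi> n (x, 0) - g x" sequentially] Lp_space_diff[OF p \<phi>L gL] by blast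
  have "(\<lambda>n. Lp_mass p (\<lambda>x. - (\<phi> n (x, 0) - g x) + (\<phi> n (x, 0) - ?T x))) \<longlonglongrightarrow> 0"
    by (rule Lp_mass_add_tendsto_0[OF p]) (use l1 l2 in \<open>simp_all only: Lp_mass_uminus\<close>, measurable)
  then have "(\<lambda>n. Lp_mass p (\<lambda>x. g x - ?T x)) \<longlonglongrightarrow> 0" by simp
  then have "Lp_mass p (\<lambda>x. g x - ?T x) = 0" by (simp add: LIMSEQ_const_iff)
  then have "AE x in lborel. g x - ?T x = 0"
    by (rule iffD1[OF Lp_mass_eq_0_iff, rotated]) measurable
  then show ?thesis by simp
qed

lemma has_trace_exists:
  fixes u w :: "'a::euclidean_space \<times> real \<Rightarrow> real"
  assumes p: "p \<ge> 1" and u: "u \<in> sobolev_space 1 p" and tk: "trace_kernel \<delta> a H" and w: "w \<in> Lp_space p"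
    and uw: "has_weak_deriv (unit_index (0, 1)) u w"
  shows "has_trace p u (trace_integral a H u w)"
proof -
  have uL: "u \<in> Lp_space p" using u by (simp add: sobolev_space_def)
  obtain \<phi> where \<phi>: "\<And>n. test_function (\<phi> n)" "(\<lambda>n. sobolev_norm 1 p (\<lambda>x. \<phi> n x - u x)) \<longlonglongrightarrow> 0"
    using test_functions_dense[OF p u] by blast
  have TL: "trace_integral a H u w \<in> Lp_space p" by (rule trace_integral_Lp[OF p tk uL w])
  have "(\<lambda>n. Lp_norm p (\<lambda>x. \<phi> n (x, 0) - trace_integral a H u w x)) \<longlonglongrightarrow> 0"
    using Lp_norm_tendsto_0_iff[OF p, of "\<lambda>n x. \<phi> n (x, 0) - trace_integral a H u w x" sequentially]
      Lp_space_diff[OF p test_function_restrict_Lp[OF p \<phi>(1)] TL]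
      test_function_trace_tendsto[OF p tk uL w uw \<phi>] by blast
  then show ?thesis
    unfolding has_trace_def using u TL \<phi> by blast
qed

lemma sobolev_space_mono: "u \<in> sobolev_space k p \<Longrightarrow> j \<le> k \<Longrightarrow> u \<in> sobolev_space j p"
  by (auto simp: sobolev_space_def multi_indices_def)

lemma sobolev_space_normal_deriv:
  fixes u :: "'a::euclidean_space \<times> real \<Rightarrow> real"
  assumes "u \<in> sobolev_space 1 p"
  obtains w where "w \<in> Lp_space p" "has_weak_deriv (unit_index (0, 1)) u w"
  using assms unit_index_in_multi_indices[OF normal_Basis, of 1] by (auto simp: sobolev_space_def)

lemma has_trace_hyperplane_trace:
  fixes u :: "'a::euclidean_space \<times> real \<Rightarrow> real"
  assumes p: "p \<ge> 1" and u: "u \<in> sobolev_space 1 p"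
  shows "has_trace p u (hyperplane_trace p u)"
proof -
  obtain w where "w \<in> Lp_space p" "has_weak_deriv (unit_index (0, 1)) u w"
    using u by (rule sobolev_space_normal_deriv)
  moreover obtain a H where "trace_kernel 1 a H" using trace_kernel_exists[of 1] by auto
  ultimately have "\<exists>g. has_trace p u g" using has_trace_exists[OF p u] by blast
  then show ?thesis unfolding hyperplane_trace_def by (rule someI_ex)
qed

text \<open>The trace kernel is arbitrary, so its width and density can later be adapted to the
  mollifier.\<close>

lemma hyperplane_trace_eq:
  fixes u w :: "'a::euclidean_space \<times> real \<Rightarrow> real"
  assumes "p \<ge> 1" "u \<in> sobolev_space 1 p" "trace_kernel \<delta> a H" "w \<in> Lp_space p"
    "has_weak_deriv (unit_index (0, 1)) u w"
  shows "AE x in lborel. hyperplane_trace p u x = trace_integral a H u w x"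
  by (rule has_trace_unique[OF assms(1) has_trace_hyperplane_trace[OF assms(1,2)] assms(3-5)])

lemma hyperplane_trace_Lp:
  fixes u :: "'a::euclidean_space \<times> real \<Rightarrow> real"
  assumes "p \<ge> 1" "u \<in> sobolev_space 1 p"
  shows "hyperplane_trace p u \<in> Lp_space p"
  using has_trace_hyperplane_trace[OF assms] by (simp add: has_trace_def)

text \<open>For smooth functions the integral formula holds at every point; the classical normal
  derivative lies in L^p and so can serve as the weak one.\<close>

lemma hyperplane_trace_C_infinity:
  fixes v :: "'a::euclidean_space \<times> real \<Rightarrow> real"
  assumes p: "p \<ge> 1" and v: "v \<in> sobolev_space 1 p" "v \<in> C_infinity"
    and dv: "partial_deriv (0, 1) v \<in> Lp_space p"
  shows "AE x in lborel. hyperplane_trace p v x = v (x, 0)"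
proof -
  obtain a H where tk: "trace_kernel 1 a H" using trace_kernel_exists[of 1] by auto
  show ?thesis
    using hyperplane_trace_eq[OF p v(1) tk dv has_weak_deriv_C_infinity[OF normal_Basis v(2)]]
    by (simp add: trace_integral_C_infinity[OF tk v(2)])
qed

text \<open>\<open>hyperplane_trace\<close> is chosen separately for each function, so linearity is
  read off from the integral formula with a common trace kernel.\<close>

lemma hyperplane_trace_diff:
  fixes u v :: "'a::euclidean_space \<times> real \<Rightarrow> real"
  assumes p: "p \<ge> 1" and u: "u \<in> sobolev_space 1 p" and v: "v \<in> sobolev_space 1 p"
    and d: "(\<lambda>x. v x - u x) \<in> sobolev_space 1 p"
  shows "AE x in lborel. hyperplane_trace p (\<lambda>x. v x - u x) x = hyperplane_trace p v x - hyperplane_trace p u x"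
proof -
  obtain a H where tk: "trace_kernel 1 a H" using trace_kernel_exists[of 1] by auto
  obtain w where w: "w \<in> Lp_space p" "has_weak_deriv (unit_index (0, 1)) u w"
    using u by (rule sobolev_space_normal_deriv)
  obtain w' where w': "w' \<in> Lp_space p" "has_weak_deriv (unit_index (0, 1)) v w'"
    using v by (rule sobolev_space_normal_deriv)
  have uv: "u \<in> Lp_space p" "v \<in> Lp_space p" using u v by (auto simp: sobolev_space_def)
  have wd: "has_weak_deriv (unit_index (0, 1)) (\<lambda>x. v x - u x) (\<lambda>x. w' x - w x)"
    by (rule has_weak_deriv_diff[OF unit_index_in_multi_indices[OF normal_Basis order_refl] w'(2) w(2)])
  obtain M where M: "\<And>t. \<bar>a t\<bar> \<le> M" using test_function_bound[OF trace_kernelD(1)[OF tk]] by blast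
  have asupp: "a t \<noteq> 0 \<Longrightarrow> t \<in> {0..1}" for t using trace_kernelD(3)[OF tk] by simp
  have d1: "AE x in lborel. fibre_integral a (\<lambda>x. v x - u x) x = fibre_integral a v x - fibre_integral a u x"
    by (rule fibre_integral_diff[OF p test_function_measurable[OF trace_kernelD(1)[OF tk]] M _ compact_Icc uv(2,1)])
      (rule asupp)
  have d2: "AE x in lborel. fibre_integral H (\<lambda>x. w' x - w x) x = fibre_integral H w' x - fibre_integral H w x"
    by (rule fibre_integral_diff[OF p trace_kernelD(5,7)[OF tk] _ compact_Icc w'(1) w(1)])
      (rule trace_kernelD(8)[OF tk])
  show ?thesis
    using hyperplane_trace_eq[OF p d tk Lp_space_diff[OF p w'(1) w(1)] wd]
      hyperplane_trace_eq[OF p u tk w] hyperplane_trace_eq[OF p v tk w'] d1 d2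
    by eventually_elim (simp add: trace_integral_def)
qed

section \<open>Averages over thin slabs\<close>

text \<open>Dominated convergence: the closed slabs shrink to the hyperplane, which is a null
  set.\<close>

lemma slab_mass_small:
  fixes f :: "'a::euclidean_space \<times> real \<Rightarrow> real"
  assumes p: "p \<ge> 1" and f: "f \<in> Lp_space p" and e: "e > 0"
  shows "\<exists>d>0. Lp_mass p (\<lambda>x. indicator {0..d} (snd x) * f x) \<le> ennreal e"
proof -
  have [measurable]: "f \<in> borel_measurable borel" by (rule Lp_space_measurable[OF f])
  let ?d = "\<lambda>n. inverse (real (Suc n))"
  have meas: "(\<lambda>x. indicator {0..?d n} (snd x) * f x) \<in> borel_measurable borel" for n
  proof -
    have [measurable]: "f \<in> borel_measurable (borel \<Otimes>\<^sub>M borel)" by (simp add: borel_prod)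
    have "(\<lambda>x. indicator {0..?d n} (snd x) * f x) \<in> borel_measurable (borel \<Otimes>\<^sub>M borel)" by measurable
    then show ?thesis by (simp add: borel_prod)
  qed
  note [measurable] = meas
  have "AE x in (lborel :: ('a \<times> real) measure). snd x \<noteq> 0"
  proof -
    have "AE x in (lborel \<Otimes>\<^sub>M lborel :: ('a \<times> real) measure). snd x \<noteq> 0"
    proof (rule lborel_pair.AE_pair_measure)
      show "AE x in lborel. AE y in lborel. snd (x :: 'a, y :: real) \<noteq> 0"
        using AE_lborel_singleton[of "0::real"] by simp
    qed measurable
    then show ?thesis unfolding lborel_prod .
  qed
  then have lim: "AE x in lborel. (\<lambda>n. ennreal (\<bar>indicator {0..?d n} (snd x) * f x\<bar> powr p)) \<longlonglongrightarrow> 0"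
  proof eventually_elim
    case (elim x)
    have "\<forall>\<^sub>F n in sequentially. ennreal (\<bar>indicator {0..?d n} (snd x) * f x\<bar> powr p) = 0"
    proof (cases "snd x > 0")
      case True
      then have "\<forall>\<^sub>F n in sequentially. ?d n < snd x"
        using order_tendstoD(2)[OF LIMSEQ_inverse_real_of_nat] by blast
      then show ?thesis by eventually_elim (auto simp: indicator_def)
    next
      case False
      then show ?thesis using elim by (intro always_eventually) (auto simp: indicator_def)
    qed
    then show ?case by (rule tendsto_eventually)
  qed
  have "(\<lambda>n. Lp_mass p (\<lambda>x. indicator {0..?d n} (snd x) * f x)) \<longlonglongrightarrow> (\<integral>\<^sup>+x. 0 \<partial>(lborel :: ('a \<times> real) measure))"
    unfolding Lp_mass_def
  proof (rule nn_integral_dominated_convergence[where w="\<lambda>x. ennreal (\<bar>f x\<bar> powr p)"])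
    show "(\<integral>\<^sup>+x. ennreal (\<bar>f x\<bar> powr p) \<partial>lborel) < \<infinity>" using f by (simp add: Lp_space_iff Lp_mass_def)
    show "AE x in lborel. ennreal (\<bar>indicator {0..?d n} (snd x) * f x\<bar> powr p) \<le> ennreal (\<bar>f x\<bar> powr p)" for n
      using p by (intro AE_I2 ennreal_leI powr_mono2) (auto simp: indicator_def)
  qed (use lim in measurable)
  then have "(\<lambda>n. Lp_mass p (\<lambda>x. indicator {0..?d n} (snd x) * f x)) \<longlonglongrightarrow> 0" by simp
  then have "\<forall>\<^sub>F n in sequentially. Lp_mass p (\<lambda>x. indicator {0..?d n} (snd x) * f x) < ennreal e"
    using e by (intro order_tendstoD(2)) auto
  then obtain n where "Lp_mass p (\<lambda>x. indicator {0..?d n} (snd x) * f x) < ennreal e"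
    by (auto simp: eventually_sequentially)
  then show ?thesis by (intro exI[of _ "?d n"]) auto
qed

text \<open>The difference is exactly the fibre integral of \<open>H\<close> against the normal
  derivative, hence controlled by the mass of that derivative in the slab. The width d is fixed
  before the kernel, which may then be any kernel of smaller width.\<close>

lemma fibre_integral_near_trace:
  fixes u :: "'a::euclidean_space \<times> real \<Rightarrow> real"
  assumes p: "p \<ge> 1" and u: "u \<in> sobolev_space 1 p" and e: "e > 0"
  shows "\<exists>d>0. \<forall>a H \<delta>. trace_kernel \<delta> a H \<longrightarrow> \<delta> \<le> d \<longrightarrow>
    Lp_mass p (\<lambda>x. fibre_integral a u x - hyperplane_trace p u x) \<le> ennreal e"
proof -
  obtain w where w: "w \<in> Lp_space p" "has_weak_deriv (unit_index (0, 1)) u w"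
    using u by (rule sobolev_space_normal_deriv)
  note [measurable] = Lp_space_measurable[OF w(1)]
  obtain d where d: "d > 0" "Lp_mass p (\<lambda>x. indicator {0..d} (snd x) * w x) \<le> ennreal e"
    using slab_mass_small[OF p w(1) e] by blast
  show ?thesis
  \<comment> \<open>Width at most 1 gives \<open>H\<close> an L^1 norm at most 1 and so makes the
    constant in the fibre estimate at most 1.\<close>
  proof (intro exI[of _ "min d 1"] conjI allI impI)
    fix a H \<delta> assume tk: "trace_kernel \<delta> a H" and \<delta>: "\<delta> \<le> min d 1"
    note H = trace_kernelD(5-8)[OF tk] and Hi = trace_kernel_integrable(2)[OF tk]
    have "(\<integral>t. \<bar>H t\<bar> \<partial>lborel) \<le> (\<integral>t. indicator {0..1} t \<partial>(lborel :: real measure))"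
    proof (rule integral_mono)
      show "\<bar>H t\<bar> \<le> indicator {0..1} t" for t
        using H(2)[of t] \<delta> by (auto split: split_indicator_asm split_indicator)
    qed (use Hi in auto)
    then have "(\<integral>t. \<bar>H t\<bar> \<partial>lborel) powr (p - 1) \<le> 1 powr (p - 1)"
      using p by (intro powr_mono2) auto
    then have H1: "(\<integral>t. \<bar>H t\<bar> \<partial>lborel) powr (p - 1) * 1 \<le> 1" by simp
    have Hd: "t \<in> {0..d}" if "H t \<noteq> 0" for t using H(4)[OF that] \<delta> by auto
    have "Lp_mass p (\<lambda>x. fibre_integral a u x - hyperplane_trace p u x) = Lp_mass p (fibre_integral H w)"
      using hyperplane_trace_eq[OF p u tk w]
      by (intro Lp_mass_cong_AE) (simp add: trace_integral_def eventually_mono)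
    also have "\<dots> \<le> ennreal ((\<integral>t. \<bar>H t\<bar> \<partial>lborel) powr (p - 1) * 1) * Lp_mass p (\<lambda>x. indicator {0..d} (snd x) * w x)"
      by (rule Lp_mass_fibre_integral_le[OF p Hi H(3)]) (use Hd in auto)
    also have "\<dots> \<le> 1 * ennreal e"
      using H1 d(2) by (intro mult_mono) auto
    finally show "Lp_mass p (\<lambda>x. fibre_integral a u x - hyperplane_trace p u x) \<le> ennreal e" by simp
  qed (use d in auto)
qed

section \<open>Supports\<close>

text \<open>The union defining the support may be uncountable; Lindelof's theorem replaces it by a
  countable one, so that the exceptional null sets can be united.\<close>

lemma AE_zero_outside_ae_support:
  fixes f :: "'a::euclidean_space \<Rightarrow> real"
  shows "AE x in lborel. x \<notin> ae_support f \<longrightarrow> f x = 0"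
proof -
  let ?F = "{U. open U \<and> (AE x in lborel. x \<in> U \<longrightarrow> f x = 0)}"
  obtain F' where F': "F' \<subseteq> ?F" "countable F'" "\<Union>F' = \<Union>?F"
    using Lindelof[of ?F] by blast
  have "AE x in lborel. \<forall>U\<in>F'. x \<in> U \<longrightarrow> f x = 0"
    using F'(1,2) by (subst AE_ball_countable) auto
  then show ?thesis
  proof eventually_elim
    case (elim x)
    show ?case
    proof
      assume "x \<notin> ae_support f"
      then have "x \<in> \<Union>F'" unfolding F'(3) ae_support_def by blast
      then show "f x = 0" using elim by blast
    qed
  qed
qed

lemma closed_ae_support: "closed (ae_support f)"
  unfolding ae_support_def by (intro closed_Compl open_Union) auto

text \<open>A closed set plus a compact one is closed, so its complement qualifies as one of the
  open sets in the definition of the support; at points of this complement the kernel meets only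
  points outside the support of \<open>u\<close>.\<close>

lemma ae_support_convolve:
  fixes K u :: "'a::euclidean_space \<Rightarrow> real"
  assumes [measurable]: "K \<in> borel_measurable borel" "u \<in> borel_measurable borel"
    and K: "\<And>x. K x \<noteq> 0 \<Longrightarrow> norm x \<le> r"
  shows "ae_support (convolve K u) \<subseteq> ae_support u + cball 0 r"
proof -
  let ?S = "ae_support u + cball 0 r"
  have "?S = (\<Union>x\<in>ae_support u. \<Union>y\<in>cball 0 r. {x + y})"
    by (auto simp: set_plus_def)
  then have "closed ?S"
    using closed_compact_sums[OF closed_ae_support[of u] compact_cball[of 0 r]] by simp
  moreover have "convolve K u x = 0" if x: "x \<notin> ?S" for x
  proof -
    have "AE y in lborel. K (x - y) * u y = 0"
      using AE_zero_outside_ae_support[of u]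
    proof eventually_elim
      case (elim y)
      have "K (x - y) = 0" if "y \<in> ae_support u"
      proof (rule ccontr)
        assume "K (x - y) \<noteq> 0"
        then have "x - y \<in> cball 0 r" using K by simp
        then have "y + (x - y) \<in> ?S" using that by (intro set_plus_intro)
        then show False using x by simp
      qed
      then show ?case using elim by auto
    qed
    then have "convolve K u x = (\<integral>y. 0 \<partial>(lborel :: 'a measure))"
      unfolding convolve_def by (intro integral_cong_AE) auto
    then show ?thesis by simp
  qed
  ultimately have "- ?S \<in> {U. open U \<and> (AE x in lborel. x \<in> U \<longrightarrow> convolve K u x = 0)}"
    by (auto simp: open_Compl)
  then show ?thesis unfolding ae_support_def by blast
qed

section \<open>Anisotropic mollification\<close>

text \<open>The sign in \<open>- snd z\<close> turns the convolution at x_N = 0 into an average with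
  density \<open>a\<close> over the side x_N > 0, to which the trace formula refers.\<close>

definition tensor_kernel :: "('a::euclidean_space \<Rightarrow> real) \<Rightarrow> (real \<Rightarrow> real) \<Rightarrow> 'a \<times> real \<Rightarrow> real" where
  "tensor_kernel \<rho> a z = \<rho> (fst z) * a (- snd z)"

text \<open>Both components have size at most r / 2 on the support, so their sum bounds the norm by
  r; the masses multiply by Fubini's theorem.\<close>

lemma mollifier_tensor_kernel:
  fixes \<rho> :: "'a::euclidean_space \<Rightarrow> real"
  assumes \<rho>: "mollifier (r / 2) \<rho>" and tk: "trace_kernel \<delta> a H" and \<delta>: "\<delta> \<le> r / 2"
  shows "mollifier r (tensor_kernel \<rho> a)"
proof -
  note t\<rho> = mollifier_test_function[OF \<rho>] and ta = trace_kernelD(1)[OF tk]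
  have "(\<lambda>z :: 'a \<times> real. \<rho> (0 + fst z)) \<in> C_infinity"
    by (rule C_infinity_compose_affine[OF test_function_C_infinity[OF t\<rho>]]) (simp add: linear_iff)
  moreover have "(\<lambda>z :: 'a \<times> real. a (0 + - snd z)) \<in> C_infinity"
    by (rule C_infinity_compose_affine[OF test_function_C_infinity[OF ta]]) (simp add: linear_iff)
  ultimately have C: "tensor_kernel \<rho> a \<in> C_infinity"
    using C_infinity_mult[of "\<lambda>z :: 'a \<times> real. \<rho> (0 + fst z)" "\<lambda>z. a (0 + - snd z)"]
    by (simp add: tensor_kernel_def[abs_def])
  have supp: "norm z \<le> r" if "tensor_kernel \<rho> a z \<noteq> 0" for z
  proof -
    have "norm (fst z) \<le> r / 2" using that mollifier_support[OF \<rho>] by (simp add: tensor_kernel_def)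
    moreover have "norm (snd z) \<le> r / 2"
      using that trace_kernelD(3)[OF tk, of "- snd z"] \<delta> by (auto simp: tensor_kernel_def)
    ultimately show ?thesis
      using norm_Pair_le[of "fst z" "snd z"] by simp
  qed
  have test: "test_function (tensor_kernel \<rho> a)"
    using C supp test_function_iff by blast
  have a': "integrable lborel (\<lambda>t. a (- t))" "(\<integral>t. a (- t) \<partial>lborel) = 1"
    using integrable_lborel_reflect[OF test_function_integrable[OF ta], of 0]
      integral_lborel_reflect[OF test_function_measurable[OF ta], of 0] trace_kernelD(4)[OF tk] by simp_all
  have int: "integrable (lborel \<Otimes>\<^sub>M lborel) (\<lambda>(x, t). \<rho> x * a (- t))"
    by (rule integrable_pair_mult[OF test_function_integrable[OF t\<rho>] a'(1)])
  have "(\<integral>z. tensor_kernel \<rho> a z \<partial>lborel) = (\<integral>z. (case z of (x, t) \<Rightarrow> \<rho> x * a (- t)) \<partial>(lborel \<Otimes>\<^sub>M lborel))"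
    unfolding lborel_prod by (simp add: tensor_kernel_def case_prod_beta)
  also have "\<dots> = (\<integral>x. \<integral>t. \<rho> x * a (- t) \<partial>lborel \<partial>lborel)"
    using lborel_pair.integral_fst'[OF int] by simp
  also have "\<dots> = 1"
    using a' \<rho> by (simp add: mollifier_def)
  finally show ?thesis
    using test supp \<rho> trace_kernelD(2)[OF tk] by (auto simp: mollifier_def tensor_kernel_def)
qed

text \<open>On the hyperplane the normal factor is integrated out first, and a purely tangential
  convolution remains.\<close>

lemma convolve_tensor_kernel:
  fixes \<rho> :: "'a::euclidean_space \<Rightarrow> real"
  assumes "test_function (tensor_kernel \<rho> a)" "locally_integrable u"
  shows "convolve (tensor_kernel \<rho> a) u (x, 0) = convolve \<rho> (fibre_integral a u) x"
proof -
  have "integrable lborel (\<lambda>z. tensor_kernel \<rho> a ((x, 0) - z) * u z)"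
    by (rule convolve_integrable[OF assms])
  then have int: "integrable (lborel \<Otimes>\<^sub>M lborel) (\<lambda>z. tensor_kernel \<rho> a ((x, 0) - z) * u z)"
    by (simp add: lborel_prod)
  have "convolve (tensor_kernel \<rho> a) u (x, 0) =
      (\<integral>z. tensor_kernel \<rho> a ((x, 0) - z) * u z \<partial>(lborel \<Otimes>\<^sub>M lborel))"
    by (simp add: convolve_def lborel_prod)
  also have "\<dots> = (\<integral>y. \<integral>t. tensor_kernel \<rho> a ((x, 0) - (y, t)) * u (y, t) \<partial>lborel \<partial>lborel)"
    using lborel_pair.integral_fst'[OF int] by simp
  also have "\<dots> = (\<integral>y. \<integral>t. \<rho> (x - y) * (a t * u (y, t)) \<partial>lborel \<partial>lborel)"
    by (simp add: tensor_kernel_def mult.assoc)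
  also have "\<dots> = convolve \<rho> (fibre_integral a u) x"
    by (simp add: convolve_def fibre_integral_def)
  finally show ?thesis .
qed

text \<open>\<open>W\<close> and \<open>Z\<close> are explicit weak derivatives of the difference
  and of its trace, so that the estimates avoid norms defined through choice operators. The order of
  choices matters: the radius for the interior, then \<open>\<rho>\<close>, then the constants
  depending on \<open>\<rho>\<close>, and only then \<open>\<delta>\<close>.\<close>

lemma approximation_step:
  fixes u :: "'a::euclidean_space \<times> real \<Rightarrow> real"
  assumes k: "k \<ge> 1" and p: "p \<ge> 1" and u: "u \<in> trace_sobolev_space k l p" and r: "r > 0" and e: "e > 0"
  shows "\<exists>v W Z. v \<in> trace_sobolev_space k l p \<and> v \<in> C_infinity \<and>
    ae_support v \<subseteq> ae_support u + cball 0 r \<and>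
    (\<forall>\<alpha>\<in>multi_indices k. has_weak_deriv \<alpha> (\<lambda>x. v x - u x) (W \<alpha>) \<and> Lp_mass p (W \<alpha>) \<le> ennreal e) \<and>
    (\<forall>\<beta>\<in>multi_indices l. has_weak_deriv \<beta> (hyperplane_trace p (\<lambda>x. v x - u x)) (Z \<beta>) \<and> Lp_mass p (Z \<beta>) \<le> ennreal e)"
proof -
  define g where "g = hyperplane_trace p u"
  have uk: "u \<in> sobolev_space k p" and gl: "g \<in> sobolev_space l p"
    using u by (auto simp: trace_sobolev_space_def g_def)
  have u1: "u \<in> sobolev_space 1 p" by (rule sobolev_space_mono[OF uk k])
  have uL: "u \<in> Lp_space p" and gL: "g \<in> Lp_space p"
    using uk gl by (auto simp: sobolev_space_def)
  have lu: "locally_integrable u" and lg: "locally_integrable g"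
    by (intro Lp_imp_locally_integrable[OF p] uL gL)+
  obtain w where w: "\<And>\<alpha>. \<alpha> \<in> multi_indices k \<Longrightarrow> w \<alpha> \<in> Lp_space p" "\<And>\<alpha>. \<alpha> \<in> multi_indices k \<Longrightarrow> has_weak_deriv \<alpha> u (w \<alpha>)"
    using uk unfolding sobolev_space_def mem_Collect_eq by metis
  obtain h where h: "\<And>\<beta>. \<beta> \<in> multi_indices l \<Longrightarrow> h \<beta> \<in> Lp_space p" "\<And>\<beta>. \<beta> \<in> multi_indices l \<Longrightarrow> has_weak_deriv \<beta> g (h \<beta>)"
    using gl unfolding sobolev_space_def mem_Collect_eq by metis
  \<comment> \<open>Each of the two error terms of the trace gets half of \<open>e\<close>, divided
    by the constant of the triangle inequality for masses.\<close>
  define e' where "e' = e / (2 * 2 powr p)"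
  have e': "e' > 0" using e by (simp add: e'_def)
  have e'e: "ennreal (2 powr p) * (ennreal e' + ennreal e') = ennreal e"
    using e' by (simp add: e'_def ennreal_mult[symmetric] ennreal_plus[symmetric] del: ennreal_plus)
  obtain d1 where d1: "d1 > 0" "\<And>K. mollifier d1 K \<Longrightarrow> \<forall>\<alpha>\<in>multi_indices k. Lp_mass p (\<lambda>x. convolve K (w \<alpha>) x - w \<alpha> x) \<le> ennreal e"
    using mollify_Lp_finite[where f=w, OF p finite_multi_indices[of k] w(1) e] by blast
  obtain d2 where d2: "d2 > 0" "\<And>K. mollifier d2 K \<Longrightarrow> \<forall>\<beta>\<in>multi_indices l. Lp_mass p (\<lambda>x. convolve K (h \<beta>) x - h \<beta> x) \<le> ennreal e'"
    using mollify_Lp_finite[where f=h, OF p finite_multi_indices[of l] h(1) e'] by blast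
  \<comment> \<open>Radius of the full kernel, small enough for the W^(k,p) error and for the
    support condition.\<close>
  define s where "s = min d1 r"
  have s: "s > 0" using d1 r by (simp add: s_def)
  obtain \<rho> :: "'a \<Rightarrow> real" where \<rho>: "mollifier (min (s / 2) d2) \<rho>"
    using mollifier_exists[of "min (s / 2) d2"] s d2 by auto
  note t\<rho> = mollifier_test_function[OF \<rho>]
  define c where "c \<beta> = (\<integral>x. \<bar>multi_deriv \<beta> \<rho> x\<bar> \<partial>lborel) powr p" for \<beta>
  \<comment> \<open>One constant for all \<open>c \<beta>\<close>; the summand 1 makes it positive,
    so that division by it is safe.\<close>
  define C where "C = 1 + (\<Sum>\<beta>\<in>multi_indices l. c \<beta>)"
  have c0: "c \<beta> \<ge> 0" for \<beta> by (simp add: c_def)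
  have C1: "C \<ge> 1" unfolding C_def using c0 by (simp add: sum_nonneg)
  have cC: "c \<beta> \<le> C" if "\<beta> \<in> multi_indices l" for \<beta>
    using member_le_sum[OF that, of c] c0 finite_multi_indices[of l] unfolding C_def by force
  obtain d3 where d3: "d3 > 0" "\<And>a H \<delta>. trace_kernel \<delta> a H \<Longrightarrow> \<delta> \<le> d3 \<Longrightarrow>
     Lp_mass p (\<lambda>x. fibre_integral a u x - g x) \<le> ennreal (e' / C)"
    using fibre_integral_near_trace[OF p u1, of "e' / C"] e' C1 unfolding g_def by auto
  \<comment> \<open>By now \<open>\<rho>\<close> and \<open>C\<close> are fixed; shrinking
    \<open>\<delta>\<close> further does not affect them and keeps the full kernel within radius
    \<open>s\<close>.\<close>
  define \<delta> where "\<delta> = min (s / 2) d3"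
  obtain a H where tk: "trace_kernel \<delta> a H"
    using trace_kernel_exists[of \<delta>] s d3 by (auto simp: \<delta>_def)
  define K where "K = tensor_kernel \<rho> a"
  have K: "mollifier s K"
    unfolding K_def by (rule mollifier_tensor_kernel[OF mollifier_mono[OF \<rho>] tk]) (auto simp: \<delta>_def)
  note tK = mollifier_test_function[OF K]
  define v where "v = convolve K u"
  have vC: "v \<in> C_infinity" unfolding v_def by (rule convolve_C_infinity[OF tK lu])
  have KL: "convolve K f \<in> Lp_space p" if "f \<in> Lp_space p" for f
    by (rule convolve_Lp[OF p test_function_integrable[OF tK] that])
  have vw: "has_weak_deriv \<alpha> v (convolve K (w \<alpha>))" if "\<alpha> \<in> multi_indices k" for \<alpha>
    unfolding v_def by (rule has_weak_deriv_convolve[OF that w(2)[OF that] tK])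
  have vk: "v \<in> sobolev_space k p"
    unfolding sobolev_space_def using vw KL[OF w(1)] KL[OF uL] by (auto simp: v_def)
  have v1: "v \<in> sobolev_space 1 p" by (rule sobolev_space_mono[OF vk k])
  have dw: "has_weak_deriv \<alpha> (\<lambda>x. v x - u x) (\<lambda>x. convolve K (w \<alpha>) x - w \<alpha> x)" if "\<alpha> \<in> multi_indices k" for \<alpha>
    by (rule has_weak_deriv_diff[OF that vw[OF that] w(2)[OF that]])
  have "(\<lambda>x. v x - u x) \<in> sobolev_space k p"
    unfolding sobolev_space_def
  proof (intro CollectI conjI ballI)
    show "(\<lambda>x. v x - u x) \<in> Lp_space p"
      unfolding v_def by (intro Lp_space_diff[OF p] KL uL)
    show "\<exists>z\<in>Lp_space p. has_weak_deriv \<alpha> (\<lambda>x. v x - u x) z" if "\<alpha> \<in> multi_indices k" for \<alpha>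
      using dw[OF that] Lp_space_diff[OF p KL[OF w(1)[OF that]] w(1)[OF that]] by blast
  qed
  then have vu1: "(\<lambda>x. v x - u x) \<in> sobolev_space 1 p" by (rule sobolev_space_mono[OF _ k])
  define A where "A = fibre_integral a u"
  obtain M where M: "\<And>t. \<bar>a t\<bar> \<le> M" using test_function_bound[OF trace_kernelD(1)[OF tk]] by blast
  have AL: "A \<in> Lp_space p"
    unfolding A_def by (rule fibre_integral_Lp[OF p trace_kernel_integrable(1)[OF tk] M uL])
  have lA: "locally_integrable A" by (rule Lp_imp_locally_integrable[OF p AL])
  have v0: "v (x, 0) = convolve \<rho> A x" for x
    unfolding v_def A_def K_def by (rule convolve_tensor_kernel[OF tK[unfolded K_def] lu])
  have "partial_deriv (0, 1) v \<in> Lp_space p"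
    unfolding v_def partial_deriv_convolve[OF tK lu normal_Basis]
    by (rule convolve_Lp[OF p test_function_integrable[OF test_function_partial_deriv[OF tK normal_Basis]] uL])
  then have trv: "AE x in lborel. hyperplane_trace p v x = convolve \<rho> A x"
    using hyperplane_trace_C_infinity[OF p v1 vC] by (simp add: v0)
  have trvL: "hyperplane_trace p v \<in> Lp_space p" by (rule hyperplane_trace_Lp[OF p v1])
  have trvu: "AE x in lborel. hyperplane_trace p (\<lambda>x. v x - u x) x = convolve \<rho> A x - g x"
    using hyperplane_trace_diff[OF p u1 v1 vu1] trv by eventually_elim (simp add: g_def)
  have trvuL: "hyperplane_trace p (\<lambda>x. v x - u x) \<in> Lp_space p" by (rule hyperplane_trace_Lp[OF p vu1])
  have \<rho>\<beta>: "test_function (multi_deriv \<beta> \<rho>)" if "\<beta> \<in> multi_indices l" for \<beta>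
    by (rule test_function_multi_deriv[OF that t\<rho>])
  have "hyperplane_trace p v \<in> sobolev_space l p"
    unfolding sobolev_space_def
  proof (intro CollectI conjI ballI trvL)
    fix \<beta> :: "'a \<Rightarrow> nat" assume \<beta>: "\<beta> \<in> multi_indices l"
    \<comment> \<open>All derivatives fall on \<open>\<rho>\<close>, because of the average
      \<open>A\<close> only membership in L^p is known.\<close>
    have "has_weak_deriv \<beta> (hyperplane_trace p v) (convolve (multi_deriv \<beta> \<rho>) A)"
      by (rule has_weak_deriv_cong_AE[OF \<beta> has_weak_deriv_convolve_kernel[OF \<beta> lA t\<rho>]])
        (use trv Lp_space_measurable[OF trvL] in \<open>auto elim: eventually_mono\<close>)
    moreover have "convolve (multi_deriv \<beta> \<rho>) A \<in> Lp_space p"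
      by (rule convolve_Lp[OF p test_function_integrable[OF \<rho>\<beta>[OF \<beta>]] AL])
    ultimately show "\<exists>z\<in>Lp_space p. has_weak_deriv \<beta> (hyperplane_trace p v) z" by blast
  qed
  with vk have vtr: "v \<in> trace_sobolev_space k l p" by (simp add: trace_sobolev_space_def)
  have supp: "ae_support v \<subseteq> ae_support u + cball 0 r"
    unfolding v_def
    by (rule ae_support_convolve)
      (use mollifier_support[OF K] test_function_measurable[OF tK] Lp_space_measurable[OF uL] in \<open>force simp: s_def\<close>)+
  \<comment> \<open>The two terms use different rules: the kernel takes the derivative where only
    the L^p distance of \<open>A\<close> and \<open>g\<close> is small, and \<open>g\<close> takes
    it where its weak derivative \<open>h \<beta>\<close> is available.\<close>
  define Z where "Z \<beta> x = convolve (multi_deriv \<beta> \<rho>) (\<lambda>x. A x - g x) x + (convolve \<rho> (h \<beta>) x - h \<beta> x)" for \<beta> x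
  have Z: "has_weak_deriv \<beta> (hyperplane_trace p (\<lambda>x. v x - u x)) (Z \<beta>) \<and> Lp_mass p (Z \<beta>) \<le> ennreal e"
    if \<beta>: "\<beta> \<in> multi_indices l" for \<beta>
  proof
    have "has_weak_deriv \<beta> (\<lambda>x. convolve \<rho> (\<lambda>x. A x - g x) x + (convolve \<rho> g x - g x)) (Z \<beta>)"
      unfolding Z_def
      by (intro has_weak_deriv_add[OF \<beta>] has_weak_deriv_diff[OF \<beta>] has_weak_deriv_convolve_kernel[OF \<beta>]
          has_weak_deriv_convolve[OF \<beta>] locally_integrable_diff lA lg t\<rho> h(2)[OF \<beta>])
    then show "has_weak_deriv \<beta> (hyperplane_trace p (\<lambda>x. v x - u x)) (Z \<beta>)"
    proof (rule has_weak_deriv_cong_AE[OF \<beta>])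
      show "AE x in lborel. convolve \<rho> (\<lambda>x. A x - g x) x + (convolve \<rho> g x - g x) = hyperplane_trace p (\<lambda>x. v x - u x) x"
        using trvu by eventually_elim (simp add: convolve_diff[OF t\<rho> lA lg])
    qed (rule Lp_space_measurable[OF trvuL])
    note [measurable] = Lp_space_measurable[OF AL] Lp_space_measurable[OF gL] Lp_space_measurable[OF h(1)[OF \<beta>]]
      test_function_measurable[OF \<rho>\<beta>[OF \<beta>]] test_function_measurable[OF t\<rho>]
    have "Lp_mass p (convolve (multi_deriv \<beta> \<rho>) (\<lambda>x. A x - g x)) \<le> ennreal (c \<beta>) * Lp_mass p (\<lambda>x. A x - g x)"
      unfolding c_def by (rule Lp_mass_convolve_le[OF p test_function_integrable[OF \<rho>\<beta>[OF \<beta>]]]) measurable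
    also have "\<dots> \<le> ennreal C * ennreal (e' / C)"
      using cC[OF \<beta>] d3(2)[OF tk] by (intro mult_mono ennreal_leI) (auto simp: A_def \<delta>_def)
    also have "\<dots> = ennreal e'" using C1 e' by (simp add: ennreal_mult[symmetric])
    finally have b1: "Lp_mass p (convolve (multi_deriv \<beta> \<rho>) (\<lambda>x. A x - g x)) \<le> ennreal e'" .
    have b2: "Lp_mass p (\<lambda>x. convolve \<rho> (h \<beta>) x - h \<beta> x) \<le> ennreal e'"
      using d2(2)[OF mollifier_mono[OF \<rho>]] \<beta> by simp
    have "Lp_mass p (Z \<beta>) \<le> ennreal (2 powr p) * (Lp_mass p (convolve (multi_deriv \<beta> \<rho>) (\<lambda>x. A x - g x)) +
       Lp_mass p (\<lambda>x. convolve \<rho> (h \<beta>) x - h \<beta> x))"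
      unfolding Z_def by (rule Lp_mass_add_le[OF p]) measurable
    also have "\<dots> \<le> ennreal (2 powr p) * (ennreal e' + ennreal e')"
      by (intro mult_left_mono add_mono b1 b2) simp
    finally show "Lp_mass p (Z \<beta>) \<le> ennreal e" by (simp only: e'e)
  qed
  have "\<forall>\<alpha>\<in>multi_indices k. Lp_mass p (\<lambda>x. convolve K (w \<alpha>) x - w \<alpha> x) \<le> ennreal e"
    by (rule d1(2)[OF mollifier_mono[OF K]]) (simp add: s_def)
  with dw Z vtr vC supp show ?thesis
    by (intro exI[of _ v] exI[of _ "\<lambda>\<alpha> x. convolve K (w \<alpha>) x - w \<alpha> x"] exI[of _ Z]) blast
qed

theorem theorem2:
  fixes u :: "'a::euclidean_space \<times> real \<Rightarrow> real"
    and k l :: nat and p :: real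
  assumes "k \<ge> 1" and "l \<ge> 1" and "p \<ge> 1"
    and "u \<in> trace_sobolev_space k l p"
  shows "\<exists>v :: nat \<Rightarrow> 'a \<times> real \<Rightarrow> real.
    (\<forall>n\<ge>1. v n \<in> trace_sobolev_space k l p \<inter> C_infinity) \<and>
    (\<forall>n\<ge>1. ae_support (v n) \<subseteq> ae_support u + closure (ball 0 (1 / real n))) \<and>
    (\<lambda>n. trace_sobolev_norm k l p (\<lambda>x. v n x - u x)) \<longlonglongrightarrow> 0"
proof -
  \<comment> \<open>The maximum keeps the radius positive at n = 0, where no support condition is
    imposed. The same number serves as radius and as error bound.\<close>
  define r where "r n = 1 / real (max n 1)" for n
  have r: "r n > 0" for n by (simp add: r_def)
  define P where "P n v W Z \<longleftrightarrow> v \<in> trace_sobolev_space k l p \<and> v \<in> C_infinity \<and>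
    ae_support v \<subseteq> ae_support u + cball 0 (r n) \<and>
    (\<forall>\<alpha>\<in>multi_indices k. has_weak_deriv \<alpha> (\<lambda>x. v x - u x) (W \<alpha>) \<and> Lp_mass p (W \<alpha>) \<le> ennreal (r n)) \<and>
    (\<forall>\<beta>\<in>multi_indices l. has_weak_deriv \<beta> (hyperplane_trace p (\<lambda>x. v x - u x)) (Z \<beta>) \<and> Lp_mass p (Z \<beta>) \<le> ennreal (r n))"
    for n :: nat and v W Z
  have "\<exists>v W Z. P n v W Z" for n
    unfolding P_def by (rule approximation_step[OF assms(1,3,4) r r])
  then obtain v W Z where P: "\<And>n. P n (v n) (W n) (Z n)"
    by metis
  have v: "v n \<in> trace_sobolev_space k l p" "v n \<in> C_infinity"
    "ae_support (v n) \<subseteq> ae_support u + cball 0 (r n)" for n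
    using P[of n] by (simp_all add: P_def)
  have W: "\<alpha> \<in> multi_indices k \<Longrightarrow> has_weak_deriv \<alpha> (\<lambda>x. v n x - u x) (W n \<alpha>)"
    "\<alpha> \<in> multi_indices k \<Longrightarrow> Lp_mass p (W n \<alpha>) \<le> ennreal (r n)" for n \<alpha>
    using P[of n] by (simp_all add: P_def)
  have Z: "\<beta> \<in> multi_indices l \<Longrightarrow> has_weak_deriv \<beta> (hyperplane_trace p (\<lambda>x. v n x - u x)) (Z n \<beta>)"
    "\<beta> \<in> multi_indices l \<Longrightarrow> Lp_mass p (Z n \<beta>) \<le> ennreal (r n)" for n \<beta>
    using P[of n] by (simp_all add: P_def)
  have "r \<longlonglongrightarrow> 0"
  proof (rule Lim_transform_eventually[OF lim_1_over_n])
    show "\<forall>\<^sub>F n in sequentially. 1 / of_nat n = r n"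
      using eventually_ge_at_top[of 1] by eventually_elim (simp add: r_def max_def)
  qed
  then have r0: "(\<lambda>n. ennreal (r n)) \<longlonglongrightarrow> 0" using tendsto_ennrealI by fastforce
  have "(\<lambda>n. sobolev_norm k p (\<lambda>x. v n x - u x)) \<longlonglongrightarrow> 0"
    by (rule sobolev_norm_tendsto_0I[OF assms(3)]) (fact W(1), rule tendsto_0_le[OF W(2) r0])
  moreover have "(\<lambda>n. sobolev_norm l p (hyperplane_trace p (\<lambda>x. v n x - u x))) \<longlonglongrightarrow> 0"
    by (rule sobolev_norm_tendsto_0I[OF assms(3)]) (fact Z(1), rule tendsto_0_le[OF Z(2) r0])
  ultimately have "(\<lambda>n. trace_sobolev_norm k l p (\<lambda>x. v n x - u x)) \<longlonglongrightarrow> 0"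
    unfolding trace_sobolev_norm_def using tendsto_add_zero by blast
  \<comment> \<open>A closed ball of positive radius is the closure of the open one, and
    \<open>r n\<close> equals 1 / n from n = 1 on.\<close>
  moreover have "ae_support (v n) \<subseteq> ae_support u + closure (ball 0 (1 / real n))" if "n \<ge> 1" for n
    using v(3)[of n] that by (simp add: r_def max_def)
  ultimately show ?thesis
    using v(1,2) by blast
qed

end
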